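(* Let $d\in\mathbb{N}\setminus\{0\}$ and let $\Omega$ be any non-empty open bounded subset of $\mathbb{R}^d$. Then $H^1_{\rm tr}(\Omega)$ is closed in $H^1(\Omega)$, and therefore contains the closure $\widetilde{H}^1(\Omega)$ of $H^1(\Omega)\cap C^0(\overline\Omega)$ in $H^1(\Omega)$. Moreover, the operator ${\rm tr}:H^1_{\rm tr}(\Omega)\to L^2(\partial\Omega,(\mu_\theta)_{\theta\in\mathcal{S}})$ is continuous and, for all $u,v\in H^1_{\rm tr}(\Omega)$ and $\theta\in\mathcal{S}$, $$\int_\Omega\big(u(x)\partial_\theta v(x)+v(x)\partial_\theta u(x)\big)\mathrm{d}x=\int_{\partial\Omega}\frac{{\rm tr}(u)(z)\,{\rm tr}(v)(z)-{\rm tr}(u)(z_{-\theta}(z))\,{\rm tr}(v)(z_{-\theta}(z))}{|z-z_{-\theta}(z)|}\,\mathrm{d}\mu_\theta(z).$$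
   Context: $\Omega\subset\mathbb{R}^d$ is a non-empty bounded open set, $\partial\Omega=\overline\Omega\setminus\Omega$, $\mathcal{S}=\{x\in\mathbb{R}^d:|x|=1\}$ (Euclidean norm), and $]a,b[$ denotes an open interval. For $\theta\in\mathcal{S}$ and $x\in\Omega$, $\delta_\theta(x)=\sup\{s\in[0,+\infty):\ \forall t\in[0,s[,\ x+t\theta\in\Omega\}$ and $z_\theta(x)=x+\delta_\theta(x)\theta\in\partial\Omega$. Put $\partial_\theta\Omega=z_\theta(\Omega)$. The function $z_{-\theta}$ is extended to $\partial_\theta\Omega$ by setting, for $z=z_\theta(x)$ with $x\in\Omega$, $z_{-\theta}(z)=z_{-\theta}(x)$ (independent of the choice of $x$). Directional measure: $\mu_\theta$ is the finite measure on the Borel sets of $\partial\Omega$ given by $\mu_\theta(A)=\int_\Omega\chi_A(z_\theta(x))\,\mathrm{d}x$. One has $\mu_\theta(\partial\Omega\setminus\partial_\theta\Omega)=0$. $H_\theta$ is the hyperplane through $0$ orthogonal to $\theta$, $\mathcal{P}_\theta(x)=x-(x\cdot\theta)\theta$, and $\lambda^{d-1}$ is the $(d-1)$-dimensional Lebesgue measure on $H_\theta$. For $y\in H_\theta$, $\omega_\theta(y)=\{s\in\mathbb{R}: s\theta+y\in\Omega\}$; for $y\in\mathcal{P}_\theta(\Omega)$, $\mathcal{I}_\theta(y)$ is the countable set of disjoint bounded open intervals whose union is $\omega_\theta(y)$. $W_\theta(\Omega)=\{u\in L^2(\Omega):\partial_\theta u\in L^2(\Omega)\}$, where $\partial_\theta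 u$ is the weak directional derivative: $\int_\Omega u\,(\theta\cdot\nabla\varphi)\,\mathrm{d}x=-\int_\Omega \partial_\theta u\,\varphi\,\mathrm{d}x$ for all $\varphi\in C_c^\infty(\Omega)$. One has $H^1(\Omega)=\bigcap_{\theta\in\mathcal{S}}W_\theta(\Omega)$. Directional trace: for $u\in W_\theta(\Omega)$, a function $g:\partial\Omega\to\mathbb{R}$ is a directional trace of $u$ in the direction $\theta$ if there exist a representative of $u$ (still denoted $u$) and a set $A\subset\mathcal{P}_\theta(\Omega)$ such that $\mathcal{P}_\theta(\Omega)\setminus A$ is $\lambda^{d-1}$-negligible and, for any $y\in A$ and any $]\alpha,\beta[\in\mathcal{I}_\theta(y)$, the function $f:]\alpha,\beta[\to\mathbb{R}$, $s\mapsto u(s\theta+y)$ belongs to $H^1(]\alpha,\beta[)$ and $g(\beta\theta+y)$ is the value at $\beta$ of the representative of $f$ in $C^0([\alpha,\beta])$. $\gamma_\theta u$ denotes the set of all directional traces of $u$ in the direction $\theta$; it is an equivalence class, for $\mu_\theta$-a.e. equality, of a Borel measurable function on $\partial\Omega$. $\mathcal{L}^2(\partial\Omega,(\mu_\theta)_{\theta\in\mathcal{S}})$ is the set of all functions $f:\partial\Omega\to\mathbb{R}$ for which there exists $M\ge0$ such that for all $\theta\in\mathcal{S}$ there exists $g_\theta\in\mathcal{L}^2(\partial\Omega,\mu_\theta)$ (square integrable) with $f=g_\theta$ $\mu_\theta$-a.e. and $\int_{\partial\Omega}|g_\theta|^2\,\mathrm{d}\mu_\theta\le M$. Two such functions $f,g$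 are equivalent if $f=g$ $\mu_\theta$-a.e. for all $\theta\in\mathcal{S}$; $L^2(\partial\Omega,(\mu_\theta)_{\theta\in\mathcal{S}})$ is the set of equivalence classes, normed by $\|g\|^2=\sup_{\theta\in\mathcal{S}}\int_{\partial\Omega}|g|^2\,\mathrm{d}\mu_\theta$. $H^1_{\rm tr}(\Omega)$ is the set of all $u\in H^1(\Omega)$ such that there exists $g\in L^2(\partial\Omega,(\mu_\theta)_{\theta\in\mathcal{S}})$ with, for all $\theta\in\mathcal{S}$, $\gamma_\theta u(z)=g(z)$ for $\mu_\theta$-a.e. $z\in\partial\Omega$; then $g$ is unique and is denoted ${\rm tr}(u)$. $H^1_{\rm tr}(\Omega)$ carries the $H^1(\Omega)$ norm. $H^1(\Omega)\cap C^0(\overline\Omega)$ denotes the elements of $H^1(\Omega)$ having a representative which extends continuously to $\overline\Omega$. *)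

theory Defs
  imports "HOL-Analysis.Analysis"
begin

text \<open>Conventions. The space \<open>\<real>\<^sup>d\<close>, \<open>d \<ge> 1\<close>, is an arbitrary type of class \<^class>\<open>euclidean_space\<close>.
  Elements of \<open>L\<^sup>2(\<Omega>)\<close>, \<open>H\<^sup>1(\<Omega>)\<close> and of the boundary space are handled through representatives:
  total functions, of which only the values on \<open>\<Omega>\<close> (resp. \<open>\<partial>\<Omega>\<close>) matter. All the sets of functions
  below are saturated for a.e. equality, and norms become seminorms whose
  kernel is a.e. equality; the topologies are the ones induced by these seminorms.\<close>

definition sq_integrable :: "'b measure \<Rightarrow> ('b \<Rightarrow> real) set" where
  "sq_integrable M = {f \<in> borel_measurable M. integrable M (\<lambda>x. (f x)\<^sup>2)}"

definition seminorm_topology ::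
    "('b \<Rightarrow> real) set \<Rightarrow> (('b \<Rightarrow> real) \<Rightarrow> real) \<Rightarrow> ('b \<Rightarrow> real) topology" where
  "seminorm_topology V N = topology (\<lambda>U. U \<subseteq> V \<and>
     (\<forall>u\<in>U. \<exists>e>0. \<forall>v\<in>V. N (\<lambda>x. v x - u x) < e \<longrightarrow> v \<in> U))"

lemma openin_seminorm_topology:
  "openin (seminorm_topology V N) U \<longleftrightarrow> U \<subseteq> V \<and>
     (\<forall>u\<in>U. \<exists>e>0. \<forall>v\<in>V. N (\<lambda>x. v x - u x) < e \<longrightarrow> v \<in> U)"
proof -
  let ?P = "\<lambda>U. U \<subseteq> V \<and> (\<forall>u\<in>U. \<exists>e>0. \<forall>v\<in>V. N (\<lambda>x. v x - u x) < e \<longrightarrow> v \<in> U)"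
  have "?P (S \<inter> T)" if S: "?P S" and T: "?P T" for S T
  proof (intro conjI ballI)
    show "S \<inter> T \<subseteq> V" using S by blast
    fix u assume u: "u \<in> S \<inter> T"
    obtain d where d: "d > 0" "\<forall>v\<in>V. N (\<lambda>x. v x - u x) < d \<longrightarrow> v \<in> S" using S u by blast
    obtain e where e: "e > 0" "\<forall>v\<in>V. N (\<lambda>x. v x - u x) < e \<longrightarrow> v \<in> T" using T u by blast
    show "\<exists>e>0. \<forall>v\<in>V. N (\<lambda>x. v x - u x) < e \<longrightarrow> v \<in> S \<inter> T"
      using d e by (intro exI[of _ "min d e"]) auto
  qed
  moreover have "?P (\<Union>K)" if "\<forall>S\<in>K. ?P S" for K
    using that by (meson Sup_le_iff UnionE UnionI)
  ultimately have "istopology ?P"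
    unfolding istopology_def by blast
  then show ?thesis
    unfolding seminorm_topology_def by (simp add: topology_inverse')
qed

lemma topspace_seminorm_topology: "topspace (seminorm_topology V N) = V"
proof (rule antisym)
  show "topspace (seminorm_topology V N) \<subseteq> V"
    using openin_seminorm_topology[of V N] openin_topspace by blast
  have "openin (seminorm_topology V N) V"
    by (auto simp: openin_seminorm_topology intro: exI[of _ 1])
  then show "V \<subseteq> topspace (seminorm_topology V N)"
    by (rule openin_subset)
qed


section \<open>Weak directional derivatives and Sobolev spaces\<close>

fun Ck :: "nat \<Rightarrow> ('a::euclidean_space \<Rightarrow> real) \<Rightarrow> bool" where
  "Ck 0 f \<longleftrightarrow> continuous_on UNIV f"
| "Ck (Suc k) f \<longleftrightarrow> (\<forall>x. f differentiable (at x)) \<and>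
     (\<forall>i\<in>Basis. Ck k (\<lambda>x. frechet_derivative f (at x) i))"

text \<open>\<open>C\<^sub>c\<^sup>\<infinity>(\<Omega>)\<close>, its elements being extended by zero to the whole space.\<close>

definition test_functions :: "'a::euclidean_space set \<Rightarrow> ('a \<Rightarrow> real) set" where
  "test_functions \<Omega> = {\<phi>. (\<forall>k. Ck k \<phi>) \<and>
     compact (closure {x. \<phi> x \<noteq> 0}) \<and> closure {x. \<phi> x \<noteq> 0} \<subseteq> \<Omega>}"

text \<open>For differentiable \<open>\<phi>\<close>, \<open>\<theta> \<cdot> \<nabla>\<phi>(x)\<close> is the Frechet derivative of \<open>\<phi>\<close> at \<open>x\<close> applied to \<open>\<theta>\<close>.\<close>

definition has_weak_dir_deriv ::
    "'a::euclidean_space set \<Rightarrow> 'a \<Rightarrow> ('a \<Rightarrow> real) \<Rightarrow> ('a \<Rightarrow> real) \<Rightarrow> bool" where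
  "has_weak_dir_deriv \<Omega> \<theta> u w \<longleftrightarrow> (\<forall>\<phi>\<in>test_functions \<Omega>.
     (LINT x|lebesgue_on \<Omega>. u x * frechet_derivative \<phi> (at x) \<theta>) =
     - (LINT x|lebesgue_on \<Omega>. w x * \<phi> x))"

definition W_dir :: "'a::euclidean_space set \<Rightarrow> 'a \<Rightarrow> ('a \<Rightarrow> real) set" where
  "W_dir \<Omega> \<theta> = {u \<in> sq_integrable (lebesgue_on \<Omega>).
     \<exists>w\<in>sq_integrable (lebesgue_on \<Omega>). has_weak_dir_deriv \<Omega> \<theta> u w}"

definition weak_dir_deriv ::
    "'a::euclidean_space set \<Rightarrow> 'a \<Rightarrow> ('a \<Rightarrow> real) \<Rightarrow> 'a \<Rightarrow> real" where
  "weak_dir_deriv \<Omega> \<theta> u =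
     (SOME w. w \<in> sq_integrable (lebesgue_on \<Omega>) \<and> has_weak_dir_deriv \<Omega> \<theta> u w)"

definition H1 :: "'a::euclidean_space set \<Rightarrow> ('a \<Rightarrow> real) set" where
  "H1 \<Omega> = (\<Inter>i\<in>Basis. W_dir \<Omega> i)"

definition H1_norm :: "'a::euclidean_space set \<Rightarrow> ('a \<Rightarrow> real) \<Rightarrow> real" where
  "H1_norm \<Omega> u = sqrt ((LINT x|lebesgue_on \<Omega>. (u x)\<^sup>2) +
     (\<Sum>i\<in>Basis. LINT x|lebesgue_on \<Omega>. (weak_dir_deriv \<Omega> i u x)\<^sup>2))"

definition H1_topology :: "'a::euclidean_space set \<Rightarrow> ('a \<Rightarrow> real) topology" where
  "H1_topology \<Omega> = seminorm_topology (H1 \<Omega>) (H1_norm \<Omega>)"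

text \<open>\<open>H\<^sup>1(\<Omega>) \<inter> C\<^sup>0(closure \<Omega>)\<close>\<close>

definition H1_C0 :: "'a::euclidean_space set \<Rightarrow> ('a \<Rightarrow> real) set" where
  "H1_C0 \<Omega> = {u \<in> H1 \<Omega>. \<exists>h. continuous_on (closure \<Omega>) h \<and> (AE x in lebesgue_on \<Omega>. h x = u x)}"


section \<open>Boundary points seen from a direction, and directional measures\<close>

definition dir_dist :: "'a::euclidean_space set \<Rightarrow> 'a \<Rightarrow> 'a \<Rightarrow> real" where
  "dir_dist \<Omega> \<theta> x = Sup {s. 0 \<le> s \<and> (\<forall>t\<in>{0..<s}. x + t *\<^sub>R \<theta> \<in> \<Omega>)}"

text \<open>\<open>z\<^sub>\<theta>(x)\<close> for \<open>x \<in> \<Omega>\<close>\<close>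

definition dir_exit :: "'a::euclidean_space set \<Rightarrow> 'a \<Rightarrow> 'a \<Rightarrow> 'a" where
  "dir_exit \<Omega> \<theta> x = x + dir_dist \<Omega> \<theta> x *\<^sub>R \<theta>"

text \<open>The extension of \<open>z\<^bsub>-\<theta>\<^esub>\<close> to \<open>\<partial>\<^sub>\<theta>\<Omega> = z\<^sub>\<theta>(\<Omega>)\<close>; its values outside this set
  are irrelevant since the complement in \<open>\<partial>\<Omega>\<close> is null for \<open>\<mu>\<^sub>\<theta>\<close>.\<close>

definition dir_opposite :: "'a::euclidean_space set \<Rightarrow> 'a \<Rightarrow> 'a \<Rightarrow> 'a" where
  "dir_opposite \<Omega> \<theta> z = dir_exit \<Omega> (- \<theta>) (SOME x. x \<in> \<Omega> \<and> dir_exit \<Omega> \<theta> x = z)"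

text \<open>\<open>\<mu>\<^sub>\<theta>\<close>, on the Borel sets of \<open>\<partial>\<Omega>\<close>\<close>

definition dir_measure :: "'a::euclidean_space set \<Rightarrow> 'a \<Rightarrow> 'a measure" where
  "dir_measure \<Omega> \<theta> =
     distr (lebesgue_on \<Omega>) (restrict_space borel (frontier \<Omega>)) (dir_exit \<Omega> \<theta>)"


section \<open>Directional traces\<close>

definition hyperplane :: "'a::euclidean_space \<Rightarrow> 'a set" where
  "hyperplane \<theta> = {y. y \<bullet> \<theta> = 0}"

definition hyperplane_proj :: "'a::euclidean_space \<Rightarrow> 'a \<Rightarrow> 'a" where
  "hyperplane_proj \<theta> x = x - (x \<bullet> \<theta>) *\<^sub>R \<theta>"

definition hyperplane_basis :: "'a::euclidean_space \<Rightarrow> 'a set" where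
  "hyperplane_basis \<theta> = (SOME B. pairwise orthogonal B \<and> (\<forall>b\<in>B. norm b = 1) \<and>
     span B = hyperplane \<theta>)"

text \<open>Lebesgue measure on the hyperplane, built from an orthonormal basis of it exactly as
  \<^const>\<open>lborel\<close> is built from \<^const>\<open>Basis\<close>; it does not depend on the choice of the basis. In
  dimension 1 it is the unit mass at 0.\<close>

definition hyperplane_lborel :: "'a::euclidean_space \<Rightarrow> 'a measure" where
  "hyperplane_lborel \<theta> =
     distr (\<Pi>\<^sub>M b\<in>hyperplane_basis \<theta>. (lborel :: real measure))
       (restrict_space borel (hyperplane \<theta>))
       (\<lambda>f. \<Sum>b\<in>hyperplane_basis \<theta>. f b *\<^sub>R b)"

definition line_slice :: "'a::euclidean_space set \<Rightarrow> 'a \<Rightarrow> 'a \<Rightarrow> real set" where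
  "line_slice \<Omega> \<theta> y = {s. s *\<^sub>R \<theta> + y \<in> \<Omega>}"

text \<open>The disjoint open intervals \<open>]\<alpha>,\<beta>[\<close> whose union is a slice of \<open>\<Omega>\<close> are its connected components.
  The space \<open>H\<^sup>1(]\<alpha>,\<beta>[)\<close> is \<^const>\<open>H1\<close> at type \<^typ>\<open>real\<close>.\<close>

definition dir_traces ::
    "'a::euclidean_space set \<Rightarrow> 'a \<Rightarrow> ('a \<Rightarrow> real) \<Rightarrow> ('a \<Rightarrow> real) set" where
  "dir_traces \<Omega> \<theta> u = {g. \<exists>u' A.
     (AE x in lebesgue_on \<Omega>. u' x = u x) \<and>
     A \<subseteq> hyperplane_proj \<theta> ` \<Omega> \<and>
     (AE y in hyperplane_lborel \<theta>. y \<in> hyperplane_proj \<theta> ` \<Omega> \<longrightarrow> y \<in> A) \<and>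
     (\<forall>y\<in>A. \<forall>\<alpha> \<beta>. {\<alpha><..<\<beta>} \<in> components (line_slice \<Omega> \<theta> y) \<longrightarrow>
        (\<lambda>s. u' (s *\<^sub>R \<theta> + y)) \<in> H1 {\<alpha><..<\<beta>} \<and>
        (\<exists>h. continuous_on {\<alpha>..\<beta>} h \<and>
             (AE s in lebesgue_on {\<alpha><..<\<beta>}. h s = u' (s *\<^sub>R \<theta> + y)) \<and>
             g (\<beta> *\<^sub>R \<theta> + y) = h \<beta>))}"

text \<open>\<open>L\<^sup>2(\<partial>\<Omega>, (\<mu>\<^sub>\<theta>)\<^sub>\<theta>)\<close>. Its elements need not be Borel functions: they only agree,
  \<open>\<mu>\<^sub>\<theta>\<close>-a.e. and for each \<open>\<theta>\<close> separately, with Borel functions. Their integrals are therefore taken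
  with respect to the completion of \<open>\<mu>\<^sub>\<theta>\<close>.\<close>

definition L2_bd :: "'a::euclidean_space set \<Rightarrow> ('a \<Rightarrow> real) set" where
  "L2_bd \<Omega> = {f. \<exists>M\<ge>0. \<forall>\<theta>\<in>sphere 0 1. \<exists>g\<in>sq_integrable (dir_measure \<Omega> \<theta>).
     (AE z in dir_measure \<Omega> \<theta>. f z = g z) \<and> (LINT z|dir_measure \<Omega> \<theta>. (g z)\<^sup>2) \<le> M}"

definition L2_bd_norm :: "'a::euclidean_space set \<Rightarrow> ('a \<Rightarrow> real) \<Rightarrow> real" where
  "L2_bd_norm \<Omega> g =
     sqrt (SUP \<theta>\<in>sphere 0 1. LINT z|completion (dir_measure \<Omega> \<theta>). (g z)\<^sup>2)"

definition L2_bd_topology :: "'a::euclidean_space set \<Rightarrow> ('a \<Rightarrow> real) topology" where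
  "L2_bd_topology \<Omega> = seminorm_topology (L2_bd \<Omega>) (L2_bd_norm \<Omega>)"

definition is_tr :: "'a::euclidean_space set \<Rightarrow> ('a \<Rightarrow> real) \<Rightarrow> ('a \<Rightarrow> real) \<Rightarrow> bool" where
  "is_tr \<Omega> u g \<longleftrightarrow> g \<in> L2_bd \<Omega> \<and>
     (\<forall>\<theta>\<in>sphere 0 1. \<exists>k\<in>dir_traces \<Omega> \<theta> u. AE z in dir_measure \<Omega> \<theta>. k z = g z)"

definition H1_tr :: "'a::euclidean_space set \<Rightarrow> ('a \<Rightarrow> real) set" where
  "H1_tr \<Omega> = {u \<in> H1 \<Omega>. \<exists>g. is_tr \<Omega> u g}"

definition bd_tr :: "'a::euclidean_space set \<Rightarrow> ('a \<Rightarrow> real) \<Rightarrow> 'a \<Rightarrow> real" where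
  "bd_tr \<Omega> u = (SOME g. is_tr \<Omega> u g)"

end

theory Submission
  imports Defs
begin

text \<open>For \<open>u \<in> W\<^sub>\<theta>(\<Omega>)\<close> with weak derivative \<open>w\<close> in direction \<open>\<theta>\<close>, almost every \<open>x \<in> \<Omega>\<close> satisfies
  \<open>u(x + r\<theta>) = u(x) + \<integral>\<^sub>0\<^sup>r w(x + \<rho>\<theta>) d\<rho>\<close> for almost every \<open>r\<close> such that the segment stays in \<open>\<Omega>\<close>. Hence
  \<open>\<gamma>\<^sub>\<theta>u(z\<^sub>\<theta>(x)) = T\<^sub>\<theta>u(x)\<close> almost everywhere, where \<open>T\<^sub>\<theta>u(x) = u(x) + \<integral> w(x + \<rho>\<theta>) d\<rho>\<close> over
  \<open>0 < \<rho> < \<delta>\<^sub>\<theta>(x)\<close>, and \<open>g\<close> is the trace of \<open>u\<close> if and only if \<open>g \<circ> z\<^sub>\<theta> = T\<^sub>\<theta>u\<close> almost everywhere on \<open>\<Omega>\<close> for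
  every \<open>\<theta>\<close>; boundary integrals for \<open>\<mu>\<^sub>\<theta>\<close> are integrals over \<open>\<Omega>\<close> of such pullbacks. By Cauchy-Schwarz and
  Fubini \<open>T\<^sub>\<theta>\<close> is bounded from \<open>H\<^sup>1(\<Omega>)\<close> to \<open>L\<^sup>2(\<Omega>)\<close> uniformly in \<open>\<theta>\<close>. This gives the continuity of the
  trace, and also closedness: along a sequence converging geometrically in \<open>H\<^sup>1\<close> the traces converge
  \<open>\<mu>\<^sub>\<theta>\<close>-almost everywhere, and the pointwise limit is one function for all \<open>\<theta>\<close>. The integral formula
  is the product rule on each segment, averaged over the segment.\<close>

section \<open>Smooth test functions\<close>

text \<open>Only the definition of a directional trace refers to \<open>hyperplane_lborel\<close>.
  All other arguments on lines take each point x of \<Omega> as the base point of its own line and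
  use that \<open>(x, r) -> (x + r \<theta>, r)\<close> preserves Lebesgue measure for every
  \<theta>, so no coordinates adapted to \<theta> are needed. The obstacle is the way back to the
  boundary: z_\<theta> is constant on whole segments, and the traces, being chosen by
  \<open>SOME\<close>, are not known to be Borel. Null sets therefore have to be carried from
  \<Omega> to the boundary by a separate argument, and integrals of traces are taken for the
  completed measure. The denominator |z - z_{-\<theta>}(z)| is the length of the segment ending at
  z. The measure \<mu>_\<theta> counts z once for every point of this segment, so dividing by the
  length leaves exactly one contribution of the increment of uv per segment. Uniformity in \<theta>
  comes from linearity: the weak derivative along \<theta> is the combination of the coordinate
  derivatives with coefficients of Euclidean norm 1, so Cauchy-Schwarz bounds it by the full
  gradient.\<close>

lemma Ck_SucI:
  assumes "\<And>x. (f has_derivative f' x) (at x)" and "\<And>i. i \<in> Basis \<Longrightarrow> Ck k (\<lambda>x. f' x i)"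
  shows "Ck (Suc k) f"
proof -
  have "frechet_derivative f (at x) = f' x" for x
    by (rule frechet_derivative_at[OF assms(1), symmetric])
  then show ?thesis
    using assms by (auto simp: differentiable_def)
qed

lemma Ck_SucD:
  assumes "Ck (Suc k) f"
  shows "(f has_derivative frechet_derivative f (at x)) (at x)"
    and "i \<in> Basis \<Longrightarrow> Ck k (\<lambda>x. frechet_derivative f (at x) i)"
  using assms by (auto simp: frechet_derivative_works)

lemma Ck_mono: "Ck (Suc k) f \<Longrightarrow> Ck k f"
proof (induction k arbitrary: f)
  case 0
  then show ?case
    by (auto intro!: continuous_at_imp_continuous_on differentiable_imp_continuous_within)
next
  case (Suc k)
  then show ?case by auto
qed

lemma Ck_continuous: "Ck k f \<Longrightarrow> continuous_on UNIV f"
  by (induction k) (use Ck.simps(1) Ck_mono in blast)+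

lemma Ck_const: "Ck k (\<lambda>x. c)"
proof (induction k arbitrary: c)
  case (Suc k)
  show ?case by (rule Ck_SucI[where f' = "\<lambda>_ _. 0"]) (auto intro: Suc)
qed auto

lemma Ck_add: "Ck k f \<Longrightarrow> Ck k g \<Longrightarrow> Ck k (\<lambda>x. f x + g x)"
proof (induction k arbitrary: f g)
  case 0
  then show ?case by (auto intro: continuous_on_add)
next
  case (Suc k)
  show ?case
  proof (rule Ck_SucI)
    show "((\<lambda>x. f x + g x) has_derivative
        (\<lambda>i. frechet_derivative f (at x) i + frechet_derivative g (at x) i)) (at x)" for x
      by (intro has_derivative_add Ck_SucD(1)[OF Suc.prems(1)] Ck_SucD(1)[OF Suc.prems(2)])
  qed (use Suc in auto)
qed

lemma Ck_mult: "Ck k f \<Longrightarrow> Ck k g \<Longrightarrow> Ck k (\<lambda>x. f x * g x)"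
proof (induction k arbitrary: f g)
  case 0
  then show ?case by (auto intro: continuous_on_mult)
next
  case (Suc k)
  show ?case
  proof (rule Ck_SucI)
    show "((\<lambda>x. f x * g x) has_derivative
        (\<lambda>i. f x * frechet_derivative g (at x) i + frechet_derivative f (at x) i * g x)) (at x)" for x
      by (intro has_derivative_mult Ck_SucD(1)[OF Suc.prems(1)] Ck_SucD(1)[OF Suc.prems(2)])
    show "Ck k (\<lambda>x. f x * frechet_derivative g (at x) i + frechet_derivative f (at x) i * g x)"
      if "i \<in> Basis" for i
      by (intro Ck_add Suc.IH Ck_mono[OF Suc.prems(1)] Ck_mono[OF Suc.prems(2)]
          Ck_SucD(2)[OF Suc.prems(1)] Ck_SucD(2)[OF Suc.prems(2)] that)
  qed
qed

lemma Ck_prod: "(\<And>i. i \<in> I \<Longrightarrow> Ck k (f i)) \<Longrightarrow> Ck k (\<lambda>x. \<Prod>i\<in>I. f i x)"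
  by (induction I rule: infinite_finite_induct) (auto intro: Ck_const Ck_mult)

lemma has_derivative_shift:
  assumes "(f has_derivative f') (at (x - c))"
  shows "((\<lambda>x. f (x - c)) has_derivative f') (at (x::'a::real_normed_vector))"
proof -
  have "((\<lambda>x. x - c) has_derivative (\<lambda>h. h)) (at x)"
    by (auto intro!: derivative_eq_intros)
  from has_derivative_compose[OF this assms] show ?thesis by simp
qed

lemma Ck_shift: "Ck k f \<Longrightarrow> Ck k (\<lambda>x. f (x - c))"
proof (induction k arbitrary: f)
  case 0
  then show ?case
    by (auto intro!: continuous_intros continuous_on_compose2[of UNIV f])
next
  case (Suc k)
  show ?case
    by (rule Ck_SucI[OF has_derivative_shift[OF Ck_SucD(1)[OF Suc.prems]]])
      (use Suc in auto)
qed

text \<open>The powers of \<open>t\<close> make the family closed under differentiation up to linear combinations.\<close>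

definition flat :: "nat \<Rightarrow> real \<Rightarrow> real" where
  "flat n t = (if 0 < t then exp (- 1 / t) / t ^ n else 0)"

text \<open>With y = 1/t the claim compares \<open>y ^ (n + 2)\<close> with \<open>exp y\<close>,
  and a single term of the exponential series suffices. Two powers of t are kept in the bound
  because they force the difference quotient at 0 to vanish in
  \<open>has_derivative_flat\<close>.\<close>

lemma flat_bound: "\<bar>flat n t\<bar> \<le> fact (n + 2) * t\<^sup>2"
proof (cases "0 < t")
  case True
  define y where "y = 1 / t"
  have y: "0 < y" "t = 1 / y" using True by (auto simp: y_def)
  have sm: "(\<lambda>n. y ^ n /\<^sub>R fact n) sums exp y" by (rule exp_converges)
  have "y ^ (n + 2) /\<^sub>R fact (n + 2) \<le> exp y"
    using sum_le_suminf[of "\<lambda>n. y ^ n /\<^sub>R fact n" "{n+2}"] sm y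
    by (auto simp: sums_iff)
  then have "y ^ n * y\<^sup>2 \<le> fact (n + 2) * exp y"
    using fact_gt_zero[of "n + 2", where 'a = real]
    by (simp add: power_add inverse_eq_divide pos_divide_le_eq mult.commute del: fact_Suc add_2_eq_Suc')
  then have "y ^ n / exp y \<le> fact (n + 2) / y\<^sup>2"
    using y by (simp add: field_simps)
  moreover have "flat n t = y ^ n / exp y"
    unfolding y(2) using y(1) by (simp add: flat_def exp_minus power_one_over divide_simps)
  moreover have "t\<^sup>2 = 1 / y\<^sup>2" using y by (simp add: power_divide)
  ultimately show ?thesis using y by simp
qed (simp add: flat_def)

lemma flat_bounds: "0 \<le> flat 0 t" "flat 0 t \<le> 1"
  by (auto simp: flat_def)

lemma has_derivative_flat: "(flat n has_real_derivative - real n * flat (n + 1) t + flat (n + 2) t) (at t)"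
proof (cases "t = 0")
  case True
  have "((\<lambda>y. (flat n y - flat n 0) / (y - 0)) \<longlongrightarrow> 0) (at 0)"
  proof (rule Lim_null_comparison)
    show "\<forall>\<^sub>F y in at 0. norm ((flat n y - flat n 0) / (y - 0)) \<le> fact (n + 2) * \<bar>y\<bar>"
    proof (rule always_eventually, rule allI)
      fix y :: real
      have "\<bar>flat n y\<bar> / \<bar>y\<bar> \<le> (fact (n + 2) * y\<^sup>2) / \<bar>y\<bar>"
        by (intro divide_right_mono flat_bound) auto
      also have "\<dots> = fact (n + 2) * \<bar>y\<bar>"
        by (simp add: power2_eq_square abs_if)
      finally show "norm ((flat n y - flat n 0) / (y - 0)) \<le> fact (n + 2) * \<bar>y\<bar>"
        by (simp add: flat_def[of _ 0] abs_divide)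
    qed
    show "((\<lambda>y::real. fact (n + 2) * \<bar>y\<bar>) \<longlongrightarrow> 0) (at 0)"
      by (auto intro!: tendsto_eq_intros)
  qed
  then show ?thesis using True by (simp add: has_field_derivative_iff flat_def)
next
  case False
  then consider "0 < t" | "t < 0" by linarith
  then show ?thesis
  proof cases
    case 1
    have "((\<lambda>t. exp (- 1 / t) / t ^ n) has_real_derivative - real n * flat (n + 1) t + flat (n + 2) t) (at t)"
      using 1
      apply (cases n)
       apply (auto intro!: derivative_eq_intros simp: flat_def field_simps power2_eq_square)
      subgoal for m by (cases m) auto
      done
    then show ?thesis
      by (rule has_field_derivative_transform_within_open[where S = "{0<..}"])
        (use 1 in \<open>auto simp: flat_def\<close>)
  next
    case 2
    have "((\<lambda>t. 0) has_real_derivative - real n * flat (n + 1) t + flat (n + 2) t) (at t)"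
      using 2 by (auto simp: flat_def)
    then show ?thesis
      by (rule has_field_derivative_transform_within_open[where S = "{..<0}"])
        (use 2 in \<open>auto simp: flat_def\<close>)
  qed
qed

lemma continuous_flat: "continuous_on UNIV (flat n)"
  by (meson DERIV_continuous_on has_derivative_flat DERIV_subset UNIV_I subset_UNIV)

lemma Ck_flat: "Ck k (\<lambda>x::'a::euclidean_space. flat n (x \<bullet> b + c))"
proof (induction k arbitrary: n)
  case 0
  show ?case
    by (auto intro!: continuous_intros continuous_on_compose2[OF continuous_flat])
next
  case (Suc k)
  show ?case
  proof (rule Ck_SucI)
    show "((\<lambda>x. flat n (x \<bullet> b + c)) has_derivative
        (\<lambda>i. (i \<bullet> b) * (- real n * flat (n + 1) (x \<bullet> b + c) + flat (n + 2) (x \<bullet> b + c)))) (at x)" for x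
      by (rule has_derivative_compose[OF _ has_derivative_flat[unfolded has_field_derivative_def], THEN
          has_derivative_eq_rhs])
        (auto intro!: derivative_eq_intros simp: mult.commute)
    show "Ck k (\<lambda>x. (i \<bullet> b) * (- real n * flat (n + 1) (x \<bullet> b + c) + flat (n + 2) (x \<bullet> b + c)))" for i
      by (intro Ck_mult Ck_add Ck_const Suc)
  qed
qed

text \<open>The product is positive exactly on the open box. The factor \<open>Suc n\<close> leaves
  this set alone and pushes every positive value towards 1, since \<open>flat 0 (m * t)\<close> is
  \<open>exp (- 1 / (m * t))\<close>.\<close>

definition bump :: "'a::euclidean_space \<Rightarrow> 'a \<Rightarrow> nat \<Rightarrow> 'a \<Rightarrow> real" where
  "bump a b n x = (\<Prod>i\<in>Basis. flat 0 (real (Suc n) * (x \<bullet> i - a \<bullet> i)) * flat 0 (real (Suc n) * (b \<bullet> i - x \<bullet> i)))"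

lemma Ck_bump: "Ck k (bump a b n)"
proof -
  have "flat 0 (real (Suc n) * (x \<bullet> i - a \<bullet> i)) = flat 0 (x \<bullet> (real (Suc n) *\<^sub>R i) + (- real (Suc n) * (a
      \<bullet> i)))"
    "flat 0 (real (Suc n) * (b \<bullet> i - x \<bullet> i)) = flat 0 (x \<bullet> (- real (Suc n) *\<^sub>R i) + (real (Suc n) * (b \<bullet> i)))"
    for x i by (simp_all add: algebra_simps)
  then show ?thesis
    unfolding bump_def[abs_def] by (simp only:) (intro Ck_prod Ck_mult Ck_flat)
qed

lemma bump_bounds: "0 \<le> bump a b n x" "bump a b n x \<le> 1"
  unfolding bump_def
  by (auto intro!: prod_nonneg prod_le_1 mult_nonneg_nonneg mult_le_one flat_bounds)

lemma bump_zero: "x \<notin> box a b \<Longrightarrow> bump a b n x = 0"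
  by (force simp: bump_def box_def flat_def zero_less_mult_iff)

lemma bump_tendsto: "(\<lambda>n. bump a b n x) \<longlonglongrightarrow> indicator (box a b) x"
proof (cases "x \<in> box a b")
  case True
  have lim: "(\<lambda>n. flat 0 (real (Suc n) * t)) \<longlonglongrightarrow> 1" if "0 < t" for t
  proof -
    have "(\<lambda>n. exp (- (1 / t) * inverse (real (Suc n)))) \<longlonglongrightarrow> exp (- (1/t) * 0)"
      by (intro tendsto_intros LIMSEQ_inverse_real_of_nat)
    moreover have "flat 0 (real (Suc n) * t) = exp (- (1 / t) * inverse (real (Suc n)))" for n
      using that by (simp add: flat_def zero_less_mult_iff divide_inverse)
    ultimately show ?thesis by simp
  qed
  have "(\<lambda>n. bump a b n x) \<longlonglongrightarrow> (\<Prod>i\<in>(Basis::'a set). 1 * 1)"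
    unfolding bump_def using True by (intro tendsto_prod tendsto_mult lim) (auto simp: box_def)
  then show ?thesis using True by simp
qed (simp add: bump_zero)

section \<open>Compactly supported test functions\<close>

lemma test_functionsI:
  assumes "\<And>k. Ck k \<phi>" "\<And>x. x \<notin> K \<Longrightarrow> \<phi> x = 0" "compact K" "K \<subseteq> S"
  shows "\<phi> \<in> test_functions S"
proof -
  have "closure {x. \<phi> x \<noteq> 0} \<subseteq> K"
    using assms by (intro closure_minimal) (auto simp: compact_imp_closed)
  moreover from this have "compact (closure {x. \<phi> x \<noteq> 0})"
    using assms(3) by (metis closed_closure compact_Int_closed inf.absorb_iff2)
  ultimately show ?thesis using assms by (auto simp: test_functions_def)
qed

lemma bump_test_function: "cbox a b \<subseteq> S \<Longrightarrow> bump a b n \<in> test_functions S"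
  by (rule test_functionsI[where K = "cbox a b"])
    (use box_subset_cbox in \<open>auto intro!: Ck_bump bump_zero\<close>)

text \<open>Off the closed support \<phi> is locally zero, so its derivative vanishes there as well;
  one compact K then yields the bounds on \<phi> and on all its directional derivatives.\<close>

lemma test_function_support:
  assumes "\<phi> \<in> test_functions S"
  shows "\<exists>K. compact K \<and> K \<subseteq> S \<and>
    (\<forall>x. x \<notin> K \<longrightarrow> \<phi> x = 0 \<and> (\<forall>\<theta>. frechet_derivative \<phi> (at x) \<theta> = 0))"
proof -
  define K where "K = closure {x. \<phi> x \<noteq> 0}"
  have K: "compact K" "K \<subseteq> S" using assms by (auto simp: test_functions_def K_def)
  have 0: "\<phi> x = 0" if "x \<notin> K" for x
    using that closure_subset[of "{x. \<phi> x \<noteq> 0}"] unfolding K_def by blast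
  have "frechet_derivative \<phi> (at x) \<theta> = 0" if "x \<notin> K" for x \<theta>
  proof -
    have "open (- K)" "x \<in> - K" "\<And>y. y \<in> - K \<Longrightarrow> 0 = \<phi> y"
      using that 0 K compact_imp_closed by auto
    from has_derivative_transform_within_open[OF has_derivative_const this]
    have "(\<phi> has_derivative (\<lambda>_. 0)) (at x)" .
    from fun_cong[OF frechet_derivative_at[OF this], of \<theta>] show ?thesis by simp
  qed
  with K 0 show ?thesis by blast
qed

lemma test_function_derivative:
  assumes "\<phi> \<in> test_functions S"
  shows "(\<phi> has_derivative frechet_derivative \<phi> (at x)) (at x)"
  using assms by (intro Ck_SucD(1)[of 0]) (auto simp: test_functions_def)

text \<open>\<open>Ck\<close> controls only the derivatives along \<open>Basis\<close>; linearity of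
  the Frechet derivative passes this control on to an arbitrary direction.\<close>

lemma test_function_derivative_expand:
  assumes "\<phi> \<in> test_functions S"
  shows "frechet_derivative \<phi> (at x) \<theta> = (\<Sum>i\<in>Basis. (\<theta> \<bullet> i) * frechet_derivative \<phi> (at x) i)"
proof -
  have "linear (frechet_derivative \<phi> (at x))"
    using has_derivative_linear[OF test_function_derivative[OF assms]] .
  then have "frechet_derivative \<phi> (at x) (\<Sum>i\<in>Basis. (\<theta> \<bullet> i) *\<^sub>R i) = (\<Sum>i\<in>Basis. (\<theta> \<bullet> i) *
      frechet_derivative \<phi> (at x) i)"
    by (simp add: linear_sum linear_cmul)
  then show ?thesis by (simp add: euclidean_representation)
qed

lemma test_function_continuous:
  assumes "\<phi> \<in> test_functions S"
  shows "continuous_on UNIV \<phi>" "continuous_on UNIV (\<lambda>x. frechet_derivative \<phi> (at x) \<theta>)"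
proof -
  show "continuous_on UNIV \<phi>"
    using assms by (auto simp: test_functions_def intro: Ck_continuous)
  have "Ck (Suc 0) \<phi>" using assms by (simp add: test_functions_def del: Ck.simps)
  then show "continuous_on UNIV (\<lambda>x. frechet_derivative \<phi> (at x) \<theta>)"
    by (subst test_function_derivative_expand[OF assms])
      (auto intro!: continuous_intros dest: Ck_SucD(2))
qed

lemma bounded_compact_support:
  fixes f :: "'a::euclidean_space \<Rightarrow> real"
  assumes "continuous_on UNIV f" "compact K" "\<And>x. x \<notin> K \<Longrightarrow> f x = 0"
  shows "\<exists>B\<ge>0. \<forall>x. \<bar>f x\<bar> \<le> B"
proof -
  have "compact (f ` K)"
    using assms compact_continuous_image continuous_on_subset by blast
  then obtain B where B: "0 < B" "\<And>y. y \<in> f ` K \<Longrightarrow> norm y \<le> B"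
    by (metis bounded_pos compact_imp_bounded)
  then have "\<bar>f x\<bar> \<le> B" for x
    using assms(3)[of x] by (cases "x \<in> K") auto
  then show ?thesis using B(1) by (auto intro!: exI[of _ B])
qed

lemma test_function_bounded:
  assumes "\<phi> \<in> test_functions S"
  shows "\<exists>B\<ge>0. \<forall>x. \<bar>\<phi> x\<bar> \<le> B" "\<exists>B\<ge>0. \<forall>x. \<bar>frechet_derivative \<phi> (at x) \<theta>\<bar> \<le> B"
proof -
  obtain K where "compact K" "K \<subseteq> S" "\<And>x. x \<notin> K \<Longrightarrow> \<phi> x = 0"
    "\<And>x \<theta>. x \<notin> K \<Longrightarrow> frechet_derivative \<phi> (at x) \<theta> = 0"
    using test_function_support[OF assms] by blast
  then show "\<exists>B\<ge>0. \<forall>x. \<bar>\<phi> x\<bar> \<le> B" "\<exists>B\<ge>0. \<forall>x. \<bar>frechet_derivative \<phi> (at x) \<theta>\<bar> \<le> B"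
    using bounded_compact_support[of _ K] test_function_continuous[OF assms] by auto
qed

lemma test_function_borel:
  assumes "\<phi> \<in> test_functions S"
  shows "\<phi> \<in> borel_measurable borel"
  using test_function_continuous(1)[OF assms] by (rule borel_measurable_continuous_onI)

lemma test_function_derivative_borel:
  assumes "\<phi> \<in> test_functions S"
  shows "(\<lambda>x. frechet_derivative \<phi> (at x) \<theta>) \<in> borel_measurable borel"
  using test_function_continuous(2)[OF assms] by (rule borel_measurable_continuous_onI)

lemma test_function_shift:
  assumes "\<phi> \<in> test_functions S" "\<And>x. x \<in> S \<Longrightarrow> x + c \<in> T"
  shows "(\<lambda>x. \<phi> (x - c)) \<in> test_functions T"
    and "frechet_derivative (\<lambda>x. \<phi> (x - c)) (at x) = frechet_derivative \<phi> (at (x - c))"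
proof -
  obtain K where K: "compact K" "K \<subseteq> S" "\<And>x. x \<notin> K \<Longrightarrow> \<phi> x = 0"
    "\<And>x \<theta>. x \<notin> K \<Longrightarrow> frechet_derivative \<phi> (at x) \<theta> = 0"
    using test_function_support[OF assms(1)] by blast
  show "(\<lambda>x. \<phi> (x - c)) \<in> test_functions T"
  proof (rule test_functionsI[where K = "(\<lambda>x. x + c) ` K"])
    show "compact ((\<lambda>x. x + c) ` K)"
      using K(1) by (intro compact_continuous_image continuous_intros)
    show "\<phi> (x - c) = 0" if "x \<notin> (\<lambda>x. x + c) ` K" for x
    proof (rule K(3))
      show "x - c \<notin> K" using that by (metis diff_add_cancel image_eqI)
    qed
    show "Ck k (\<lambda>x. \<phi> (x - c))" for k
      using assms(1) by (intro Ck_shift) (auto simp: test_functions_def)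
  qed (use K assms(2) in auto)
  show "frechet_derivative (\<lambda>x. \<phi> (x - c)) (at x) = frechet_derivative \<phi> (at (x - c))"
    by (rule frechet_derivative_at[OF has_derivative_shift[OF test_function_derivative[OF assms(1)]],
        symmetric])
qed

text \<open>Open boxes are stable under intersection and generate the Borel sets, so the vanishing
  of the integrals spreads from boxes to all Borel subsets of the given box by the Dynkin argument.
  Uniqueness of densities then gives f = 0.\<close>

lemma integral_zero_boxes_imp_AE_zero:
  fixes f :: "'a::euclidean_space \<Rightarrow> real"
  assumes f: "integrable lborel f" and Q: "\<And>c d. box c d \<subseteq> box a b \<Longrightarrow> (LINT x|lborel. indicator (box c d) x
      * f x) = 0"
  shows "AE x in lborel. x \<in> box a b \<longrightarrow> f x = 0"
proof -
  have [measurable]: "f \<in> borel_measurable borel" using borel_measurable_integrable[OF f] by simp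
  have int: "integrable lborel (\<lambda>x. indicator A x * f x)" if "A \<in> sets borel" for A
    using integrable_mult_indicator[OF _ f, of A] that by simp
  have B: "sets (borel :: 'a measure) = sigma_sets UNIV (range (\<lambda>(a, b). box a b))"
    by (rule trans[OF arg_cong[OF borel_eq_box, of sets]]) (simp add: sets_measure_of)
  have zero: "(LINT x|lborel. indicator (A \<inter> box a b) x * f x) = 0" if "A \<in> sets borel" for A
  proof -
    have "Int_stable (range (\<lambda>(a, b). box a b :: 'a set))"
      by (rule Int_stableI) (clarsimp simp: image_iff box_Int_box, blast)
    moreover have "range (\<lambda>(a, b). box a b :: 'a set) \<subseteq> Pow UNIV" by auto
    moreover have "A \<in> sigma_sets UNIV (range (\<lambda>(a, b). box a b :: 'a set))"
      using that by (simp add: B)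
    ultimately show ?thesis
    proof (induction rule: sigma_sets_induct_disjoint)
      case (basic A)
      then obtain c d where "A = box c d" by auto
      then obtain c' d' where "A \<inter> box a b = box c' d'" by (auto simp: box_Int_box)
      then show ?case using Q[of c' d'] by auto
    next
      case empty
      show ?case by simp
    next
      case (compl A)
      have A: "A \<in> sets borel" using compl by (simp add: B)
      have "(LINT x|lborel. indicator ((UNIV - A) \<inter> box a b) x * f x) =
        (LINT x|lborel. indicator (box a b) x * f x - indicator (A \<inter> box a b) x * f x)"
        by (intro Bochner_Integration.integral_cong) (auto simp: indicator_def)
      also have "\<dots> = 0"
        using A by (subst Bochner_Integration.integral_diff) (auto intro!: int Q simp: compl)
      finally show ?case .
    next
      case (union A)
      have A: "A i \<in> sets borel" for i using union(2) by (auto simp: B)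
      have "(LINT x:(\<Union>i. A i \<inter> box a b)|lborel. f x) = (\<Sum>i. LINT x:(A i \<inter> box a b)|lborel. f x)"
      proof (rule lebesgue_integral_countable_add)
        show "set_integrable lborel (\<Union>i. A i \<inter> box a b) f"
          unfolding set_integrable_def real_scaleR_def by (rule int) (use A in auto)
        show "(A i \<inter> box a b) \<inter> (A j \<inter> box a b) = {}" if "i \<noteq> j" for i j
          using union(1) that by (auto simp: disjoint_family_on_def)
      qed (use A in auto)
      then show ?case
        using union(3) by (simp add: set_lebesgue_integral_def)
    qed
  qed
  have "AE x in lborel. indicator (box a b) x * f x = 0"
  proof (rule density_unique_real)
    show "integrable lborel (\<lambda>x. indicator (box a b) x * f x)" by (intro int) auto
    fix A :: "'a set" assume "A \<in> sets lborel"
    then have "(LINT x:A|lborel. indicator (box a b) x * f x) = 0"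
      using zero[of A] by (simp add: set_lebesgue_integral_def indicator_inter_arith mult.assoc)
    then show "(LINT x:A|lborel. indicator (box a b) x * f x) = (LINT x:A|lborel. 0)"
      by (simp add: set_lebesgue_integral_def)
  qed auto
  then show ?thesis by (auto elim!: eventually_mono)
qed

text \<open>The bumps tend boundedly to the indicator of a box, so by dominated convergence f
  integrates to 0 over every small box. The open set is covered by countably many boxes, hence the
  exceptional sets stay null in total.\<close>

lemma test_functions_separate:
  fixes f :: "'a::euclidean_space \<Rightarrow> real"
  assumes "open S" and [measurable]: "f \<in> borel_measurable borel"
    and int: "\<And>K. compact K \<Longrightarrow> K \<subseteq> S \<Longrightarrow> integrable lborel (\<lambda>x. indicator K x * f x)"
    and zero: "\<And>\<phi>. \<phi> \<in> test_functions S \<Longrightarrow> (LINT x|lborel. f x * \<phi> x) = 0"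
  shows "AE x\<in>S in lborel. f x = 0"
proof -
  have cb: "AE x in lborel. x \<in> box a b \<longrightarrow> f x = 0" if "cbox a b \<subseteq> S" for a b
  proof -
    let ?g = "\<lambda>x. indicator (cbox a b) x * f x"
    have g: "integrable lborel ?g" using that by (intro int) auto
    have "AE x in lborel. x \<in> box a b \<longrightarrow> ?g x = 0"
    proof (rule integral_zero_boxes_imp_AE_zero[OF g])
      fix c d assume cd: "box c d \<subseteq> box a b"
      show "(LINT x|lborel. indicator (box c d) x * ?g x) = 0"
      proof (cases "box c d = {}")
        case False
        \<comment> \<open>Nonemptiness matters: only then is the closure of an open box the closed
          box.\<close>
        then have "cbox c d \<subseteq> cbox a b" 
          using closure_mono[OF cd] cd by (metis closure_box subset_empty)
        then have "cbox c d \<subseteq> S" using that by auto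
        have "(\<lambda>n. LINT x|lborel. bump c d n x * ?g x) \<longlonglongrightarrow> (LINT x|lborel. indicator (box c d) x * ?g x)"
        proof (rule integral_dominated_convergence[where w = "\<lambda>x. \<bar>?g x\<bar>"])
          have [measurable]: "bump c d n \<in> borel_measurable borel" for n
            using bump_test_function[OF \<open>cbox c d \<subseteq> S\<close>] test_function_borel by blast
          show "(\<lambda>x. bump c d n x * ?g x) \<in> borel_measurable lborel" for n by measurable
          show "AE x in lborel. norm (bump c d n x * ?g x) \<le> \<bar>?g x\<bar>" for n
            using bump_bounds[of c d n] by (auto simp: abs_mult indicator_def intro!: mult_left_le_one_le)
          show "AE x in lborel. (\<lambda>n. bump c d n x * ?g x) \<longlonglongrightarrow> indicator (box c d) x * ?g x"
            by (intro AE_I2 tendsto_intros bump_tendsto)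
        qed (use g in auto)
        moreover have "(LINT x|lborel. bump c d n x * ?g x) = 0" for n
        proof -
          have "(LINT x|lborel. bump c d n x * ?g x) = (LINT x|lborel. f x * bump c d n x)"
            using \<open>cbox c d \<subseteq> cbox a b\<close> box_subset_cbox[of c d] bump_zero[of _ c d]
            by (intro Bochner_Integration.integral_cong) (auto simp: indicator_def)
          also have "\<dots> = 0"
            by (intro zero bump_test_function) fact
          finally show ?thesis .
        qed
        ultimately show ?thesis by (simp add: LIMSEQ_const_iff)
      qed simp
    qed
    then show ?thesis
      using box_subset_cbox[of a b] by (auto elim!: eventually_mono simp: indicator_def)
  qed
  \<comment> \<open>Lindelof makes the cover countable. Requiring the closed box inside the open set
    gives the compact support and the integrability used above.\<close>
  obtain \<D> where D: "\<D> \<subseteq> {box a b |a b. cbox a b \<subseteq> S}" "countable \<D>"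
    "\<Union>\<D> = \<Union>{box a b |a b. cbox a b \<subseteq> S}"
    using Lindelof[of "{box a b |a b. cbox a b \<subseteq> S}"] by (auto simp: open_box)
  have cover: "x \<in> \<Union>\<D>" if x: "x \<in> S" for x
  proof -
    obtain e where e: "0 < e" "cball x e \<subseteq> S"
      using \<open>open S\<close> x by (auto simp: open_contains_cball)
    obtain a b where ab: "x \<in> box a b" "box a b \<subseteq> ball x e"
      using rational_boxes[OF e(1), of x] by blast
    then have "closure (box a b) \<subseteq> closure (ball x e)" by (intro closure_mono)
    moreover have "closure (box a b) = cbox a b" using ab(1) by (metis closure_box empty_iff)
    ultimately have "cbox a b \<subseteq> S" using e by auto
    then show ?thesis unfolding D(3) using ab by blast
  qed
  have "AE x in lborel. \<forall>X\<in>\<D>. x \<in> X \<longrightarrow> f x = 0"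
    by (rule AE_ball_countable'[OF _ D(2)]) (use D(1) cb in blast)
  then show ?thesis
    using cover by (auto elim!: eventually_mono)
qed

section \<open>Lines through a bounded open set\<close>

text \<open>For fixed r the map is a translation in x, so Tonelli with the integral in x inside
  reduces the claim to translation invariance.\<close>

lemma distr_lborel_shear:
  fixes \<theta> :: "'a::euclidean_space"
  shows "distr (lborel \<Otimes>\<^sub>M lborel) (lborel \<Otimes>\<^sub>M lborel) (\<lambda>(x, r::real). (x + r *\<^sub>R \<theta>, r)) = lborel \<Otimes>\<^sub>M lborel"
    (is "distr _ _ ?T = _")
proof (rule measure_eqI)
  have T[measurable]: "?T \<in> (lborel \<Otimes>\<^sub>M lborel) \<rightarrow>\<^sub>M (lborel \<Otimes>\<^sub>M lborel)" by measurable
  fix A assume "A \<in> sets (distr (lborel \<Otimes>\<^sub>M lborel) (lborel \<Otimes>\<^sub>M lborel) ?T)"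
  then have A[measurable]: "A \<in> sets (lborel \<Otimes>\<^sub>M lborel)" by simp
  have transl: "(\<integral>\<^sup>+x. indicator A (x + r *\<^sub>R \<theta>, r) \<partial>lborel) = (\<integral>\<^sup>+x. indicator A (x, r) \<partial>lborel)" for r
  proof -
    have "(\<integral>\<^sup>+x. indicator A (x, r) \<partial>lborel) = (\<integral>\<^sup>+x. indicator A (x, r) \<partial>distr lborel borel ((+) (r *\<^sub>R \<theta>)))"
      by (simp add: lborel_distr_plus)
    also have "\<dots> = (\<integral>\<^sup>+x. indicator A (r *\<^sub>R \<theta> + x, r) \<partial>lborel)"
      by (subst nn_integral_distr) auto
    finally show ?thesis by (simp add: add.commute)
  qed
  have "emeasure (distr (lborel \<Otimes>\<^sub>M lborel) (lborel \<Otimes>\<^sub>M lborel) ?T) A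
    = (\<integral>\<^sup>+z. indicator A z \<partial>distr (lborel \<Otimes>\<^sub>M lborel) (lborel \<Otimes>\<^sub>M lborel) ?T)"
    using A by (intro nn_integral_indicator[symmetric]) simp
  also have "\<dots> = (\<integral>\<^sup>+z. indicator A (?T z) \<partial>(lborel \<Otimes>\<^sub>M lborel))"
    by (rule nn_integral_distr) auto
  also have "\<dots> = (\<integral>\<^sup>+r. \<integral>\<^sup>+x. indicator A (x + r *\<^sub>R \<theta>, r) \<partial>lborel \<partial>lborel)"
    by (subst lborel_pair.nn_integral_snd[symmetric]) auto
  also have "\<dots> = (\<integral>\<^sup>+r. \<integral>\<^sup>+x. indicator A (x, r) \<partial>lborel \<partial>lborel)"
    by (simp add: transl)
  also have "\<dots> = emeasure (lborel \<Otimes>\<^sub>M lborel) A"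
    using A by (subst lborel_pair.nn_integral_snd) auto
  finally show "emeasure (distr (lborel \<Otimes>\<^sub>M lborel) (lborel \<Otimes>\<^sub>M lborel) ?T) A = emeasure (lborel \<Otimes>\<^sub>M
      lborel) A" .
qed simp

lemma integrable_lborel_shear:
  fixes \<theta> :: "'a::euclidean_space" and k :: "'a \<Rightarrow> real \<Rightarrow> real"
  assumes "integrable (lborel \<Otimes>\<^sub>M lborel) (\<lambda>(x, r). k x r)"
  shows "integrable (lborel \<Otimes>\<^sub>M lborel) (\<lambda>(x, r). k (x + r *\<^sub>R \<theta>) r)"
proof -
  have "integrable (distr (lborel \<Otimes>\<^sub>M lborel) (lborel \<Otimes>\<^sub>M lborel) (\<lambda>(x, r::real). (x + r *\<^sub>R \<theta>, r))) (\<lambda>(x,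
      r). k x r)"
    using assms by (simp add: distr_lborel_shear)
  from integrable_distr[OF _ this] show ?thesis by (simp add: case_prod_unfold)
qed

lemma integral_lborel_shear:
  fixes \<theta> :: "'a::euclidean_space" and k :: "'a \<Rightarrow> real \<Rightarrow> real"
  assumes k: "integrable (lborel \<Otimes>\<^sub>M lborel) (\<lambda>(x, r). k x r)"
  shows "(LINT x|lborel. LINT r|lborel. k (x + r *\<^sub>R \<theta>) r) = (LINT x|lborel. LINT r|lborel. k x r)"
proof -
  have [measurable]: "case_prod k \<in> borel_measurable (lborel \<Otimes>\<^sub>M lborel)"
    using borel_measurable_integrable[OF k] by simp
  have "(LINT x|lborel. LINT r|lborel. k x r) = (LINT z|(lborel \<Otimes>\<^sub>M lborel). case_prod k z)"
    using lborel_pair.integral_fst'[OF k] by simp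
  also have "\<dots> = (LINT z|(distr (lborel \<Otimes>\<^sub>M lborel) (lborel \<Otimes>\<^sub>M lborel) (\<lambda>(x, r::real). (x + r *\<^sub>R \<theta>,
      r))). case_prod k z)"
    by (simp add: distr_lborel_shear)
  also have "\<dots> = (LINT z|(lborel \<Otimes>\<^sub>M lborel). (\<lambda>(x, r). k (x + r *\<^sub>R \<theta>) r) z)"
    by (subst integral_distr) (auto simp: case_prod_unfold)
  also have "\<dots> = (LINT x|lborel. LINT r|lborel. k (x + r *\<^sub>R \<theta>) r)"
    using lborel_pair.integral_fst'[OF integrable_lborel_shear[OF k]] by simp
  finally show ?thesis ..
qed

lemma AE_lborel_translate:
  fixes c :: "'a::euclidean_space"
  assumes "AE x in lborel. P x"
  shows "AE x in lborel. P (x + c)"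
proof -
  have "AE x in distr lborel borel ((+) c). P x" using assms by (subst lborel_distr_plus)
  from AE_distrD[OF _ this] show ?thesis by (simp add: add.commute)
qed

text \<open>For each fixed r the translated null set is null; exchanging the two quantifiers is
  Fubini. The exceptional set is first enlarged to a Borel null set N because the exchange needs a
  measurable predicate on the product.\<close>

lemma AE_lborel_lines:
  fixes \<theta> :: "'a::euclidean_space"
  assumes "AE x in lborel. P x"
  shows "AE x in lborel. AE r in lborel. P (x + r *\<^sub>R \<theta>)"
proof -
  obtain N where N: "N \<in> null_sets lborel" "{x. \<not> P x} \<subseteq> N"
    using assms by (auto simp: eventually_ae_filter)
  have [measurable]: "N \<in> sets borel" using N(1) by auto
  have "AE r in lborel. AE x in lborel. x + r *\<^sub>R \<theta> \<notin> N"
    using AE_lborel_translate[OF AE_not_in[OF N(1)]] by blast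
  moreover have "{p \<in> space (lborel \<Otimes>\<^sub>M lborel). fst p + snd p *\<^sub>R \<theta> \<notin> N} \<in> sets (lborel \<Otimes>\<^sub>M lborel)"
    by measurable
  ultimately have "AE x in lborel. AE r in lborel. x + r *\<^sub>R \<theta> \<notin> N"
    using lborel_pair.AE_commute[of "\<lambda>x r. x + r *\<^sub>R \<theta> \<notin> N"] by blast
  then show ?thesis
    using N(2) by (auto elim!: eventually_mono)
qed

section \<open>From Lebesgue measure on a domain to Borel functions on the whole space\<close>

lemma AE_lebesgue_on_iff:
  fixes S :: "'a::euclidean_space set"
  assumes "S \<in> sets borel"
  shows "(AE x in lebesgue_on S. P x) \<longleftrightarrow> (AE x\<in>S in lborel. P x)"
proof -
  have "S \<in> sets lborel" using assms by simp
  then show ?thesis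
    by (subst AE_restrict_space_iff) (auto simp: AE_completion_iff)
qed

lemma borel_measurable_lebesgue_onI:
  fixes S :: "'a::euclidean_space set"
  assumes "f \<in> borel_measurable borel"
  shows "f \<in> borel_measurable (lebesgue_on S)"
  using assms by (intro measurable_restrict_space1 measurable_completion) simp

lemma lebesgue_on_integral_borel:
  fixes S :: "'a::euclidean_space set" and f :: "'a \<Rightarrow> real"
  assumes S: "S \<in> sets borel" and [measurable]: "g \<in> borel_measurable borel" "f \<in> borel_measurable
      (lebesgue_on S)"
    and ae: "AE x\<in>S in lborel. f x = g x" and 0: "\<And>x. x \<notin> S \<Longrightarrow> g x = 0"
  shows "integrable (lebesgue_on S) f \<longleftrightarrow> integrable lborel g"
    and "(LINT x|lebesgue_on S. f x) = (LINT x|lborel. g x)"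
proof -
  have g: "g \<in> borel_measurable (lebesgue_on S)" by (rule borel_measurable_lebesgue_onI) simp
  have S': "S \<in> sets lborel" using S by simp
  have [measurable]: "S \<in> sets lebesgue" using S' by blast
  have AE: "AE x in lebesgue_on S. f x = g x" using ae S by (simp add: AE_lebesgue_on_iff)
  have ind: "indicator S x *\<^sub>R g x = g x" for x using 0 by (auto simp: indicator_def)
  have "integrable (lebesgue_on S) f \<longleftrightarrow> integrable (lebesgue_on S) g"
    by (rule integrable_cong_AE) (use AE g in auto)
  also have "\<dots> \<longleftrightarrow> integrable lebesgue g"
    by (subst integrable_restrict_space) (auto simp: ind simp del: real_scaleR_def)
  also have "\<dots> \<longleftrightarrow> integrable lborel g" by (rule integrable_completion) simp
  finally show "integrable (lebesgue_on S) f \<longleftrightarrow> integrable lborel g" .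
  have "(LINT x|lebesgue_on S. f x) = (LINT x|lebesgue_on S. g x)"
    by (rule integral_cong_AE) (use AE g in auto)
  also have "\<dots> = (LINT x|lebesgue. g x)"
    by (subst integral_restrict_space) (auto simp: ind simp del: real_scaleR_def)
  also have "\<dots> = (LINT x|lborel. g x)" by (rule integral_completion) simp
  finally show "(LINT x|lebesgue_on S. f x) = (LINT x|lborel. g x)" .
qed

text \<open>The Fubini arguments compose functions with \<open>(x, r) -> x + r \<theta>\<close> on a
  product of Borel spaces. Lebesgue measurable functions on the domain are therefore replaced once
  and for all by Borel ones extended by zero.\<close>

lemma lebesgue_on_borel_representative:
  fixes S :: "'a::euclidean_space set" and f :: "'a \<Rightarrow> real"
  assumes S: "S \<in> sets borel" and f: "f \<in> borel_measurable (lebesgue_on S)"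
  obtains g where "g \<in> borel_measurable borel" "AE x\<in>S in lborel. f x = g x"
    "\<And>x. x \<notin> S \<Longrightarrow> g x = (0::real)"
proof -
  have "S \<in> sets lborel" using S by simp
  then have SL: "S \<in> sets lebesgue" by blast
  then have "(\<lambda>x. if x \<in> S then f x else 0) \<in> borel_measurable lebesgue"
    using f by (simp add: borel_measurable_if)
  then obtain h where h[measurable]: "h \<in> borel_measurable lborel" and ae: "AE x in lborel. (if x \<in> S then
      f x else 0) = h x"
    using completion_ex_borel_measurable_real by blast
  show ?thesis
  proof (rule that[of "\<lambda>x. indicator S x * h x"])
    show "(\<lambda>x. indicator S x * h x) \<in> borel_measurable borel" using S h by simp
    show "AE x\<in>S in lborel. f x = indicator S x * h x" using ae by (auto elim!: eventually_mono)
  qed auto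
qed

text \<open>The complement is the sum of the closed set \<open>- S\<close> and the compact set
  \<open>- K\<close>. This is the source of measurability for exit times and exit points, with K a
  compact piece of a line.\<close>

lemma open_compact_tube:
  fixes S :: "'a::real_normed_vector set"
  assumes "open S" "compact K"
  shows "open {x. \<forall>k\<in>K. x + k \<in> S}"
proof -
  have "closed (\<Union>x\<in>- S. \<Union>y\<in>uminus ` K. {x + y})"
    using assms by (intro closed_compact_sums compact_negations) (auto simp: closed_def)
  moreover have "(\<Union>x\<in>- S. \<Union>y\<in>uminus ` K. {x + y}) = - {x. \<forall>k\<in>K. x + k \<in> S}"
  proof (intro equalityI subsetI)
    fix x assume "x \<in> - {x. \<forall>k\<in>K. x + k \<in> S}"
    then obtain k where "k \<in> K" "x + k \<notin> S" by auto
    then show "x \<in> (\<Union>x\<in>- S. \<Union>y\<in>uminus ` K. {x + y})"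
      by (intro UN_I[of "x + k"] UN_I[of "- k"]) auto
  next
    fix x assume "x \<in> (\<Union>x\<in>- S. \<Union>y\<in>uminus ` K. {x + y})"
    then obtain y k where "y \<notin> S" "k \<in> K" "x = y - k" by auto
    then show "x \<in> - {x. \<forall>k\<in>K. x + k \<in> S}" by (auto intro!: bexI[of _ k])
  qed
  ultimately show ?thesis by (simp add: open_closed)
qed

lemma (in complete_measure) borel_measurable_cong_AE:
  fixes f g :: "'a \<Rightarrow> 'b::topological_space"
  assumes g: "g \<in> borel_measurable M" and ae: "AE x in M. f x = g x"
  shows "f \<in> borel_measurable M"
proof (rule measurableI)
  fix A :: "'b set" assume A: "A \<in> sets borel"
  have "AE x in M. x \<in> g -` A \<inter> space M \<longleftrightarrow> x \<in> f -` A \<inter> space M"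
    using ae by eventually_elim auto
  from in_sets_AE[OF this measurable_sets[OF g A]] show "f -` A \<inter> space M \<in> sets M" by auto
qed auto

section \<open>Exit times and exit points in a fixed direction\<close>

locale directed_domain =
  fixes \<Omega> :: "'a::euclidean_space set" and \<theta> :: 'a
  assumes open_domain: "open \<Omega>" and bounded_domain: "bounded \<Omega>" and norm_direction: "norm \<theta> = 1"
begin

lemma reverse: "directed_domain \<Omega> (- \<theta>)"
  using open_domain bounded_domain norm_direction by unfold_locales auto

lemma borel_domain [measurable]: "\<Omega> \<in> sets borel"
  using open_domain by simp

definition dd :: "'a \<Rightarrow> real" where "dd x = dir_dist \<Omega> \<theta> x"

definition exit :: "'a \<Rightarrow> 'a" where "exit x = dir_exit \<Omega> \<theta> x"

lemma exit_eq: "exit x = x + dd x *\<^sub>R \<theta>"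
  by (simp add: exit_def dir_exit_def dd_def)

lemma segment_le_diameter:
  assumes "x \<in> \<Omega>" "x + t *\<^sub>R \<theta> \<in> \<Omega>"
  shows "t \<le> diameter \<Omega>"
proof -
  have "dist (x + t *\<^sub>R \<theta>) x \<le> diameter \<Omega>"
    using assms bounded_domain by (intro diameter_bounded_bound)
  then show ?thesis using norm_direction by (simp add: dist_norm)
qed

lemma segment_bound:
  assumes "x \<in> \<Omega>" "0 \<le> s" "\<forall>t\<in>{0..<s}. x + t *\<^sub>R \<theta> \<in> \<Omega>"
  shows "s \<le> diameter \<Omega>"
proof (rule dense_le)
  fix t assume "t < s"
  show "t \<le> diameter \<Omega>"
  proof (cases "0 \<le> t")
    case True
    then show ?thesis using assms \<open>t < s\<close> by (intro segment_le_diameter[of x]) auto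
  next
    case False
    then show ?thesis using diameter_ge_0[OF bounded_domain] by linarith
  qed
qed

lemma dd_facts:
  assumes "x \<in> \<Omega>"
  shows "0 < dd x" "dd x \<le> diameter \<Omega>" "\<And>t. 0 \<le> t \<Longrightarrow> t < dd x \<Longrightarrow> x + t *\<^sub>R \<theta> \<in> \<Omega>"
    "exit x \<notin> \<Omega>" "exit x \<in> frontier \<Omega>"
proof -
  let ?S = "{s. 0 \<le> s \<and> (\<forall>t\<in>{0..<s}. x + t *\<^sub>R \<theta> \<in> \<Omega>)}"
  have dd: "dd x = Sup ?S" by (simp add: dd_def dir_dist_def)
  have bdd: "bdd_above ?S" by (rule bdd_aboveI[where M = "diameter \<Omega>"]) (auto intro: segment_bound[OF assms])
  have ne: "0 \<in> ?S" by auto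
  \<comment> \<open>Openness leaves room along the line around any point of it in \<Omega>. At x
    this gives a positive exit time; at the supremum it would push the supremum further, which keeps
    the exit point out of \<Omega>.\<close>
  have extend: "\<exists>e>0. \<forall>r. \<bar>r\<bar> < e \<longrightarrow> x + (t + r) *\<^sub>R \<theta> \<in> \<Omega>" if "x + t *\<^sub>R \<theta> \<in> \<Omega>" for t
  proof -
    obtain e where e: "e > 0" "ball (x + t *\<^sub>R \<theta>) e \<subseteq> \<Omega>"
      using open_domain \<open>x + t *\<^sub>R \<theta> \<in> \<Omega>\<close> openE by blast
    have "x + (t + r) *\<^sub>R \<theta> \<in> \<Omega>" if "\<bar>r\<bar> < e" for r
      using that norm_direction by (intro subsetD[OF e(2)]) (simp add: dist_norm algebra_simps)
    then show ?thesis using e(1) by blast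
  qed
  show le: "dd x \<le> diameter \<Omega>"
    unfolding dd using ne segment_bound[OF assms] by (intro cSup_least) auto
  show in1: "x + t *\<^sub>R \<theta> \<in> \<Omega>" if t: "0 \<le> t" "t < dd x" for t
  proof -
    obtain s where "s \<in> ?S" "t < s"
      using t ne bdd unfolding dd by (subst (asm) less_cSup_iff) auto
    then show ?thesis using t by auto
  qed
  show "exit x \<notin> \<Omega>"
  proof
    assume "exit x \<in> \<Omega>"
    then obtain e where e: "e > 0" "\<forall>r. \<bar>r\<bar> < e \<longrightarrow> x + (dd x + r) *\<^sub>R \<theta> \<in> \<Omega>"
      using extend[of "dd x"] by (auto simp: exit_eq)
    have "dd x + e / 2 \<in> ?S"
    proof (intro CollectI conjI ballI)
      have "0 \<le> dd x" unfolding dd using ne bdd by (rule cSup_upper)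
      then show "0 \<le> dd x + e / 2" using e(1) by simp
      fix t assume t: "t \<in> {0..<dd x + e / 2}"
      show "x + t *\<^sub>R \<theta> \<in> \<Omega>"
      proof (cases "t < dd x")
        case True then show ?thesis using in1 t by auto
      next
        case False
        then show ?thesis using e(2)[rule_format, of "t - dd x"] t e(1) by auto
      qed
    qed
    then have "dd x + e / 2 \<le> dd x" unfolding dd using bdd by (rule cSup_upper)
    then show False using e(1) by simp
  qed
  show pos: "0 < dd x"
  proof -
    obtain e where e: "e > 0" "\<forall>r. \<bar>r\<bar> < e \<longrightarrow> x + (0 + r) *\<^sub>R \<theta> \<in> \<Omega>"
      using extend[of 0] assms by auto
    then have "e \<in> ?S" by auto
    then have "e \<le> dd x" unfolding dd using bdd by (rule cSup_upper)
    then show ?thesis using e(1) by simp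
  qed
  have "exit x \<in> closure \<Omega>"
  proof (rule Lim_in_closed_set[of _ "\<lambda>t. x + t *\<^sub>R \<theta>" "at_left (dd x)"])
    show "\<forall>\<^sub>F t in at_left (dd x). x + t *\<^sub>R \<theta> \<in> closure \<Omega>"
      using pos eventually_at_left_real[of 0 "dd x"] closure_subset[of \<Omega>]
      by (auto intro!: in1 elim!: eventually_mono)
    show "((\<lambda>t. x + t *\<^sub>R \<theta>) \<longlongrightarrow> exit x) (at_left (dd x))"
      unfolding exit_eq by (auto intro!: tendsto_intros)
  qed (auto simp: trivial_limit_at_left_real)
  then show "exit x \<in> frontier \<Omega>"
    using \<open>exit x \<notin> \<Omega>\<close> open_domain by (simp add: frontier_def interior_open)
qed

lemma dd_eqI:
  assumes "0 \<le> d" "\<And>t. 0 \<le> t \<Longrightarrow> t < d \<Longrightarrow> x + t *\<^sub>R \<theta> \<in> \<Omega>" "x + d *\<^sub>R \<theta> \<notin> \<Omega>" "x \<in> \<Omega>"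
  shows "dd x = d"
  using dd_facts(1,3,4)[OF assms(4)] assms unfolding exit_eq
  by (metis less_eq_real_def linorder_less_linear)

text \<open>The strict inequality corresponds to a closed, hence compact, range of r. That is the
  form in which \<open>open_compact_tube\<close> applies, and it makes \<open>dd\<close> lower
  semicontinuous on \<Omega>.\<close>

lemma less_dd_iff:
  assumes "x \<in> \<Omega>" "0 \<le> t"
  shows "t < dd x \<longleftrightarrow> (\<forall>r\<in>{0..t}. x + r *\<^sub>R \<theta> \<in> \<Omega>)"
  using dd_facts(1,3,4)[OF assms(1)] assms unfolding exit_eq
  by (metis atLeastAtMost_iff less_eq_real_def linorder_not_less order_le_less_trans)

lemma dd_forward:
  assumes "x \<in> \<Omega>" "0 \<le> r" "r < dd x"
  shows "x + r *\<^sub>R \<theta> \<in> \<Omega>" "dd (x + r *\<^sub>R \<theta>) = dd x - r" "exit (x + r *\<^sub>R \<theta>) = exit x"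
proof -
  show *: "x + r *\<^sub>R \<theta> \<in> \<Omega>" using assms dd_facts by auto
  show **: "dd (x + r *\<^sub>R \<theta>) = dd x - r"
  proof (rule dd_eqI[OF _ _ _ *])
    show "x + r *\<^sub>R \<theta> + t *\<^sub>R \<theta> \<in> \<Omega>" if "0 \<le> t" "t < dd x - r" for t
      using dd_facts(3)[OF assms(1), of "r + t"] that assms by (simp add: algebra_simps)
    show "x + r *\<^sub>R \<theta> + (dd x - r) *\<^sub>R \<theta> \<notin> \<Omega>"
      using dd_facts(4)[OF assms(1)] by (simp add: exit_eq algebra_simps)
  qed (use assms in auto)
  show "exit (x + r *\<^sub>R \<theta>) = exit x"
    unfolding exit_eq ** by (simp add: algebra_simps)
qed

definition db :: "'a \<Rightarrow> real" where "db x = dir_dist \<Omega> (- \<theta>) x"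

definition entry :: "'a \<Rightarrow> 'a" where "entry x = dir_exit \<Omega> (- \<theta>) x"

text \<open>The locale holds for - \<theta> too, so every backward fact is the forward one read
  there. These equations translate the names, and the \<open>lemmas\<close> below are obtained by
  rewriting alone.\<close>

lemma back_eq: "directed_domain.dd \<Omega> (- \<theta>) = db" "directed_domain.exit \<Omega> (- \<theta>) = entry"
  by (auto simp: fun_eq_iff db_def entry_def directed_domain.dd_def[OF reverse]
      directed_domain.exit_def[OF reverse])

lemma back_back: "directed_domain.db \<Omega> (- \<theta>) = dd" "directed_domain.entry \<Omega> (- \<theta>) = exit"
  by (auto simp: fun_eq_iff dd_def exit_def directed_domain.db_def[OF reverse]
      directed_domain.entry_def[OF reverse])

lemmas entry_eq = directed_domain.exit_eq[OF reverse, unfolded back_eq scaleR_minus_right]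
lemmas db_facts = directed_domain.dd_facts[OF reverse, unfolded back_eq scaleR_minus_right]
lemmas db_backward = directed_domain.dd_forward[OF reverse, unfolded back_eq scaleR_minus_right]
lemmas db_eqI = directed_domain.dd_eqI[OF reverse, unfolded back_eq scaleR_minus_right]

lemma db_forward:
  assumes "x \<in> \<Omega>" "0 \<le> r" "r < dd x"
  shows "db (x + r *\<^sub>R \<theta>) = db x + r" "entry (x + r *\<^sub>R \<theta>) = entry x"
proof -
  show *: "db (x + r *\<^sub>R \<theta>) = db x + r"
  proof (rule db_eqI)
    show "x + r *\<^sub>R \<theta> + - (t *\<^sub>R \<theta>) \<in> \<Omega>" if "0 \<le> t" "t < db x + r" for t
    proof (cases "t \<le> r")
      case True
      then show ?thesis using dd_facts(3)[OF assms(1), of "r - t"] that assms by (simp add: algebra_simps)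
    next
      case False
      then show ?thesis using db_facts(3)[OF assms(1), of "t - r"] that assms by (simp add: algebra_simps)
    qed
    show "x + r *\<^sub>R \<theta> + - ((db x + r) *\<^sub>R \<theta>) \<notin> \<Omega>"
      using db_facts(4)[OF assms(1)] by (simp add: entry_eq algebra_simps)
  qed (use assms db_facts(1)[OF assms(1)] dd_forward(1) in auto)
  show "entry (x + r *\<^sub>R \<theta>) = entry x"
    unfolding entry_eq * by (simp add: algebra_simps)
qed

lemmas dd_backward = directed_domain.db_forward[OF reverse, unfolded back_eq back_back scaleR_minus_right]

text \<open>Both endpoints and the length \<open>dd x + db x\<close> are constant along the maximal
  segment through x; on this invariance rest the averages over segments.\<close>

lemma segment:
  assumes "x \<in> \<Omega>" "- db x < r" "r < dd x"
  shows "x + r *\<^sub>R \<theta> \<in> \<Omega>" "dd (x + r *\<^sub>R \<theta>) = dd x - r" "db (x + r *\<^sub>R \<theta>) = db x + r"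
    "exit (x + r *\<^sub>R \<theta>) = exit x" "entry (x + r *\<^sub>R \<theta>) = entry x"
proof -
  have "x + r *\<^sub>R \<theta> \<in> \<Omega> \<and> dd (x + r *\<^sub>R \<theta>) = dd x - r \<and> db (x + r *\<^sub>R \<theta>) = db x + r \<and>
    exit (x + r *\<^sub>R \<theta>) = exit x \<and> entry (x + r *\<^sub>R \<theta>) = entry x"
  proof (cases "0 \<le> r")
    case True
    then show ?thesis using assms dd_forward[of x r] db_forward[of x r] by auto
  next
    case False
    then show ?thesis using assms db_backward[of x "- r"] dd_backward[of x "- r"] by auto
  qed
  then show "x + r *\<^sub>R \<theta> \<in> \<Omega>" "dd (x + r *\<^sub>R \<theta>) = dd x - r" "db (x + r *\<^sub>R \<theta>) = db x + r"
    "exit (x + r *\<^sub>R \<theta>) = exit x" "entry (x + r *\<^sub>R \<theta>) = entry x" by auto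
qed

lemma open_less_dd:
  assumes "0 \<le> t"
  shows "open {x \<in> \<Omega>. t < dd x}"
proof -
  have "x \<in> \<Omega> \<and> t < dd x \<longleftrightarrow> (\<forall>r\<in>{0..t}. x + r *\<^sub>R \<theta> \<in> \<Omega>)" for x
    using less_dd_iff[OF _ assms, of x] assms by (cases "x \<in> \<Omega>") (auto intro!: bexI[of _ 0])
  then have "{x \<in> \<Omega>. t < dd x} = {x. \<forall>k\<in>(\<lambda>r. r *\<^sub>R \<theta>) ` {0..t}. x + k \<in> \<Omega>}"
    by simp
  also have "open \<dots>"
    by (intro open_compact_tube open_domain compact_continuous_image continuous_intros) auto
  finally show ?thesis .
qed

lemma borel_dd: "(\<lambda>x. indicator \<Omega> x * dd x) \<in> borel_measurable borel"
proof (rule borel_measurableI_greater)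
  fix t :: real
  show "{x \<in> space borel. t < indicator \<Omega> x * dd x} \<in> sets borel"
  proof (cases "0 \<le> t")
    case True
    then have "{x \<in> space borel. t < indicator \<Omega> x * dd x} = {x \<in> \<Omega>. t < dd x}"
      using True by (auto simp: indicator_def split: if_splits)
    then show ?thesis using open_less_dd[OF True] by simp
  next
    case False
    have "t < indicator \<Omega> x * dd x" for x
      using dd_facts(1)[of x] False by (auto simp: indicator_def)
    then have "{x \<in> space borel. t < indicator \<Omega> x * dd x} = UNIV"
      by auto
    then show ?thesis by simp
  qed
qed

definition dd0 :: "'a \<Rightarrow> real" where "dd0 x = indicator \<Omega> x * dd x"

lemma borel_dd0 [measurable]: "dd0 \<in> borel_measurable borel"
  using borel_dd by (simp add: dd0_def[abs_def])

lemma dd0_eq: "x \<in> \<Omega> \<Longrightarrow> dd0 x = dd x" "x \<notin> \<Omega> \<Longrightarrow> dd0 x = 0"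
  by (auto simp: dd0_def)

definition db0 :: "'a \<Rightarrow> real" where "db0 x = indicator \<Omega> x * db x"

lemma borel_db0 [measurable]: "db0 \<in> borel_measurable borel"
  using directed_domain.borel_dd[OF reverse] by (simp add: db0_def[abs_def] back_eq)

lemma db0_eq: "x \<in> \<Omega> \<Longrightarrow> db0 x = db x" "x \<notin> \<Omega> \<Longrightarrow> db0 x = 0"
  by (auto simp: db0_def)

section \<open>The directional measure as an image measure\<close>

lemma measurable_exit: "exit \<in> lebesgue_on \<Omega> \<rightarrow>\<^sub>M restrict_space borel (frontier \<Omega>)"
proof (rule measurable_restrict_space2)
  show "exit \<in> space (lebesgue_on \<Omega>) \<rightarrow> frontier \<Omega>" using dd_facts(5) by auto
  have "(\<lambda>x. x + dd0 x *\<^sub>R \<theta>) \<in> lebesgue_on \<Omega> \<rightarrow>\<^sub>M borel"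
    by (rule borel_measurable_lebesgue_onI) measurable
  then show "exit \<in> lebesgue_on \<Omega> \<rightarrow>\<^sub>M borel"
    by (rule measurable_cong[THEN iffD1, rotated]) (auto simp: exit_eq dd0_eq)
qed

lemma dir_measure_eq: "dir_measure \<Omega> \<theta> = distr (lebesgue_on \<Omega>) (restrict_space borel (frontier \<Omega>)) exit"
  by (simp add: dir_measure_def exit_def[abs_def])

lemma sets_dir_measure [measurable_cong]: "sets (dir_measure \<Omega> \<theta>) = sets (restrict_space borel (frontier \<Omega>))"
  by (simp add: dir_measure_eq)

lemma borel_measurable_dir_measureI:
  "f \<in> borel_measurable borel \<Longrightarrow> f \<in> borel_measurable (dir_measure \<Omega> \<theta>)"
  by (subst measurable_cong_sets[OF sets_dir_measure refl]) (rule measurable_restrict_space1)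

lemma AE_dir_measureD:
  "(AE z in dir_measure \<Omega> \<theta>. Q z) \<Longrightarrow> (AE x\<in>\<Omega> in lborel. Q (exit x))"
  unfolding dir_measure_eq
  by (drule AE_distrD[OF measurable_exit]) (simp add: AE_lebesgue_on_iff)

text \<open>The range of \<open>exit\<close> on \<open>\<Omega>\<close>, written with compact ranges of \<open>r\<close> to make it visibly a Borel set.\<close>

definition exit_points :: "'a set" where
  "exit_points = {z \<in> frontier \<Omega>. \<exists>n::nat. \<forall>m::nat. \<forall>r\<in>{inverse (Suc m)..inverse (Suc n)}. z - r *\<^sub>R \<theta> \<in> \<Omega>}"

lemma exit_in_exit_points:
  assumes "x \<in> \<Omega>"
  shows "exit x \<in> exit_points"
proof -
  obtain n where n: "inverse (Suc n) < dd x"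
    using reals_Archimedean[OF dd_facts(1)[OF assms]] by blast
  have "exit x - r *\<^sub>R \<theta> \<in> \<Omega>" if "r \<in> {inverse (Suc m)..inverse (Suc n)}" for r m
  proof -
    have "0 < inverse (real (Suc m))" by simp
    then have "0 < r" using that by (auto simp del: inverse_positive_iff_positive)
    then show ?thesis
      using dd_facts(3)[OF assms, of "dd x - r"] that n by (simp add: exit_eq algebra_simps)
  qed
  then show ?thesis using dd_facts(5)[OF assms] unfolding exit_points_def by blast
qed

lemma exit_points_exit:
  assumes "z \<in> exit_points"
  obtains x where "x \<in> \<Omega>" "exit x = z"
proof -
  obtain n :: nat where n: "\<forall>m::nat. \<forall>r\<in>{inverse (real (Suc m))..inverse (Suc n)}. z - r *\<^sub>R \<theta> \<in> \<Omega>"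
    and z: "z \<in> frontier \<Omega>" using assms unfolding exit_points_def by blast
  have seg: "z - r *\<^sub>R \<theta> \<in> \<Omega>" if r: "0 < r" "r \<le> inverse (Suc n)" for r
  proof -
    obtain m where "inverse (Suc m) < r" using reals_Archimedean[OF r(1)] by blast
    then show ?thesis using n r by (meson atLeastAtMost_iff less_imp_le)
  qed
  let ?d = "inverse (real (Suc n))"
  let ?x = "z - ?d *\<^sub>R \<theta>"
  have x: "?x \<in> \<Omega>" by (rule seg) auto
  have "dd ?x = ?d"
  proof (rule dd_eqI[OF _ _ _ x])
    show "?x + t *\<^sub>R \<theta> \<in> \<Omega>" if "0 \<le> t" "t < ?d" for t
      using seg[of "?d - t"] that by (simp add: algebra_simps)
    show "?x + ?d *\<^sub>R \<theta> \<notin> \<Omega>" using z open_domain by (simp add: frontier_def interior_open)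
  qed auto
  then have "exit ?x = z" by (simp add: exit_eq)
  with x that show ?thesis by blast
qed

lemma sets_exit_points [measurable]: "exit_points \<in> sets borel"
proof -
  have "exit_points = frontier \<Omega> \<inter> (\<Union>n::nat. \<Inter>m::nat. {z. \<forall>k\<in>(\<lambda>r. - (r *\<^sub>R \<theta>)) ` {inverse (real (Suc
      m))..inverse (Suc n)}. z + k \<in> \<Omega>})"
    by (auto simp: exit_points_def)
  moreover have "{z. \<forall>k\<in>(\<lambda>r. - (r *\<^sub>R \<theta>)) ` {inverse (real (Suc m))..inverse (Suc n)}. z + k \<in> \<Omega>} \<in> sets
      borel" for m n :: nat
    by (intro borel_open open_compact_tube open_domain compact_continuous_image continuous_intros) auto
  ultimately show ?thesis
    by (auto intro!: sets.Int sets.countable_UN sets.countable_INT)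
qed

text \<open>A set of exit points with negligible shadow is \<open>\<mu>\<^sub>\<theta>\<close>-null although it need not be Borel: it lies in the
  translation-invariant Borel set of the points whose line meets the shadow in positive length.\<close>

lemma AE_dir_measureI:
  assumes "AE x\<in>\<Omega> in lborel. Q (exit x)"
  shows "AE z in dir_measure \<Omega> \<theta>. Q z"
proof -
  obtain N where N: "N \<in> null_sets lborel" "{x. \<not> (x \<in> \<Omega> \<longrightarrow> Q (exit x))} \<subseteq> N"
    using assms by (auto simp: eventually_ae_filter)
  have [measurable]: "N \<in> sets borel" using N(1) by auto
  define Y where "Y = {x. (\<integral>\<^sup>+r. indicator N (x + r *\<^sub>R \<theta>) \<partial>lborel) \<noteq> 0}"
  have [measurable]: "Y \<in> sets borel" unfolding Y_def by measurable
  have "AE x in lborel. AE r in lborel. x + r *\<^sub>R \<theta> \<notin> N"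
    by (rule AE_lborel_lines[OF AE_not_in[OF N(1)]])
  then have notY: "AE x in lborel. x \<notin> Y"
  proof (eventually_elim)
    case (elim x)
    then have "(\<integral>\<^sup>+r. indicator N (x + r *\<^sub>R \<theta>) \<partial>lborel) = (\<integral>\<^sup>+(r::real). 0 \<partial>lborel)"
      by (intro nn_integral_cong_AE) (auto elim!: eventually_mono)
    then show ?case by (simp add: Y_def)
  qed
  \<comment> \<open>The null set N controls points of \<Omega>, while exit points lie outside
    \<Omega>. Invariance along \<theta> carries membership in Y from x to its exit point.\<close>
  have shift: "x + t *\<^sub>R \<theta> \<in> Y \<longleftrightarrow> x \<in> Y" for x t
  proof -
    have "(\<integral>\<^sup>+r. indicator N (x + r *\<^sub>R \<theta>) \<partial>lborel) = (\<integral>\<^sup>+r. indicator N (x + (t + 1 * r) *\<^sub>R \<theta>) \<partial>lborel)"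
      by (subst nn_integral_real_affine[of _ 1 t]) auto
    then show ?thesis by (simp add: Y_def algebra_simps)
  qed
  have bad: "z \<in> Y" if "z \<in> exit_points" "\<not> Q z" for z
  proof -
    obtain x where x: "x \<in> \<Omega>" "exit x = z" using exit_points_exit \<open>z \<in> exit_points\<close> by blast
    \<comment> \<open>All points between x and z exit at z, so a single bad z fills a whole segment
      of N.\<close>
    have "x + r *\<^sub>R \<theta> \<in> N" if "0 \<le> r" "r < dd x" for r
      using dd_forward[OF x(1) that] x \<open>\<not> Q z\<close> N(2) by auto
    then have "(\<integral>\<^sup>+r. indicator {0<..<dd x} r \<partial>lborel) \<le> (\<integral>\<^sup>+r. indicator N (x + r *\<^sub>R \<theta>) \<partial>lborel)"
      by (intro nn_integral_mono) (auto simp: indicator_def)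
    then have "x \<in> Y" using dd_facts(1)[OF x(1)] by (auto simp: Y_def)
    then show ?thesis using shift[of x "dd x"] x(2) by (simp add: exit_eq)
  qed
  have [measurable]: "(\<lambda>x. x) \<in> borel_measurable (restrict_space borel (frontier \<Omega>))"
    by (rule measurable_restrict_space1) simp
  have AE1: "AE z in dir_measure \<Omega> \<theta>. z \<in> exit_points"
  proof -
    have "{z \<in> space (restrict_space borel (frontier \<Omega>)). z \<in> exit_points} \<in> sets (restrict_space borel
        (frontier \<Omega>))"
      by measurable
    then show ?thesis
      unfolding dir_measure_eq by (subst AE_distr_iff[OF measurable_exit]) (auto simp: exit_in_exit_points)
  qed
  have AE2: "AE z in dir_measure \<Omega> \<theta>. z \<notin> Y"
  proof -
    have "{z \<in> space (restrict_space borel (frontier \<Omega>)). z \<notin> Y} \<in> sets (restrict_space borel (frontier \<Omega>))"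
      by measurable
    then show ?thesis
      unfolding dir_measure_eq
      by (subst AE_distr_iff[OF measurable_exit])
        (use notY shift in \<open>auto simp: AE_lebesgue_on_iff exit_eq elim!: eventually_mono\<close>)
  qed
  show ?thesis using AE1 AE2 by eventually_elim (use bad in blast)
qed

text \<open>The representative is the limit of the averages of \<open>G\<close> over short segments ending at \<open>z\<close>.\<close>

lemma exit_function_borel_representative:
  fixes F G :: "'a \<Rightarrow> real"
  assumes [measurable]: "G \<in> borel_measurable borel" and FG: "AE x\<in>\<Omega> in lborel. F (exit x) = G x"
  obtains F' where "F' \<in> borel_measurable borel" "AE x\<in>\<Omega> in lborel. F' (exit x) = G x"
    "AE z in dir_measure \<Omega> \<theta>. F z = F' z"
proof -
  define F' where "F' z = lim (\<lambda>n. real (Suc n) * (LINT r|lborel. indicator {0<..<inverse (real (Suc n))}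
      r * G (z - r *\<^sub>R \<theta>)))" for z
  have [measurable]: "F' \<in> borel_measurable borel"
    unfolding F'_def[abs_def] by measurable
  have "AE x in lborel. AE r in lborel. x + r *\<^sub>R \<theta> \<in> \<Omega> \<longrightarrow> F (exit (x + r *\<^sub>R \<theta>)) = G (x + r *\<^sub>R \<theta>)"
    using AE_lborel_lines[OF FG] .
  then have F': "AE x\<in>\<Omega> in lborel. F' (exit x) = F (exit x)"
  proof (eventually_elim, intro impI)
    fix x
    assume elim: "AE r in lborel. x + r *\<^sub>R \<theta> \<in> \<Omega> \<longrightarrow> F (exit (x + r *\<^sub>R \<theta>)) = G (x + r *\<^sub>R \<theta>)" "x \<in> \<Omega>"
    let ?c = "F (exit x)"
    \<comment> \<open>The substitution r -> dd x - r measures the distance backwards from the exit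
      point, so that the averages refer to z and no longer to x.\<close>
    have ae: "AE r in lborel. 0 < r \<and> r < dd x \<longrightarrow> G (exit x - r *\<^sub>R \<theta>) = ?c"
    proof -
      have "distr lborel borel (\<lambda>r. dd x + (-1) * r) = lborel"
        using lborel_real_affine[of "-1" "dd x", symmetric] by (simp add: density_1)
      then have "AE r in distr lborel borel (\<lambda>r. dd x + (-1) * r). x + r *\<^sub>R \<theta> \<in> \<Omega> \<longrightarrow> F (exit (x + r *\<^sub>R
          \<theta>)) = G (x + r *\<^sub>R \<theta>)"
        using elim(1) by metis
      from AE_distrD[OF _ this]
      have "AE r in lborel. x + (dd x - r) *\<^sub>R \<theta> \<in> \<Omega> \<longrightarrow> F (exit (x + (dd x - r) *\<^sub>R \<theta>)) = G (x + (dd x - r)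
          *\<^sub>R \<theta>)"
        by simp
      then show ?thesis
      proof (eventually_elim, intro impI)
        fix r assume r: "x + (dd x - r) *\<^sub>R \<theta> \<in> \<Omega> \<longrightarrow> F (exit (x + (dd x - r) *\<^sub>R \<theta>)) = G (x + (dd x - r)
            *\<^sub>R \<theta>)" "0 < r \<and> r < dd x"
        then show "G (exit x - r *\<^sub>R \<theta>) = ?c"
          using dd_forward[OF elim(2), of "dd x - r"] by (simp add: exit_eq algebra_simps)
      qed
    qed
    \<comment> \<open>Once the averaging segment is shorter than \<open>dd x\<close> it lies inside
      the segment of x, where G is almost everywhere the constant \<open>F (exit x)\<close>. The
      averages are thus eventually equal to this constant.\<close>
    obtain N where N: "inverse (real (Suc N)) < dd x"
      using reals_Archimedean[OF dd_facts(1)[OF elim(2)]] by blast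
    have "real (Suc n) * (LINT r|lborel. indicator {0<..<inverse (real (Suc n))} r * G (exit x - r *\<^sub>R \<theta>))
        = ?c" if "N \<le> n" for n
    proof -
      have "inverse (real (Suc n)) \<le> inverse (real (Suc N))" using that by (simp add: field_simps)
      then have n: "inverse (real (Suc n)) < dd x" using N by linarith
      have "(LINT r|lborel. indicator {0<..<inverse (real (Suc n))} r * G (exit x - r *\<^sub>R \<theta>)) =
        (LINT r|lborel. indicator {0<..<inverse (real (Suc n))} r * ?c)"
        by (rule integral_cong_AE) (use ae n in \<open>auto simp: indicator_def elim!: eventually_mono\<close>)
      also have "\<dots> = inverse (real (Suc n)) * ?c" by simp
      finally show ?thesis by simp
    qed
    then have "(\<lambda>n. real (Suc n) * (LINT r|lborel. indicator {0<..<inverse (real (Suc n))} r * G (exit x -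
        r *\<^sub>R \<theta>))) \<longlonglongrightarrow> ?c"
      by (intro tendsto_eventually eventually_sequentiallyI[of N])
    then show "F' (exit x) = F (exit x)" unfolding F'_def by (rule limI)
  qed
  show ?thesis
  proof (rule that[of F'])
    show "AE x\<in>\<Omega> in lborel. F' (exit x) = G x" using F' FG by eventually_elim auto
    show "AE z in dir_measure \<Omega> \<theta>. F z = F' z"
      by (rule AE_dir_measureI) (use F' in \<open>auto elim!: eventually_mono\<close>)
  qed simp
qed

lemma integral_dir_measure:
  fixes F' G :: "'a \<Rightarrow> real"
  assumes [measurable]: "F' \<in> borel_measurable borel" "G \<in> borel_measurable borel"
    and FG: "AE x\<in>\<Omega> in lborel. F' (exit x) = G x" and G0: "\<And>x. x \<notin> \<Omega> \<Longrightarrow> G x = 0"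
  shows "integrable (dir_measure \<Omega> \<theta>) F' \<longleftrightarrow> integrable lborel G"
    and "(LINT z|dir_measure \<Omega> \<theta>. F' z) = (LINT x|lborel. G x)"
proof -
  have F': "F' \<in> borel_measurable (restrict_space borel (frontier \<Omega>))"
    by (rule measurable_restrict_space1) simp
  have m: "(\<lambda>x. F' (exit x)) \<in> borel_measurable (lebesgue_on \<Omega>)"
    using measurable_compose[OF measurable_exit F'] .
  show "integrable (dir_measure \<Omega> \<theta>) F' \<longleftrightarrow> integrable lborel G"
    unfolding dir_measure_eq integrable_distr_eq[OF measurable_exit F']
    by (rule lebesgue_on_integral_borel(1)) (use m FG G0 in auto)
  show "(LINT z|dir_measure \<Omega> \<theta>. F' z) = (LINT x|lborel. G x)"
    unfolding dir_measure_eq integral_distr[OF measurable_exit F']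
    by (rule lebesgue_on_integral_borel(2)) (use m FG G0 in auto)
qed

text \<open>F may be built from arbitrary choices, as with \<open>dir_opposite\<close> and
  \<open>bd_tr\<close>. Agreement almost everywhere with a Borel F' makes it measurable for the
  completion, and there both have the same integral.\<close>

lemma integral_completion_dir_measure:
  fixes F G :: "'a \<Rightarrow> real"
  assumes G: "G \<in> borel_measurable borel"
    and FG: "AE x\<in>\<Omega> in lborel. F (exit x) = G x" and G0: "\<And>x. x \<notin> \<Omega> \<Longrightarrow> G x = 0"
  shows "integrable (completion (dir_measure \<Omega> \<theta>)) F \<longleftrightarrow> integrable lborel G"
    and "(LINT z|completion (dir_measure \<Omega> \<theta>). F z) = (LINT x|lborel. G x)"
proof -
  obtain F' where F': "F' \<in> borel_measurable borel" "AE x\<in>\<Omega> in lborel. F' (exit x) = G x"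
    "AE z in dir_measure \<Omega> \<theta>. F z = F' z"
    using exit_function_borel_representative[OF G FG] by blast
  have m: "F' \<in> borel_measurable (dir_measure \<Omega> \<theta>)" by (rule borel_measurable_dir_measureI[OF F'(1)])
  have mc: "F' \<in> borel_measurable (completion (dir_measure \<Omega> \<theta>))" by (rule measurable_completion[OF m])
  have ae: "AE z in completion (dir_measure \<Omega> \<theta>). F z = F' z" by (rule AE_completion[OF F'(3)])
  have Fm: "F \<in> borel_measurable (completion (dir_measure \<Omega> \<theta>))"
    by (rule completion.borel_measurable_cong_AE[OF mc ae])
  show "integrable (completion (dir_measure \<Omega> \<theta>)) F \<longleftrightarrow> integrable lborel G"
    using integrable_cong_AE[OF Fm mc ae] integrable_completion[OF m] integral_dir_measure(1)[OF F'(1) G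
        F'(2) G0] by simp
  show "(LINT z|completion (dir_measure \<Omega> \<theta>). F z) = (LINT x|lborel. G x)"
    using integral_cong_AE[OF Fm mc ae] integral_completion[OF m] integral_dir_measure(2)[OF F'(1) G F'(2)
        G0] by simp
qed

end

section \<open>Absolute continuity on lines\<close>

text \<open>This is the oriented integral of g from 0 to r. Writing it with indicators on the whole
  real line lets linearity, dominated convergence and Fubini for \<open>lborel\<close> apply
  directly.\<close>

definition prim :: "(real \<Rightarrow> real) \<Rightarrow> real \<Rightarrow> real" where
  "prim g r = (LINT \<rho>|lborel. indicator {0<..<r} \<rho> * g \<rho>) - (LINT \<rho>|lborel. indicator {r<..<0} \<rho> * g \<rho>)"

lemma integrable_interval:
  fixes g :: "real \<Rightarrow> real"
  assumes "integrable lborel g" "A \<in> sets borel"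
  shows "integrable lborel (\<lambda>\<rho>. indicator A \<rho> * g \<rho>)"
  using integrable_mult_indicator[OF _ assms(1), of A] assms(2) by simp

lemma prim_nonneg: "0 \<le> r \<Longrightarrow> prim g r = (LINT \<rho>|lborel. indicator {0<..<r} \<rho> * g \<rho>)"
  and prim_nonpos: "r \<le> 0 \<Longrightarrow> prim g r = - (LINT \<rho>|lborel. indicator {r<..<0} \<rho> * g \<rho>)"
  by (simp_all add: prim_def)

lemma prim_0 [simp]: "prim g 0 = 0"
  by (simp add: prim_def)

lemma prim_add_interval:
  assumes g: "integrable lborel g" and "a \<le> b"
  shows "prim g b = prim g a + (LINT \<rho>|lborel. indicator {a<..<b} \<rho> * g \<rho>)"
proof -
  have [measurable]: "g \<in> borel_measurable borel" using borel_measurable_integrable[OF g] by simp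
  have "(LINT \<rho>|lborel. indicator {0<..<b} \<rho> * g \<rho> - indicator {b<..<0} \<rho> * g \<rho>) =
    (LINT \<rho>|lborel. indicator {0<..<a} \<rho> * g \<rho> - indicator {a<..<0} \<rho> * g \<rho> + indicator {a<..<b} \<rho> * g \<rho>)"
  proof (rule integral_cong_AE)
    show "AE \<rho> in lborel. indicator {0<..<b} \<rho> * g \<rho> - indicator {b<..<0} \<rho> * g \<rho> =
      indicator {0<..<a} \<rho> * g \<rho> - indicator {a<..<0} \<rho> * g \<rho> + indicator {a<..<b} \<rho> * g \<rho>"
      using AE_lborel_singleton[of a] AE_lborel_singleton[of b] AE_lborel_singleton[of 0]
      by eventually_elim (use assms(2) in \<open>auto simp: indicator_def\<close>)
  qed auto
  then show ?thesis
    using integrable_interval[OF g] by (simp add: prim_def)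
qed

text \<open>As the endpoint moves to r, the indicators converge at every point except possibly r
  itself, and |g| dominates.\<close>

lemma prim_continuous:
  assumes g: "integrable lborel g"
  shows "continuous_on S (prim g)"
proof -
  have [measurable]: "g \<in> borel_measurable borel" using borel_measurable_integrable[OF g] by simp
  have conv: "(\<lambda>n. LINT \<rho>|lborel. indicator (A (X n)) \<rho> * g \<rho>) \<longlonglongrightarrow> (LINT \<rho>|lborel. indicator (A r) \<rho> * g \<rho>)"
    if X: "X \<longlonglongrightarrow> r" and [measurable]: "\<And>r. A r \<in> sets borel"
      and ev: "\<And>\<rho>. \<rho> \<noteq> r \<Longrightarrow> \<forall>\<^sub>F n in sequentially. \<rho> \<in> A (X n) \<longleftrightarrow> \<rho> \<in> A r" for X r and A :: "real \<Rightarrow> real set"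
  proof (rule integral_dominated_convergence[where w = "\<lambda>\<rho>. \<bar>g \<rho>\<bar>"])
    show "AE \<rho> in lborel. (\<lambda>n. indicator (A (X n)) \<rho> * g \<rho>) \<longlonglongrightarrow> indicator (A r) \<rho> * g \<rho>"
      using AE_lborel_singleton[of r]
    proof eventually_elim
      case (elim \<rho>)
      show ?case
        by (rule tendsto_eventually) (use ev[OF elim] in \<open>auto elim!: eventually_mono simp: indicator_def\<close>)
    qed
    show "AE \<rho> in lborel. norm (indicator (A (X n)) \<rho> * g \<rho>) \<le> \<bar>g \<rho>\<bar>" for n
      by (auto simp: indicator_def)
  qed (use g in auto)
  have "(prim g \<circ> X) \<longlonglongrightarrow> prim g r" if X: "X \<longlonglongrightarrow> r" for X r
    unfolding prim_def o_def
  proof (intro tendsto_diff conv[OF X])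
    fix \<rho> :: real assume "\<rho> \<noteq> r"
    then consider "\<rho> < r" | "r < \<rho>" by linarith
    then have ev: "\<forall>\<^sub>F n in sequentially. (\<rho> < X n \<longleftrightarrow> \<rho> < r) \<and> (X n < \<rho> \<longleftrightarrow> r < \<rho>)"
    proof cases
      case 1
      from order_tendstoD(1)[OF X 1] show ?thesis by eventually_elim (use 1 in auto)
    next
      case 2
      from order_tendstoD(2)[OF X 2] show ?thesis by eventually_elim (use 2 in auto)
    qed
    then show "\<forall>\<^sub>F n in sequentially. \<rho> \<in> {0<..<X n} \<longleftrightarrow> \<rho> \<in> {0<..<r}"
      by eventually_elim auto
    show "\<forall>\<^sub>F n in sequentially. \<rho> \<in> {X n<..<0} \<longleftrightarrow> \<rho> \<in> {r<..<0}"
      using ev by eventually_elim auto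
  qed auto
  then have "continuous_on UNIV (prim g)"
    by (simp add: continuous_on_sequentially)
  then show ?thesis by (rule continuous_on_subset) auto
qed

text \<open>The product of the two integrals over ]a, b[ is an integral over a square. Cutting the
  square along the diagonal gives two triangles, and by Fubini these are the integrals of (F - F a)
  g and of (G - G a) f; the kernel \<open>h\<close> below is one triangle.\<close>

lemma prim_product:
  assumes f: "integrable lborel f" and g: "integrable lborel g" and "a \<le> b"
    and F: "\<And>s. F s = c + prim f s" and G: "\<And>s. G s = d + prim g s"
  shows "F b * G b - F a * G a = (LINT s|lborel. indicator {a<..<b} s * (F s * g s + G s * f s))"
    and "integrable lborel (\<lambda>s. indicator {a<..<b} s * (F s * g s + G s * f s))"
proof -
  have [measurable]: "f \<in> borel_measurable borel" "g \<in> borel_measurable borel"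
    using borel_measurable_integrable[OF f] borel_measurable_integrable[OF g] by simp_all
  have cont: "continuous_on UNIV F" "continuous_on UNIV G"
    unfolding F[abs_def] G[abs_def] by (intro continuous_intros prim_continuous f g)+
  have [measurable]: "F \<in> borel_measurable borel" "G \<in> borel_measurable borel"
    using borel_measurable_continuous_onI[OF cont(1)] borel_measurable_continuous_onI[OF cont(2)] by auto
  define h where "h p q s r = indicator {a<..<b} s * (indicator {a<..<s} r * p r * q s)" for p q :: "real
      \<Rightarrow> real" and s r :: real
  have h_int: "integrable (lborel \<Otimes>\<^sub>M lborel) (\<lambda>(s, r). h p q s r)" if p: "integrable lborel p" and q:
      "integrable lborel q" for p q
  proof -
    have [measurable]: "p \<in> borel_measurable borel" "q \<in> borel_measurable borel"
      using borel_measurable_integrable[OF p] borel_measurable_integrable[OF q] by simp_all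
    have "integrable (lborel \<Otimes>\<^sub>M lborel) (\<lambda>z. p (snd z) * q (fst z))"
    proof (rule lborel_pair.Fubini_integrable)
      show "integrable lborel (\<lambda>x. LINT y|lborel. norm (p (snd (x, y)) * q (fst (x, y))))"
        using q by (simp add: abs_mult)
      show "AE x in lborel. integrable lborel (\<lambda>y. p (snd (x, y)) * q (fst (x, y)))"
        using p by auto
    qed measurable
    then show ?thesis
      by (rule Bochner_Integration.integrable_bound) (auto simp: h_def case_prod_unfold indicator_def)
  qed
  have inner: "(LINT r|lborel. h p q s r) = indicator {a<..<b} s * ((prim p s - prim p a) * q s)"
    if p: "integrable lborel p" for p q s
  proof -
    have "(LINT r|lborel. h p q s r) = (LINT r|lborel. (indicator {a<..<b} s * q s) * (indicator {a<..<s}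
        r * p r))"
      by (simp add: h_def mult_ac)
    also have "\<dots> = (indicator {a<..<b} s * q s) * (LINT r|lborel. indicator {a<..<s} r * p r)"
      by simp
    also have "\<dots> = indicator {a<..<b} s * ((prim p s - prim p a) * q s)"
    proof (cases "s \<in> {a<..<b}")
      case True
      then show ?thesis using prim_add_interval[OF p, of a s] by simp
    qed simp
    finally show ?thesis .
  qed
  have int1: "integrable lborel (\<lambda>s. indicator {a<..<b} s * ((prim f s - prim f a) * g s))"
    using lborel_pair.integrable_fst'[OF h_int[OF f g]] by (simp add: inner[OF f])
  have int2: "integrable lborel (\<lambda>s. indicator {a<..<b} s * ((prim g s - prim g a) * f s))"
    using lborel_pair.integrable_fst'[OF h_int[OF g f]] by (simp add: inner[OF g])
  have Fs: "F s = F a + (prim f s - prim f a)" and Gs: "G s = G a + (prim g s - prim g a)" for s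
    by (simp_all add: F G)
  have expand: "indicator {a<..<b} s * (F s * g s + G s * f s) =
      F a * (indicator {a<..<b} s * g s) + indicator {a<..<b} s * ((prim f s - prim f a) * g s) +
      (G a * (indicator {a<..<b} s * f s) + indicator {a<..<b} s * ((prim g s - prim g a) * f s))" for s
    by (subst Fs, subst Gs) (simp add: algebra_simps)
  show "integrable lborel (\<lambda>s. indicator {a<..<b} s * (F s * g s + G s * f s))"
    unfolding expand using integrable_interval[OF f] integrable_interval[OF g] int1 int2 by auto
  let ?f = "LINT s|lborel. indicator {a<..<b} s * f s" and ?g = "LINT s|lborel. indicator {a<..<b} s * g s"
  have fb: "prim f b - prim f a = ?f" "prim g b - prim g a = ?g"
    using prim_add_interval[OF f \<open>a \<le> b\<close>] prim_add_interval[OF g \<open>a \<le> b\<close>] by auto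
  have "(LINT s|lborel. indicator {a<..<b} s * ((prim g s - prim g a) * f s)) = (LINT s|lborel. LINT
      r|lborel. h g f s r)"
    by (simp add: inner[OF g])
  also have "\<dots> = (LINT r|lborel. LINT s|lborel. h g f s r)"
    using lborel_pair.Fubini_integral[OF h_int[OF g f]] by simp
  finally have sw: "(LINT s|lborel. indicator {a<..<b} s * ((prim g s - prim g a) * f s)) = (LINT
      s|lborel. LINT r|lborel. h g f r s)" .
  have i1: "integrable lborel (\<lambda>s. LINT r|lborel. h f g s r)"
    using lborel_pair.integrable_fst'[OF h_int[OF f g]] by simp
  have i2: "integrable lborel (\<lambda>s. LINT r|lborel. h g f r s)"
    using lborel_pair.integrable_snd[OF h_int[OF g f]] by simp
  have "(LINT s|lborel. indicator {a<..<b} s * ((prim f s - prim f a) * g s)) + (LINT s|lborel. indicator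
      {a<..<b} s * ((prim g s - prim g a) * f s))
    = (LINT s|lborel. LINT r|lborel. h f g s r) + (LINT s|lborel. LINT r|lborel. h g f r s)"
    by (simp add: inner[OF f] sw)
  also have "\<dots> = (LINT s|lborel. (LINT r|lborel. h f g s r) + (LINT r|lborel. h g f r s))"
    by (rule Bochner_Integration.integral_add[OF i1 i2, symmetric])
  also have "\<dots> = (LINT s|lborel. (indicator {a<..<b} s * g s) * ?f)"
  proof (rule integral_cong_AE)
    have "AE s in lborel. integrable lborel (h f g s)"
      using lborel_pair.AE_integrable_fst'[OF h_int[OF f g]] by simp
    moreover have "AE s in lborel. integrable lborel (\<lambda>r. h g f r s)"
      using lborel_pair.AE_integrable_snd[OF h_int[OF g f]] by simp
    ultimately show "AE s in lborel. (LINT r|lborel. h f g s r) + (LINT r|lborel. h g f r s) = (indicator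
        {a<..<b} s * g s) * ?f"
    proof eventually_elim
      case (elim s)
      have "(LINT r|lborel. h f g s r) + (LINT r|lborel. h g f r s) = (LINT r|lborel. h f g s r + h g f r s)"
        using elim by simp
      also have "\<dots> = (LINT r|lborel. (indicator {a<..<b} s * g s) * (indicator {a<..<b} r * f r))"
      proof (rule integral_cong_AE)
        \<comment> \<open>For fixed s the two triangle indicators add up to that of the square
          except at r = s.\<close>
        show "AE r in lborel. h f g s r + h g f r s = (indicator {a<..<b} s * g s) * (indicator {a<..<b} r
            * f r)"
          using AE_lborel_singleton[of s]
          by eventually_elim (auto simp: h_def indicator_def)
      qed (use elim in \<open>auto simp: borel_measurable_integrable\<close>)
      finally show ?case by simp
    qed
    show "(\<lambda>s. (LINT r|lborel. h f g s r) + (LINT r|lborel. h g f r s)) \<in> borel_measurable lborel"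
      using i1 i2 by (auto dest: borel_measurable_integrable)
  qed auto
  also have "\<dots> = ?f * ?g" by simp
  finally have key: "(LINT s|lborel. indicator {a<..<b} s * ((prim f s - prim f a) * g s)) +
    (LINT s|lborel. indicator {a<..<b} s * ((prim g s - prim g a) * f s)) = ?f * ?g" .
  have "(LINT s|lborel. indicator {a<..<b} s * (F s * g s + G s * f s)) = F a * ?g + G a * ?f + ?f * ?g"
    unfolding expand using integrable_interval[OF f] integrable_interval[OF g] int1 int2 key by simp
  then show "F b * G b - F a * G a = (LINT s|lborel. indicator {a<..<b} s * (F s * g s + G s * f s))"
    unfolding Fs[of b] Gs[of b] fb by (simp add: algebra_simps)
qed

section \<open>Translates and products with intervals\<close>

lemma integrable_lborel_translate:
  fixes f :: "'a::euclidean_space \<Rightarrow> real"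
  assumes "integrable lborel f"
  shows "integrable lborel (\<lambda>x. f (x + c))"
proof -
  have "integrable (distr lborel borel ((+) c)) f" using assms by (simp add: lborel_distr_plus)
  from integrable_distr[OF _ this] show ?thesis by (simp add: add.commute)
qed

lemma integral_lborel_translate:
  fixes f :: "'a::euclidean_space \<Rightarrow> real"
  assumes [measurable]: "f \<in> borel_measurable borel"
  shows "(LINT x|lborel. f (x + c)) = (LINT x|lborel. f x)"
proof -
  have "(LINT x|lborel. f x) = (LINT x|distr lborel borel ((+) c). f x)" by (simp add: lborel_distr_plus)
  also have "\<dots> = (LINT x|lborel. f (c + x))" by (rule integral_distr) auto
  finally show ?thesis by (simp add: add.commute)
qed

lemma AE_lborel_uminus:
  assumes "AE r::real in lborel. P r"
  shows "AE r in lborel. P (- r)"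
proof -
  have "AE r in distr lborel borel uminus. P r" using assms by (subst lborel_distr_uminus)
  from AE_distrD[OF _ this] show ?thesis by simp
qed

lemma integrable_product_interval:
  fixes f :: "'a::euclidean_space \<Rightarrow> real" and a b :: real
  assumes f: "integrable lborel f"
  shows "integrable (lborel \<Otimes>\<^sub>M lborel) (\<lambda>(x, r). indicator {a<..<b} r * f x)"
proof -
  have [measurable]: "f \<in> borel_measurable borel" using borel_measurable_integrable[OF f] by simp
  show ?thesis
  proof (rule lborel_pair.Fubini_integrable)
    show "integrable lborel (\<lambda>x. LINT y|lborel. norm (case (x, y) of (x, r) \<Rightarrow> indicator {a<..<b} r * f x))"
      using f by (simp add: abs_mult)
    show "AE x in lborel. integrable lborel (\<lambda>y. case (x, y) of (x, r) \<Rightarrow> indicator {a<..<b} r * f x)"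
      using emeasure_bounded_finite[of "{a<..<b}"] by (auto intro!: integrable_real_indicator)
  qed measurable
qed

lemma integrable_of_square_integrable:
  fixes f :: "'a::euclidean_space \<Rightarrow> real"
  assumes [measurable]: "f \<in> borel_measurable borel" and f: "integrable lborel (\<lambda>x. (f x)\<^sup>2)"
    and S: "bounded S" "S \<in> sets borel" and 0: "\<And>x. x \<notin> S \<Longrightarrow> f x = 0"
  shows "integrable lborel f"
proof (rule Bochner_Integration.integrable_bound)
  have "emeasure lborel S < \<infinity>" using emeasure_bounded_finite[OF S(1)] by simp
  then show "integrable lborel (\<lambda>x. indicator S x + (f x)\<^sup>2)"
    using f S(2) by (auto intro!: integrable_real_indicator)
  have "\<bar>f x\<bar> \<le> indicator S x + (f x)\<^sup>2" for x
  proof (cases "x \<in> S")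
    case True
    \<comment> \<open>Expanding the square gives 2|f| <= 1 + f^2; the constant is integrable on the
      bounded set S.\<close>
    have "0 \<le> (\<bar>f x\<bar> - 1)\<^sup>2" "0 \<le> (f x)\<^sup>2" by auto
    then show ?thesis using True by (simp add: power2_eq_square algebra_simps)
  qed (simp add: 0)
  then show "AE x in lborel. norm (f x) \<le> norm (indicator S x + (f x)\<^sup>2)"
    by (auto intro!: order_trans[OF _ abs_ge_self])
qed simp

section \<open>Weak derivatives along almost every line\<close>

context directed_domain
begin

text \<open>The weak derivative relation for Borel functions extended by zero. In this form all
  integrals run over the whole space, as the shear requires, and lines may leave \<Omega>.\<close>

definition wd :: "('a \<Rightarrow> real) \<Rightarrow> ('a \<Rightarrow> real) \<Rightarrow> bool" where
  "wd u w \<longleftrightarrow> u \<in> borel_measurable borel \<and> w \<in> borel_measurable borel \<and>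
    integrable lborel (\<lambda>x. (u x)\<^sup>2) \<and> integrable lborel (\<lambda>x. (w x)\<^sup>2) \<and>
    (\<forall>x. x \<notin> \<Omega> \<longrightarrow> u x = 0 \<and> w x = 0) \<and>
    (\<forall>\<phi>\<in>test_functions \<Omega>. (LINT x|lborel. u x * frechet_derivative \<phi> (at x) \<theta>) = - (LINT x|lborel. w x * \<phi> x))"

lemma wdD:
  assumes "wd u w"
  shows "u \<in> borel_measurable borel" "w \<in> borel_measurable borel"
    "integrable lborel (\<lambda>x. (u x)\<^sup>2)" "integrable lborel (\<lambda>x. (w x)\<^sup>2)"
    "\<And>x. x \<notin> \<Omega> \<Longrightarrow> u x = 0" "\<And>x. x \<notin> \<Omega> \<Longrightarrow> w x = 0"
    "integrable lborel u" "integrable lborel w"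
proof -
  show *: "u \<in> borel_measurable borel" "w \<in> borel_measurable borel"
    "integrable lborel (\<lambda>x. (u x)\<^sup>2)" "integrable lborel (\<lambda>x. (w x)\<^sup>2)"
    "\<And>x. x \<notin> \<Omega> \<Longrightarrow> u x = 0" "\<And>x. x \<notin> \<Omega> \<Longrightarrow> w x = 0"
    using assms by (auto simp: wd_def)
  show "integrable lborel u" "integrable lborel w"
    using * by (auto intro!: integrable_of_square_integrable[OF _ _ bounded_domain borel_domain])
qed

lemma wd_reverse:
  assumes "wd u w"
  shows "directed_domain.wd \<Omega> (- \<theta>) u (\<lambda>x. - w x)"
proof -
  have "frechet_derivative \<phi> (at x) (- \<theta>) = - frechet_derivative \<phi> (at x) \<theta>" if "\<phi> \<in> test_functions \<Omega>" for \<phi> x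
    using has_derivative_linear[OF test_function_derivative[OF that]] by (simp add: linear_neg)
  then show ?thesis
    using assms by (auto simp: wd_def directed_domain.wd_def[OF reverse])
qed

definition line :: "('a \<Rightarrow> real) \<Rightarrow> 'a \<Rightarrow> real \<Rightarrow> real" where
  "line f x r = f (x + r *\<^sub>R \<theta>)"

text \<open>Test the weak derivative with \<open>x \<mapsto> \<phi> (x - r \<theta>)\<close> for all \<open>0 < r < \<tau>\<close> and integrate in \<open>r\<close>.\<close>

lemma acl_fixed:
  assumes wd: "wd u w" and \<tau>: "0 \<le> \<tau>"
  shows "AE x in lborel. (\<forall>r\<in>{0..\<tau>}. x + r *\<^sub>R \<theta> \<in> \<Omega>) \<longrightarrow> u (x + \<tau> *\<^sub>R \<theta>) = u x + prim (line w x) \<tau>"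
proof -
  note [measurable] = wdD(1,2)[OF wd]
  note u = wdD(7)[OF wd] and w = wdD(8)[OF wd]
  \<comment> \<open>A test function supported in S may be shifted along \<theta> by any r between 0
    and \<tau> and stays supported in \<Omega>. S is at the same time the set on which the claim is
    made.\<close>
  define S where "S = {x. \<forall>k\<in>(\<lambda>r. r *\<^sub>R \<theta>) ` {0..\<tau>}. x + k \<in> \<Omega>}"
  have S: "open S"
    unfolding S_def by (intro open_compact_tube open_domain compact_continuous_image continuous_intros) auto
  let ?I = "\<lambda>r. indicator {0<..<\<tau>} r :: real"
  have wI: "integrable (lborel \<Otimes>\<^sub>M lborel) (\<lambda>(x, r). ?I r * w (x + r *\<^sub>R \<theta>))"
    using integrable_lborel_shear[OF integrable_product_interval[OF w, of 0 \<tau>], of \<theta>] by simp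
  define f where "f x = u x - u (x + \<tau> *\<^sub>R \<theta>) + prim (line w x) \<tau>" for x
  have prim_eq: "prim (line w x) \<tau> = (LINT r|lborel. ?I r * w (x + r *\<^sub>R \<theta>))" for x
    using \<tau> by (simp add: prim_nonneg line_def)
  have primI: "integrable lborel (\<lambda>x. prim (line w x) \<tau>)"
    unfolding prim_eq using lborel_pair.integrable_fst'[OF wI] by simp
  have uI: "integrable lborel (\<lambda>x. u (x + \<tau> *\<^sub>R \<theta>))" by (rule integrable_lborel_translate[OF u])
  have fI: "integrable lborel f"
    unfolding f_def[abs_def] using u uI primI by auto
  have "AE x\<in>S in lborel. f x = 0"
  proof (rule test_functions_separate[OF S])
    show "f \<in> borel_measurable borel" using borel_measurable_integrable[OF fI] by simp
    show "integrable lborel (\<lambda>x. indicator K x * f x)" if "compact K" for K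
      using integrable_mult_indicator[OF _ fI, of K] that by (auto simp: compact_imp_closed)
    fix \<phi> assume \<phi>: "\<phi> \<in> test_functions S"
    note [measurable] = test_function_borel[OF \<phi>] test_function_derivative_borel[OF \<phi>]
    let ?D = "\<lambda>x. frechet_derivative \<phi> (at x) \<theta>"
    obtain B where B: "\<And>x. \<bar>\<phi> x\<bar> \<le> B" using test_function_bounded(1)[OF \<phi>] by blast
    obtain B' where B': "\<And>x. \<bar>?D x\<bar> \<le> B'" using test_function_bounded(2)[OF \<phi>, of \<theta>] by blast
    have shift: "(LINT x|lborel. u x * ?D (x - r *\<^sub>R \<theta>)) = - (LINT x|lborel. w x * \<phi> (x - r *\<^sub>R \<theta>))"
      if "r \<in> {0<..<\<tau>}" for r
    proof -
      have "x + r *\<^sub>R \<theta> \<in> \<Omega>" if "x \<in> S" for x using that \<open>r \<in> {0<..<\<tau>}\<close> by (auto simp: S_def)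
      then have *: "(\<lambda>x. \<phi> (x - r *\<^sub>R \<theta>)) \<in> test_functions \<Omega>"
        "\<And>x. frechet_derivative (\<lambda>x. \<phi> (x - r *\<^sub>R \<theta>)) (at x) = frechet_derivative \<phi> (at (x - r *\<^sub>R \<theta>))"
        using test_function_shift[OF \<phi>] by blast+
      show ?thesis using wd *(1) unfolding wd_def by (auto simp: *(2) dest!: bspec[OF _ *(1)])
    qed
    have mult_int: "integrable lborel (\<lambda>x. h x * \<phi> x)" if h: "integrable lborel h" for h
    proof (rule Bochner_Integration.integrable_bound)
      show "integrable lborel (\<lambda>x. B * h x)" using h by simp
      have [measurable]: "h \<in> borel_measurable borel" using borel_measurable_integrable[OF h] by simp
      show "(\<lambda>x. h x * \<phi> x) \<in> borel_measurable lborel" by simp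
      have "\<bar>h x * \<phi> x\<bar> \<le> \<bar>B * h x\<bar>" for x
        using mult_left_mono[OF order_trans[OF B abs_ge_self], of "\<bar>h x\<bar>" x] by (simp add: abs_mult
            mult.commute)
      then show "AE x in lborel. norm (h x * \<phi> x) \<le> norm (B * h x)" by simp
    qed
    have dom: "integrable (lborel \<Otimes>\<^sub>M lborel) (\<lambda>(x, r). ?I r * (h x * \<psi> (x - r *\<^sub>R \<theta>)))"
      if h: "integrable lborel h" and [measurable]: "\<psi> \<in> borel_measurable borel" and b: "\<And>x. \<bar>\<psi> x\<bar> \<le> C"
          for h \<psi> C
    proof (rule Bochner_Integration.integrable_bound)
      have [measurable]: "h \<in> borel_measurable borel" using borel_measurable_integrable[OF h] by simp
      show "integrable (lborel \<Otimes>\<^sub>M lborel) (\<lambda>z. C * (case z of (x, r) \<Rightarrow> ?I r * h x))"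
        by (intro integrable_mult_right integrable_product_interval h)
      show "(\<lambda>(x, r). ?I r * (h x * \<psi> (x - r *\<^sub>R \<theta>))) \<in> borel_measurable (lborel \<Otimes>\<^sub>M lborel)" by measurable
      have "\<bar>h x * \<psi> y\<bar> \<le> \<bar>C * h x\<bar>" for x y
        using mult_left_mono[OF order_trans[OF b abs_ge_self], of "\<bar>h x\<bar>" y] by (simp add: abs_mult
            mult.commute)
      then show "AE z in lborel \<Otimes>\<^sub>M lborel. norm (case z of (x, r) \<Rightarrow> ?I r * (h x * \<psi> (x - r *\<^sub>R \<theta>)))
          \<le> norm (C * (case z of (x, r) \<Rightarrow> ?I r * h x))"
        by (auto simp: indicator_def)
    qed
    have d1: "integrable (lborel \<Otimes>\<^sub>M lborel) (\<lambda>(x, r). ?I r * (u x * ?D (x - r *\<^sub>R \<theta>)))"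
      by (rule dom[OF u _ B']) measurable
    have d2: "integrable (lborel \<Otimes>\<^sub>M lborel) (\<lambda>(x, r). ?I r * (w x * \<phi> (x - r *\<^sub>R \<theta>)))"
      by (rule dom[OF w _ B]) measurable
    \<comment> \<open>The derivative of r -> - \<phi> (x - r \<theta>) is the derivative of \<phi>
      along \<theta> at the shifted point, so integrating the tested identity in r leaves two values
      of \<phi>.\<close>
    have FTC: "(LINT r|lborel. ?I r * ?D (x - r *\<^sub>R \<theta>)) = \<phi> x - \<phi> (x - \<tau> *\<^sub>R \<theta>)" for x
    proof -
      have "(LINT r|lborel. ?I r * ?D (x - r *\<^sub>R \<theta>)) = (LINT r|lborel. ?D (x - r *\<^sub>R \<theta>) * indicator {0..\<tau>} r)"
      proof (rule integral_cong_AE)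
        show "AE r in lborel. ?I r * ?D (x - r *\<^sub>R \<theta>) = ?D (x - r *\<^sub>R \<theta>) * indicator {0..\<tau>} r"
          using AE_lborel_singleton[of 0] AE_lborel_singleton[of \<tau>]
          by eventually_elim (auto simp: indicator_def)
      qed auto
      also have "\<dots> = - \<phi> (x - \<tau> *\<^sub>R \<theta>) - - \<phi> (x - 0 *\<^sub>R \<theta>)"
      proof (rule integral_FTC_Icc_real[OF \<tau>])
        fix r :: real
        have "((\<lambda>r. - \<phi> (x - r *\<^sub>R \<theta>)) has_derivative (\<lambda>h. - frechet_derivative \<phi> (at (x - r *\<^sub>R \<theta>)) (- (h
            *\<^sub>R \<theta>)))) (at r)"
          by (rule has_derivative_minus, rule has_derivative_compose[OF _ test_function_derivative[OF \<phi>]])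
            (auto intro!: derivative_eq_intros)
        moreover have "- frechet_derivative \<phi> (at (x - r *\<^sub>R \<theta>)) (- (h *\<^sub>R \<theta>)) = ?D (x - r *\<^sub>R \<theta>) * h" for h
          using has_derivative_linear[OF test_function_derivative[OF \<phi>]]
          by (simp add: linear_neg linear_cmul)
        ultimately show "((\<lambda>r. - \<phi> (x - r *\<^sub>R \<theta>)) has_real_derivative ?D (x - r *\<^sub>R \<theta>)) (at r)"
          by (simp add: has_field_derivative_def)
        have "continuous_on UNIV (\<lambda>r. ?D (x - r *\<^sub>R \<theta>))"
          by (rule continuous_on_compose2[OF test_function_continuous(2)[OF \<phi>]]) (auto intro!:
              continuous_intros)
        then show "isCont (\<lambda>r. ?D (x - r *\<^sub>R \<theta>)) r" by (simp add: continuous_on_eq_continuous_at)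
      qed
      finally show ?thesis by simp
    qed
    have "(LINT x|lborel. u x * (\<phi> x - \<phi> (x - \<tau> *\<^sub>R \<theta>))) =
      (LINT x|lborel. LINT r|lborel. ?I r * (u x * ?D (x - r *\<^sub>R \<theta>)))"
      by (simp add: FTC[symmetric] mult.left_commute)
    also have "\<dots> = (LINT r|lborel. LINT x|lborel. ?I r * (u x * ?D (x - r *\<^sub>R \<theta>)))"
      using lborel_pair.Fubini_integral[OF d1] by simp
    also have "\<dots> = (LINT r|lborel. - (LINT x|lborel. ?I r * (w x * \<phi> (x - r *\<^sub>R \<theta>))))"
      by (intro Bochner_Integration.integral_cong refl) (use shift in \<open>auto simp: indicator_def\<close>)
    also have "\<dots> = - (LINT r|lborel. LINT x|lborel. ?I r * (w x * \<phi> (x - r *\<^sub>R \<theta>)))"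
      by simp
    also have "\<dots> = - (LINT x|lborel. LINT r|lborel. ?I r * (w x * \<phi> (x - r *\<^sub>R \<theta>)))"
      using lborel_pair.Fubini_integral[OF d2] by simp
    \<comment> \<open>The shear moves the shift from \<phi> to w. What remains is the primitive of w
      along the line, tested against \<phi> itself.\<close>
    also have "(LINT x|lborel. LINT r|lborel. ?I r * (w x * \<phi> (x - r *\<^sub>R \<theta>))) =
      (LINT x|lborel. LINT r|lborel. ?I r * (w (x + r *\<^sub>R \<theta>) * \<phi> x))"
      using integral_lborel_shear[OF d2, of \<theta>] by simp
    also have "\<dots> = (LINT x|lborel. prim (line w x) \<tau> * \<phi> x)"
      by (simp add: prim_eq flip: mult.assoc)
    finally have *: "(LINT x|lborel. u x * (\<phi> x - \<phi> (x - \<tau> *\<^sub>R \<theta>))) = - (LINT x|lborel. prim (line w x) \<tau>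
        * \<phi> x)" .
    have "(LINT x|lborel. u x * \<phi> (x - \<tau> *\<^sub>R \<theta>)) = (LINT x|lborel. u (x + \<tau> *\<^sub>R \<theta>) * \<phi> x)"
      using integral_lborel_translate[of "\<lambda>x. u x * \<phi> (x - \<tau> *\<^sub>R \<theta>)" "\<tau> *\<^sub>R \<theta>"] by simp
    moreover have "integrable lborel (\<lambda>x. u x * \<phi> (x - \<tau> *\<^sub>R \<theta>))"
      using integrable_lborel_translate[OF mult_int[OF uI], of "- (\<tau> *\<^sub>R \<theta>)"] by simp
    moreover note mult_int[OF u] mult_int[OF uI] mult_int[OF primI]
    ultimately show "(LINT x|lborel. f x * \<phi> x) = 0"
      using * by (simp add: f_def algebra_simps)
  qed
  then show ?thesis
    by eventually_elim (auto simp: S_def f_def)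
qed

lemma borel_prim_line [measurable]:
  assumes [measurable]: "w \<in> borel_measurable borel" "f \<in> M \<rightarrow>\<^sub>M borel" "g \<in> M \<rightarrow>\<^sub>M borel"
  shows "(\<lambda>z. prim (line w (f z)) (g z)) \<in> borel_measurable M"
proof -
  have "(\<lambda>z. (LINT \<rho>|lborel. (if 0 < \<rho> \<and> \<rho> < g z then w (f z + \<rho> *\<^sub>R \<theta>) else 0)) -
      (LINT \<rho>|lborel. (if g z < \<rho> \<and> \<rho> < 0 then w (f z + \<rho> *\<^sub>R \<theta>) else 0))) \<in> borel_measurable M"
    by measurable
  moreover have "prim (line w (f z)) (g z) = (LINT \<rho>|lborel. (if 0 < \<rho> \<and> \<rho> < g z then w (f z + \<rho> *\<^sub>R \<theta>)
      else 0)) -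
      (LINT \<rho>|lborel. (if g z < \<rho> \<and> \<rho> < 0 then w (f z + \<rho> *\<^sub>R \<theta>) else 0))" for z
    unfolding prim_def line_def
    by (intro arg_cong2[where f = minus] Bochner_Integration.integral_cong) (auto simp: indicator_def)
  ultimately show ?thesis by simp
qed

text \<open>\<open>acl_fixed\<close> has an exceptional set of points for each r separately. Fubini
  turns this into one exceptional set of points, outside which almost every r is admissible; Borel
  measurability of \<open>prim\<close> along lines makes the exchange legitimate.\<close>

lemma acl_forward:
  assumes wd: "wd u w"
  shows "AE x in lborel. AE r in lborel. 0 < r \<and> r < dd0 x \<longrightarrow> u (x + r *\<^sub>R \<theta>) = u x + prim (line w x) r"
proof -
  note [measurable] = wdD(1,2)[OF wd]
  have "AE r in lborel. AE x in lborel. 0 < r \<and> r < dd0 x \<longrightarrow> u (x + r *\<^sub>R \<theta>) = u x + prim (line w x) r"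
  proof (rule AE_I2)
    fix r :: real
    show "AE x in lborel. 0 < r \<and> r < dd0 x \<longrightarrow> u (x + r *\<^sub>R \<theta>) = u x + prim (line w x) r"
    proof (cases "0 \<le> r")
      case True
      show ?thesis using acl_fixed[OF wd True]
      proof eventually_elim
        case (elim x)
        show ?case
        proof
          assume r: "0 < r \<and> r < dd0 x"
          then have "x \<in> \<Omega>" using dd0_eq(2)[of x] by fastforce
          then show "u (x + r *\<^sub>R \<theta>) = u x + prim (line w x) r"
            using elim r less_dd_iff[of x r] by (simp add: dd0_eq)
        qed
      qed
    qed auto
  qed
  moreover have "{z \<in> space (lborel \<Otimes>\<^sub>M lborel). 0 < snd z \<and> snd z < dd0 (fst z) \<longrightarrow>
      u (fst z + snd z *\<^sub>R \<theta>) = u (fst z) + prim (line w (fst z)) (snd z)} \<in> sets (lborel \<Otimes>\<^sub>M lborel)"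
    by measurable
  ultimately show ?thesis
    using lborel_pair.AE_commute[of "\<lambda>x r. 0 < r \<and> r < dd0 x \<longrightarrow> u (x + r *\<^sub>R \<theta>) = u x + prim (line w x) r"]
    by blast
qed

lemma line_integrable:
  fixes f :: "'a \<Rightarrow> real"
  assumes f: "integrable lborel f" and 0: "\<And>x. x \<notin> \<Omega> \<Longrightarrow> f x = 0"
  shows "AE x\<in>\<Omega> in lborel. integrable lborel (line f x)"
proof -
  \<comment> \<open>Two points of \<Omega> on a common line are at most
    \<open>diameter \<Omega>\<close> apart. The added 1 puts all these parameters inside an open
    interval, and is the origin of \<open>diameter \<Omega> + 1\<close> in the later bounds.\<close>
  let ?R = "diameter \<Omega> + 1"
  have "integrable (lborel \<Otimes>\<^sub>M lborel) (\<lambda>(x, r). indicator {-?R<..<?R} r * f (x + r *\<^sub>R \<theta>))"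
    using integrable_lborel_shear[OF integrable_product_interval[OF f, of "-?R" ?R], of \<theta>] by simp
  from lborel_pair.AE_integrable_fst'[OF this]
  have "AE x in lborel. integrable lborel (\<lambda>r. indicator {-?R<..<?R} r * f (x + r *\<^sub>R \<theta>))" by simp
  then show ?thesis
  proof (eventually_elim, intro impI)
    fix x assume i: "integrable lborel (\<lambda>r. indicator {-?R<..<?R} r * f (x + r *\<^sub>R \<theta>))" and x: "x \<in> \<Omega>"
    have "indicator {-?R<..<?R} r * f (x + r *\<^sub>R \<theta>) = line f x r" for r
    proof (cases "x + r *\<^sub>R \<theta> \<in> \<Omega>")
      case True
      have "r \<le> diameter \<Omega>" by (rule segment_le_diameter[OF x True])
      moreover have "- r \<le> diameter \<Omega>" using segment_le_diameter[OF True, of "- r"] x by simp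
      ultimately show ?thesis by (simp add: line_def)
    qed (simp add: line_def 0)
    then show "integrable lborel (line f x)" using i by simp
  qed
qed

text \<open>All that is later asked of the line through x: square integrability, and the primitive
  formula on the whole maximal segment, behind x as well as ahead.\<close>

definition good :: "('a \<Rightarrow> real) \<Rightarrow> ('a \<Rightarrow> real) \<Rightarrow> 'a \<Rightarrow> bool" where
  "good u w x \<longleftrightarrow> integrable lborel (line w x) \<and>
    integrable lborel (\<lambda>r. (line u x r)\<^sup>2) \<and> integrable lborel (\<lambda>r. (line w x r)\<^sup>2) \<and>
    (AE r in lborel. - db x < r \<and> r < dd x \<longrightarrow> line u x r = u x + prim (line w x) r)"

lemma line_reverse: "directed_domain.line (- \<theta>) f x r = line f x (- r)"
  by (simp add: line_def directed_domain.line_def[OF reverse])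

text \<open>Reversing \<theta> changes the sign of the weak derivative and of the parameter;
  together they turn a forward primitive for - \<theta> into the same primitive at a negative
  argument.\<close>

lemma prim_reverse: "prim (\<lambda>r. - g (- r)) r = prim g (- r)"
proof -
  have "(LINT \<rho>|lborel. indicator {a<..<b} \<rho> * (- g (- \<rho>))) = - (LINT \<rho>|lborel. indicator {-b<..<-a} \<rho> * g
      \<rho>)" for a b
    by (subst (2) lborel_integral_real_affine[where c = "-1" and t = 0])
      (auto intro!: Bochner_Integration.integral_cong simp: indicator_def simp flip:
          Bochner_Integration.integral_minus)
  from this[of 0 r] this[of r 0] show ?thesis by (simp add: prim_def)
qed

lemma AE_good:
  assumes wd: "wd u w"
  shows "AE x\<in>\<Omega> in lborel. good u w x"
proof -
  have 1: "AE x\<in>\<Omega> in lborel. integrable lborel (line w x)"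
    using wdD[OF wd] by (intro line_integrable)
  have 2: "AE x\<in>\<Omega> in lborel. integrable lborel (\<lambda>r. (line u x r)\<^sup>2)"
    using line_integrable[OF wdD(3)[OF wd]] wdD(5)[OF wd] by (simp add: line_def[abs_def])
  have 3: "AE x\<in>\<Omega> in lborel. integrable lborel (\<lambda>r. (line w x r)\<^sup>2)"
    using line_integrable[OF wdD(4)[OF wd]] wdD(6)[OF wd] by (simp add: line_def[abs_def])
  \<comment> \<open>The half of the segment behind x is \<open>acl_forward\<close> for the direction
    - \<theta>, translated back to \<theta>.\<close>
  have "directed_domain.dd0 \<Omega> (- \<theta>) = db0"
    by (simp add: fun_eq_iff db0_def directed_domain.dd0_def[OF reverse] back_eq)
  moreover have "prim (\<lambda>r. - w (x - r *\<^sub>R \<theta>)) r = prim (\<lambda>r. w (x + r *\<^sub>R \<theta>)) (- r)" for x r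
    using prim_reverse[of "\<lambda>r. w (x + r *\<^sub>R \<theta>)" r] by simp
  ultimately have 5: "AE x in lborel. AE r in lborel. 0 < r \<and> r < db0 x \<longrightarrow> u (x + r *\<^sub>R (- \<theta>)) = u x + prim
      (line w x) (- r)"
    using directed_domain.acl_forward[OF reverse wd_reverse[OF wd]]
    by (simp add: line_reverse[abs_def] prim_reverse directed_domain.line_def[OF reverse] line_def[abs_def])
  show ?thesis
    using 1 2 3 acl_forward[OF wd] 5
  proof (eventually_elim, intro impI)
    fix x
    assume x: "x \<in> \<Omega>"
      and i: "x \<in> \<Omega> \<longrightarrow> integrable lborel (line w x)" "x \<in> \<Omega> \<longrightarrow> integrable lborel (\<lambda>r. (line u x r)\<^sup>2)"
        "x \<in> \<Omega> \<longrightarrow> integrable lborel (\<lambda>r. (line w x r)\<^sup>2)"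
      and f: "AE r in lborel. 0 < r \<and> r < dd0 x \<longrightarrow> u (x + r *\<^sub>R \<theta>) = u x + prim (line w x) r"
      and b: "AE r in lborel. 0 < r \<and> r < db0 x \<longrightarrow> u (x + r *\<^sub>R (- \<theta>)) = u x + prim (line w x) (- r)"
    have "AE r in lborel. - db x < r \<and> r < dd x \<longrightarrow> line u x r = u x + prim (line w x) r"
      using f AE_lborel_uminus[OF b] AE_lborel_singleton[of 0]
      by eventually_elim (use x in \<open>auto simp: dd0_eq db0_eq line_def\<close>)
    then show "good u w x" using x i by (simp add: good_def)
  qed
qed

end

section \<open>Lebesgue measure and hyperplanes\<close>

lemma nn_integral_lborel_translate:
  fixes c :: "'a::euclidean_space"
  assumes [measurable]: "f \<in> borel_measurable borel"
  shows "(\<integral>\<^sup>+x. f (x + c) \<partial>lborel) = (\<integral>\<^sup>+x. f x \<partial>lborel)"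
proof -
  have "(\<integral>\<^sup>+x. f x \<partial>lborel) = (\<integral>\<^sup>+x. f x \<partial>distr lborel borel ((+) c))" by (simp add: lborel_distr_plus)
  also have "\<dots> = (\<integral>\<^sup>+x. f (c + x) \<partial>lborel)" by (rule nn_integral_distr) auto
  finally show ?thesis by (simp add: add.commute)
qed

lemma lborel_distr_uminus_euclidean: "distr lborel borel uminus = (lborel :: 'a::euclidean_space measure)"
  using lborel_affine[of "-1" "0 :: 'a", symmetric] by (simp add: density_1)

lemma nn_integral_lborel_reflect:
  fixes c :: "'a::euclidean_space"
  assumes [measurable]: "f \<in> borel_measurable borel"
  shows "(\<integral>\<^sup>+x. f (c - x) \<partial>lborel) = (\<integral>\<^sup>+x. f x \<partial>lborel)"
proof -
  have "(\<integral>\<^sup>+x. f x \<partial>lborel) = (\<integral>\<^sup>+x. f (x + c) \<partial>lborel)" by (simp add: nn_integral_lborel_translate)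
  also have "\<dots> = (\<integral>\<^sup>+x. f (x + c) \<partial>distr lborel borel uminus)" by (simp add: lborel_distr_uminus_euclidean)
  also have "\<dots> = (\<integral>\<^sup>+x. f (- x + c) \<partial>lborel)" by (rule nn_integral_distr) auto
  finally show ?thesis by (simp add: add.commute)
qed

text \<open>Integrate \<open>indicator A y * indicator B (x + y)\<close> in both orders, where \<open>B\<close> is the unit ball.\<close>

lemma translation_invariant_eq_lborel:
  fixes M :: "'a::euclidean_space measure"
  assumes sets[measurable_cong]: "sets M = sets borel" and "sigma_finite_measure M"
    and inv: "\<And>c f. f \<in> borel_measurable borel \<Longrightarrow> (\<integral>\<^sup>+x. f (x + c) \<partial>M) = (\<integral>\<^sup>+x. f x \<partial>M)"
    and ball: "emeasure M (cball 0 1) = emeasure lborel (cball (0::'a) 1)"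
  shows "M = lborel"
proof (rule measure_eqI)
  fix A assume "A \<in> sets M"
  then have [measurable]: "A \<in> sets borel" by (simp add: sets)
  interpret M: sigma_finite_measure M by fact
  interpret P: pair_sigma_finite M lborel ..
  let ?B = "cball (0::'a) 1"
  have [measurable]: "?B \<in> sets borel" by simp
  have "emeasure M A * emeasure lborel ?B = (\<integral>\<^sup>+y. indicator A y * emeasure lborel ?B \<partial>M)"
    using sets by (simp add: nn_integral_multc)
  also have "\<dots> = (\<integral>\<^sup>+y. indicator A y * (\<integral>\<^sup>+x. indicator ?B x \<partial>lborel) \<partial>M)"
    by simp
  also have "\<dots> = (\<integral>\<^sup>+y. indicator A y * (\<integral>\<^sup>+x. indicator ?B (x + y) \<partial>lborel) \<partial>M)"
    by (subst nn_integral_lborel_translate) auto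
  also have "\<dots> = (\<integral>\<^sup>+y. (\<integral>\<^sup>+x. indicator A y * indicator ?B (x + y) \<partial>lborel) \<partial>M)"
    by (simp add: nn_integral_cmult)
  also have "\<dots> = (\<integral>\<^sup>+x. (\<integral>\<^sup>+y. indicator A y * indicator ?B (x + y) \<partial>M) \<partial>lborel)"
    by (rule P.Fubini'[symmetric]) measurable
  \<comment> \<open>Invariance of M moves the translation from the ball to A; the next exchange then
    leaves the Lebesgue measure of a reflected translate of A.\<close>
  also have "\<dots> = (\<integral>\<^sup>+x. (\<integral>\<^sup>+y. indicator A (y - x) * indicator ?B y \<partial>M) \<partial>lborel)"
  proof (rule nn_integral_cong)
    fix x :: 'a
    show "(\<integral>\<^sup>+y. indicator A y * indicator ?B (x + y) \<partial>M) = (\<integral>\<^sup>+y. indicator A (y - x) * indicator ?B y \<partial>M)"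
      using inv[of "\<lambda>y. indicator A (y - x) * indicator ?B y" x] by (simp add: add.commute)
  qed
  also have "\<dots> = (\<integral>\<^sup>+y. (\<integral>\<^sup>+x. indicator A (y - x) * indicator ?B y \<partial>lborel) \<partial>M)"
    by (rule P.Fubini') measurable
  also have "\<dots> = (\<integral>\<^sup>+y. (\<integral>\<^sup>+x. indicator A (y - x) \<partial>lborel) * indicator ?B y \<partial>M)"
    by (simp add: nn_integral_multc)
  also have "\<dots> = emeasure lborel A * emeasure M ?B"
    using sets by (simp add: nn_integral_lborel_reflect nn_integral_cmult)
  finally have "emeasure M A * emeasure lborel ?B = emeasure lborel A * emeasure lborel ?B"
    unfolding ball .
  then have "emeasure lborel ?B * emeasure M A = emeasure lborel ?B * emeasure lborel A"
    by (simp only: mult.commute)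
  moreover have "emeasure lborel ?B \<noteq> 0"
  proof -
    have "emeasure lborel ?B = ennreal (unit_ball_vol (real DIM('a)))"
      using emeasure_cball[of 1 "0::'a"] by simp
    then show ?thesis using unit_ball_vol_pos[of "real DIM('a)"] by (simp del: unit_ball_vol_pos)
  qed
  moreover have "emeasure lborel ?B \<noteq> top"
    using emeasure_bounded_finite[of ?B] by auto
  ultimately show "emeasure M A = emeasure lborel A"
    by (simp add: ennreal_mult_cancel_left)
qed (simp add: sets)

lemma PiM_lborel_translate:
  fixes c :: "'i \<Rightarrow> real"
  assumes "finite I"
  shows "distr (\<Pi>\<^sub>M i\<in>I. lborel) (\<Pi>\<^sub>M i\<in>I. lborel) (\<lambda>f. \<lambda>i\<in>I. f i + c i) = (\<Pi>\<^sub>M i\<in>I. lborel)"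
proof -
  interpret product_sigma_finite "\<lambda>_::'i. lborel :: real measure" ..
  have m[measurable]: "(\<lambda>f. \<lambda>i\<in>I. f i + c i) \<in> (\<Pi>\<^sub>M i\<in>I. lborel) \<rightarrow>\<^sub>M (\<Pi>\<^sub>M i\<in>I. (lborel :: real measure))"
    by measurable
  show ?thesis
  proof (rule PiM_eqI[OF assms])
    fix A assume A: "\<And>i. i \<in> I \<Longrightarrow> A i \<in> sets (lborel :: real measure)"
    have PA: "Pi\<^sub>E I A \<in> sets (\<Pi>\<^sub>M i\<in>I. lborel)" using A assms by (intro sets_PiM_I_finite) auto
    have "(\<lambda>f. \<lambda>i\<in>I. f i + c i) -` Pi\<^sub>E I A \<inter> space (\<Pi>\<^sub>M i\<in>I. lborel) = Pi\<^sub>E I (\<lambda>i. (\<lambda>t. t + c i) -` A i)"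
      by (auto simp: space_PiM PiE_iff)
    moreover have "(\<lambda>t. t + c i) -` A i \<in> sets lborel" if "i \<in> I" for i
      using measurable_sets[of "\<lambda>t. t + c i" borel borel "A i"] A[OF that] by simp
    moreover have "emeasure lborel ((\<lambda>t. t + c i) -` A i) = emeasure lborel (A i)" if "i \<in> I" for i
    proof -
      have "emeasure lborel (A i) = emeasure (distr lborel borel ((+) (c i))) (A i)" by (simp add:
          lborel_distr_plus)
      also have "\<dots> = emeasure lborel ((+) (c i) -` A i)" using A[OF that] by (subst emeasure_distr) auto
      also have "(+) (c i) = (\<lambda>t. t + c i)" by (simp add: fun_eq_iff)
      finally show ?thesis by simp
    qed
    ultimately show "emeasure (distr (\<Pi>\<^sub>M i\<in>I. lborel) (\<Pi>\<^sub>M i\<in>I. lborel) (\<lambda>f. \<lambda>i\<in>I. f i + c i)) (Pi\<^sub>E I A)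
        = (\<Prod>i\<in>I. emeasure lborel (A i))"
      using PA assms by (subst emeasure_distr[OF m PA]) (simp add: emeasure_PiM)
  qed simp
qed

text \<open>The coordinate map of an orthonormal basis preserves the norm, so the image measure
  gives the unit ball its Lebesgue volume. Translations become translations of the coordinates, and
  the preceding characterisation applies.\<close>

lemma lborel_eq_distr_orthonormal_basis:
  fixes B :: "'a::euclidean_space set"
  assumes orth: "pairwise orthogonal B" and unit: "\<And>b. b \<in> B \<Longrightarrow> norm b = 1" and span: "span B = UNIV"
  shows "distr (\<Pi>\<^sub>M b\<in>B. lborel) borel (\<lambda>f. \<Sum>b\<in>B. f b *\<^sub>R b) = lborel"
proof (rule translation_invariant_eq_lborel)
  have "0 \<notin> B" using unit by force
  then have ind: "independent B" using pairwise_orthogonal_independent[OF orth] by simp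
  then have fin: "finite B" by (rule independent_imp_finite)
  have card: "card B = DIM('a)" using ind span by (metis dim_UNIV dim_span_eq_card_independent)
  interpret product_sigma_finite "\<lambda>_::'a. lborel :: real measure" ..
  let ?P = "\<Pi>\<^sub>M b\<in>B. (lborel :: real measure)" and ?T = "\<lambda>f. \<Sum>b\<in>B. f b *\<^sub>R b"
  have T[measurable]: "?T \<in> ?P \<rightarrow>\<^sub>M borel" by measurable
  have normT: "norm (?T f) = sqrt (\<Sum>b\<in>B. (f b)\<^sup>2)" for f
  proof -
    have "(norm (?T f))\<^sup>2 = (\<Sum>b\<in>B. (norm (f b *\<^sub>R b))\<^sup>2)"
      using orth by (intro norm_sum_Pythagorean[OF fin]) (auto simp: pairwise_def orthogonal_def)
    also have "\<dots> = (\<Sum>b\<in>B. (f b)\<^sup>2)" using unit by (intro sum.cong) auto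
    finally show ?thesis by (metis norm_ge_zero real_sqrt_unique)
  qed
  have ball: "emeasure (distr ?P borel ?T) (cball 0 r) = ennreal (unit_ball_vol (real (card B)) * r ^ card
      B)" if "0 < r" for r
  proof -
    have "emeasure (distr ?P borel ?T) (cball 0 r) = emeasure ?P (?T -` cball 0 r \<inter> space ?P)"
      by (rule emeasure_distr) auto
    also have "?T -` cball 0 r \<inter> space ?P = {f. sqrt (\<Sum>b\<in>B. (f b)\<^sup>2) \<le> r} \<inter> space ?P"
      by (auto simp: normT)
    finally show ?thesis using emeasure_cball_aux[OF fin that] by simp
  qed
  show "sigma_finite_measure (distr ?P borel ?T)"
  proof
    show "\<exists>A. countable A \<and> A \<subseteq> sets (distr ?P borel ?T) \<and> \<Union>A = space (distr ?P borel ?T) \<and> (\<forall>a\<in>A.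
        emeasure (distr ?P borel ?T) a \<noteq> \<infinity>)"
    \<comment> \<open>The radii start at 1 because \<open>ball\<close> is stated for positive
      radius.\<close>
    proof (intro exI[of _ "range (\<lambda>n. cball 0 (real (Suc n)))"] conjI ballI)
      show "\<Union>(range (\<lambda>n. cball 0 (real (Suc n)))) = space (distr ?P borel ?T)"
      proof -
        have "\<exists>n. norm x \<le> real (Suc n)" for x :: 'a
          using real_arch_simple[of "norm x"] by (meson le_SucI of_nat_le_iff order_refl order_trans)
        then show ?thesis by auto
      qed
    qed (auto simp: ball simp del: of_nat_Suc)
  qed
  show "emeasure (distr ?P borel ?T) (cball 0 1) = emeasure lborel (cball (0::'a) 1)"
    using ball[of 1] emeasure_cball[of 1 "0::'a"] by (simp add: card)
  fix c :: 'a and f :: "'a \<Rightarrow> ennreal" assume [measurable]: "f \<in> borel_measurable borel"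
  have c: "(\<Sum>b\<in>B. (c \<bullet> b) *\<^sub>R b) = c"
    using orthonormal_basis_expand[OF orth unit _ fin, of c] span by simp
  have shift: "?T (\<lambda>b\<in>B. g b + c \<bullet> b) = ?T g + c" for g
    using c by (simp add: scaleR_add_left sum.distrib)
  have "(\<integral>\<^sup>+x. f x \<partial>distr ?P borel ?T) = (\<integral>\<^sup>+g. f (?T g) \<partial>?P)"
    by (rule nn_integral_distr) auto
  also have "\<dots> = (\<integral>\<^sup>+g. f (?T g) \<partial>distr ?P ?P (\<lambda>g. \<lambda>b\<in>B. g b + c \<bullet> b))"
    by (simp add: PiM_lborel_translate[OF fin])
  also have "\<dots> = (\<integral>\<^sup>+g. f (?T (\<lambda>b\<in>B. g b + c \<bullet> b)) \<partial>?P)"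
    by (rule nn_integral_distr) measurable
  also have "\<dots> = (\<integral>\<^sup>+g. f (?T g + c) \<partial>?P)"
    by (simp only: shift)
  also have "\<dots> = (\<integral>\<^sup>+x. f (x + c) \<partial>distr ?P borel ?T)"
    by (rule nn_integral_distr[symmetric]) auto
  finally show "(\<integral>\<^sup>+x. f (x + c) \<partial>distr ?P borel ?T) = (\<integral>\<^sup>+x. f x \<partial>distr ?P borel ?T)" ..
qed simp

lemma hyperplane_basis:
  fixes \<theta> :: "'a::euclidean_space"
  shows "pairwise orthogonal (hyperplane_basis \<theta>)" "\<And>b. b \<in> hyperplane_basis \<theta> \<Longrightarrow> norm b = 1"
    "span (hyperplane_basis \<theta>) = hyperplane \<theta>"
proof -
  have "hyperplane \<theta> = {y. orthogonal \<theta> y}" by (auto simp: hyperplane_def orthogonal_def inner_commute)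
  then have "subspace (hyperplane \<theta>)" by (simp add: subspace_orthogonal_to_vector)
  then obtain B where "pairwise orthogonal B" "\<forall>b\<in>B. norm b = 1" "span B = hyperplane \<theta>"
    using orthonormal_basis_subspace[of "hyperplane \<theta>"] by metis
  then have "\<exists>B. pairwise orthogonal B \<and> (\<forall>b\<in>B. norm b = 1) \<and> span B = hyperplane \<theta>" by blast
  from someI_ex[OF this] show "pairwise orthogonal (hyperplane_basis \<theta>)" "\<And>b. b \<in> hyperplane_basis \<theta> \<Longrightarrow>
      norm b = 1"
    "span (hyperplane_basis \<theta>) = hyperplane \<theta>"
    by (auto simp: hyperplane_basis_def)
qed

text \<open>Adding \<theta> to the chosen orthonormal basis of the hyperplane gives an orthonormal
  basis of the space; splitting off the coordinate of \<theta> is Tonelli for the product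
  measure.\<close>

lemma nn_integral_lborel_hyperplane:
  fixes \<theta> :: "'a::euclidean_space"
  assumes \<theta>: "norm \<theta> = 1" and [measurable]: "f \<in> borel_measurable borel"
  shows "(\<integral>\<^sup>+x. f x \<partial>lborel) = (\<integral>\<^sup>+y. \<integral>\<^sup>+s. f (s *\<^sub>R \<theta> + y) \<partial>lborel \<partial>hyperplane_lborel \<theta>)"
proof -
  let ?B = "hyperplane_basis \<theta>"
  note B = hyperplane_basis[where \<theta> = \<theta>]
  have "0 \<notin> ?B" using B(2)[of 0] by auto
  then have fin: "finite ?B" using pairwise_orthogonal_independent[OF B(1)] independent_imp_finite by blast
  have Bperp: "b \<bullet> \<theta> = 0" if "b \<in> ?B" for b
    using span_base[OF that] B(3) by (simp add: hyperplane_def)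
  then have notin: "\<theta> \<notin> ?B" using \<theta> by (auto simp: norm_eq_1)
  have T: "(\<Sum>b\<in>?B. g b *\<^sub>R b) \<in> hyperplane \<theta>" for g :: "'a \<Rightarrow> real"
    using Bperp by (simp add: hyperplane_def inner_sum_left)
  have span: "span (insert \<theta> ?B) = UNIV"
  proof -
    have "x \<in> span (insert \<theta> ?B)" for x
    proof -
      have "x - (x \<bullet> \<theta>) *\<^sub>R \<theta> \<in> span ?B"
        unfolding B(3) using \<theta> by (simp add: hyperplane_def inner_diff_left norm_eq_1)
      then show ?thesis by (auto simp: span_insert)
    qed
    then show ?thesis by auto
  qed
  have orth: "pairwise orthogonal (insert \<theta> ?B)"
    using B(1) Bperp by (auto simp: pairwise_insert orthogonal_def inner_commute)
  interpret product_sigma_finite "\<lambda>_::'a. lborel :: real measure" ..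
  have "(\<integral>\<^sup>+x. f x \<partial>lborel) = (\<integral>\<^sup>+x. f x \<partial>distr (\<Pi>\<^sub>M b\<in>insert \<theta> ?B. lborel) borel (\<lambda>g. \<Sum>b\<in>insert \<theta> ?B. g b
      *\<^sub>R b))"
  proof -
    have "norm b = 1" if "b \<in> insert \<theta> ?B" for b using that B(2) \<theta> by auto
    from lborel_eq_distr_orthonormal_basis[OF orth this span] show ?thesis by simp
  qed
  also have "\<dots> = (\<integral>\<^sup>+g. f (\<Sum>b\<in>insert \<theta> ?B. g b *\<^sub>R b) \<partial>(\<Pi>\<^sub>M b\<in>insert \<theta> ?B. lborel))"
    by (rule nn_integral_distr) measurable
  also have "\<dots> = (\<integral>\<^sup>+g. \<integral>\<^sup>+s. f (\<Sum>b\<in>insert \<theta> ?B. (g(\<theta> := s)) b *\<^sub>R b) \<partial>lborel \<partial>(\<Pi>\<^sub>M b\<in>?B. lborel))"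
    by (rule product_nn_integral_insert[OF fin notin]) measurable
  also have "\<dots> = (\<integral>\<^sup>+g. \<integral>\<^sup>+s. f (s *\<^sub>R \<theta> + (\<Sum>b\<in>?B. g b *\<^sub>R b)) \<partial>lborel \<partial>(\<Pi>\<^sub>M b\<in>?B. lborel))"
  proof -
    have "(\<Sum>b\<in>insert \<theta> ?B. (g(\<theta> := s)) b *\<^sub>R b) = s *\<^sub>R \<theta> + (\<Sum>b\<in>?B. g b *\<^sub>R b)" for g :: "'a \<Rightarrow> real" and s
    proof -
      have "(\<Sum>b\<in>?B. (g(\<theta> := s)) b *\<^sub>R b) = (\<Sum>b\<in>?B. g b *\<^sub>R b)"
        using notin by (intro sum.cong) auto
      then show ?thesis using fin notin by simp
    qed
    then show ?thesis by simp
  qed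
  also have "\<dots> = (\<integral>\<^sup>+y. \<integral>\<^sup>+s. f (s *\<^sub>R \<theta> + y) \<partial>lborel \<partial>hyperplane_lborel \<theta>)"
  proof -
    have "(\<lambda>g. \<Sum>b\<in>?B. g b *\<^sub>R b) \<in> (\<Pi>\<^sub>M b\<in>?B. lborel) \<rightarrow>\<^sub>M restrict_space borel (hyperplane \<theta>)"
      by (rule measurable_restrict_space2) (auto simp: T)
    moreover have "(\<lambda>y. \<integral>\<^sup>+s. f (s *\<^sub>R \<theta> + y) \<partial>lborel) \<in> borel_measurable (restrict_space borel (hyperplane \<theta>))"
      by (rule measurable_restrict_space1) measurable
    ultimately show ?thesis
      unfolding hyperplane_lborel_def by (simp add: nn_integral_distr)
  qed
  finally show ?thesis .
qed

lemma closed_orthogonal_hyperplane: "closed (hyperplane \<theta>)"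
proof -
  have "hyperplane \<theta> = {y. \<theta> \<bullet> y = 0}" by (auto simp: hyperplane_def inner_commute)
  then show ?thesis by (simp add: closed_hyperplane)
qed

text \<open>The cylinder over a null set of the hyperplane is Lebesgue null. This carries the
  exceptional lines in the definition of a trace to exceptional points of \<Omega>.\<close>

lemma AE_hyperplane_projD:
  fixes \<theta> :: "'a::euclidean_space"
  assumes \<theta>: "norm \<theta> = 1" and ae: "AE y in hyperplane_lborel \<theta>. R y"
  shows "AE x in lborel. R (hyperplane_proj \<theta> x)"
proof -
  have sp: "space (hyperplane_lborel \<theta>) = hyperplane \<theta>" and
    se: "sets (hyperplane_lborel \<theta>) = sets (restrict_space borel (hyperplane \<theta>))"
    by (auto simp: hyperplane_lborel_def space_restrict_space)
  obtain N where N: "N \<in> null_sets (hyperplane_lborel \<theta>)" "{y \<in> hyperplane \<theta>. \<not> R y} \<subseteq> N"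
    using ae by (auto simp: eventually_ae_filter sp)
  have [measurable]: "N \<in> sets borel"
    using N(1) closed_orthogonal_hyperplane[of \<theta>] by (auto simp: null_sets_def se sets_restrict_space_iff)
  have Nsub: "N \<subseteq> hyperplane \<theta>" using N(1) sets.sets_into_space[of N "hyperplane_lborel \<theta>"] by (auto simp: sp)
  have proj: "hyperplane_proj \<theta> (s *\<^sub>R \<theta> + y) = y" if "y \<in> hyperplane \<theta>" for s y
    using that \<theta> by (simp add: hyperplane_proj_def hyperplane_def inner_add_left norm_eq_1)
  have [measurable]: "hyperplane_proj \<theta> \<in> borel_measurable borel"
    unfolding hyperplane_proj_def[abs_def] by measurable
  have "(\<integral>\<^sup>+x. indicator N (hyperplane_proj \<theta> x) \<partial>lborel) =
    (\<integral>\<^sup>+y. \<integral>\<^sup>+s. indicator N (hyperplane_proj \<theta> (s *\<^sub>R \<theta> + y)) \<partial>lborel \<partial>hyperplane_lborel \<theta>)"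
    by (rule nn_integral_lborel_hyperplane[OF \<theta>]) measurable
  \<comment> \<open>The integral over the line is infinite for y in N and 0 otherwise, so it
    vanishes for almost every y.\<close>
  also have "\<dots> = (\<integral>\<^sup>+y. \<integral>\<^sup>+(s::real). indicator N y \<partial>lborel \<partial>hyperplane_lborel \<theta>)"
    by (intro nn_integral_cong) (simp add: proj sp)
  also have "\<dots> = (\<integral>\<^sup>+y. 0 \<partial>hyperplane_lborel \<theta>)"
    by (rule nn_integral_cong_AE) (use AE_not_in[OF N(1)] in \<open>auto elim!: eventually_mono\<close>)
  finally have "(\<integral>\<^sup>+x. indicator N (hyperplane_proj \<theta> x) \<partial>lborel) = 0" by simp
  then have "AE x in lborel. hyperplane_proj \<theta> x \<notin> N"
    by (subst (asm) nn_integral_0_iff_AE) (auto simp: indicator_eq_0_iff elim!: eventually_mono)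
  moreover have "hyperplane_proj \<theta> x \<in> hyperplane \<theta>" for x
    using \<theta> by (simp add: hyperplane_proj_def hyperplane_def inner_diff_left norm_eq_1)
  ultimately show ?thesis using N(2) by (auto elim!: eventually_mono)
qed

text \<open>The converse passage: by the same disintegration almost every line meets a Lebesgue null
  set in a null set of parameters.\<close>

lemma AE_hyperplane_lines:
  fixes \<theta> :: "'a::euclidean_space"
  assumes \<theta>: "norm \<theta> = 1" and ae: "AE x in lborel. S x"
  shows "AE y in hyperplane_lborel \<theta>. AE s in lborel. S (s *\<^sub>R \<theta> + y)"
proof -
  obtain N where N: "N \<in> null_sets lborel" "{x. \<not> S x} \<subseteq> N"
    using ae by (auto simp: eventually_ae_filter)
  have [measurable]: "N \<in> sets borel" using N(1) by auto
  have "(\<integral>\<^sup>+y. \<integral>\<^sup>+s. indicator N (s *\<^sub>R \<theta> + y) \<partial>lborel \<partial>hyperplane_lborel \<theta>) = (\<integral>\<^sup>+x. indicator N x \<partial>lborel)"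
    by (rule nn_integral_lborel_hyperplane[OF \<theta>, symmetric]) measurable
  also have "\<dots> = 0" using N(1) by auto
  finally have z: "(\<integral>\<^sup>+y. \<integral>\<^sup>+s. indicator N (s *\<^sub>R \<theta> + y) \<partial>lborel \<partial>hyperplane_lborel \<theta>) = 0" .
  have m: "(\<lambda>y. \<integral>\<^sup>+s. indicator N (s *\<^sub>R \<theta> + y) \<partial>lborel) \<in> borel_measurable (hyperplane_lborel \<theta>)"
  proof -
    have "(\<lambda>y. \<integral>\<^sup>+s. indicator N (s *\<^sub>R \<theta> + y) \<partial>lborel) \<in> borel_measurable (restrict_space borel
        (hyperplane \<theta>))"
      by (rule measurable_restrict_space1) measurable
    then show ?thesis by (simp add: hyperplane_lborel_def)
  qed
  have "AE y in hyperplane_lborel \<theta>. (\<integral>\<^sup>+s. indicator N (s *\<^sub>R \<theta> + y) \<partial>lborel) = 0"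
    using z by (subst (asm) nn_integral_0_iff_AE[OF m])
  then show ?thesis
  proof eventually_elim
    case (elim y)
    then have "AE s in lborel. s *\<^sub>R \<theta> + y \<notin> N"
      by (subst (asm) nn_integral_0_iff_AE) (auto simp: indicator_eq_0_iff elim!: eventually_mono)
    then show ?case using N(2) by (auto elim!: eventually_mono)
  qed
qed

section \<open>Directional traces and line primitives\<close>

lemma AE_interval_ex:
  assumes "AE r in lborel. a < r \<and> r < b \<longrightarrow> P r" and "a < (b::real)"
  shows "\<exists>r. a < r \<and> r < b \<and> P r"
proof (rule ccontr)
  assume "\<not> ?thesis"
  then have "AE r in lborel. r \<notin> {a<..<b}" using assms(1) by (auto elim!: eventually_mono)
  then have "emeasure lborel {a<..<b} = 0"
    by (subst (asm) AE_iff_measurable[where N = "{a<..<b}"]) auto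
  then show False using assms(2) by simp
qed

text \<open>By continuity a gap at b would persist on an interval to the left of b, which has
  positive length. Through this lemma the boundary value is independent of the
  representative.\<close>

lemma AE_eq_imp_endpoint_eq:
  fixes f g :: "real \<Rightarrow> real"
  assumes f: "continuous_on {a..b} f" and g: "continuous_on {a..b} g" and "a < b"
    and ae: "AE r in lborel. a < r \<and> r < b \<longrightarrow> f r = g r"
  shows "f b = g b"
proof (rule ccontr)
  assume ne: "f b \<noteq> g b"
  have c: "continuous_on {a..b} (\<lambda>r. f r - g r)" by (intro continuous_intros f g)
  obtain d where d: "d > 0" "\<forall>r\<in>{a..b}. dist r b < d \<longrightarrow> dist (f r - g r) (f b - g b) < \<bar>f b - g b\<bar>"
    using c[unfolded continuous_on_iff, rule_format, of b "\<bar>f b - g b\<bar>"] ne \<open>a < b\<close> by auto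
  have "AE r in lborel. max a (b - d) < r \<and> r < b \<longrightarrow> f r = g r"
    using ae by eventually_elim auto
  from AE_interval_ex[OF this] obtain r where r: "max a (b - d) < r" "r < b" "f r = g r"
    using \<open>a < b\<close> d(1) by auto
  have "dist (f r - g r) (f b - g b) < \<bar>f b - g b\<bar>"
    by (rule d(2)[rule_format]) (use r d(1) \<open>a < b\<close> in \<open>auto simp: dist_real_def\<close>)
  then show False using r(3) by (simp add: dist_real_def)
qed

lemma AE_lborel_real_shift:
  assumes "AE r in lborel. P (r::real)"
  shows "AE r in lborel. P (r - c)"
  using AE_lborel_translate[OF assms, of "- c"] by simp

text \<open>Moving the base point along a line changes the primitive by a constant only. This lets
  primitives from different points of the same line be compared.\<close>

lemma prim_shift:
  assumes g: "integrable lborel g"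
  shows "prim (\<lambda>r. g (r + c)) r = prim g (r + c) - prim g c"
proof -
  have [measurable]: "g \<in> borel_measurable borel" using borel_measurable_integrable[OF g] by simp
  have tr: "(LINT \<rho>|lborel. indicator {a<..<b} \<rho> * g (\<rho> + c)) = (LINT \<rho>|lborel. indicator {a + c<..<b + c}
      \<rho> * g \<rho>)" for a b
    by (subst integral_lborel_translate[of "\<lambda>\<rho>. indicator {a + c<..<b + c} \<rho> * g \<rho>" c, symmetric])
      (auto intro!: Bochner_Integration.integral_cong simp: indicator_def)
  show ?thesis
  proof (cases "0 \<le> r")
    case True
    then show ?thesis using prim_add_interval[OF g, of c "r + c"] tr[of 0 r] by (simp add: prim_nonneg
        add.commute)
  next
    case False
    then show ?thesis using prim_add_interval[OF g, of "r + c" c] tr[of r 0] by (simp add: prim_nonpos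
        add.commute)
  qed
qed

text \<open>Writing \<phi> as a primitive of its own derivative lets \<open>prim_product\<close>
  serve as the integration by parts against test functions.\<close>

lemma test_function_prim:
  fixes \<phi> :: "real \<Rightarrow> real"
  assumes \<phi>: "\<phi> \<in> test_functions S"
  shows "integrable lborel (\<lambda>s. frechet_derivative \<phi> (at s) 1)"
    and "\<phi> s = \<phi> 0 + prim (\<lambda>s. frechet_derivative \<phi> (at s) 1) s"
proof -
  let ?D = "\<lambda>s. frechet_derivative \<phi> (at s) 1"
  note [measurable] = test_function_derivative_borel[OF \<phi>]
  obtain K where K: "compact K" "\<And>x. x \<notin> K \<Longrightarrow> ?D x = 0"
    using test_function_support[OF \<phi>] by blast
  obtain B where B: "B \<ge> 0" "\<And>x. \<bar>?D x\<bar> \<le> B" using test_function_bounded(2)[OF \<phi>, of 1] by blast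
  show "integrable lborel ?D"
  proof (rule Bochner_Integration.integrable_bound)
    show "integrable lborel (\<lambda>x. B * indicator K x)"
      using emeasure_bounded_finite[OF compact_imp_bounded[OF K(1)]] K(1)
      by (auto intro!: integrable_mult_right integrable_real_indicator simp: compact_imp_closed)
    have "\<bar>?D x\<bar> \<le> \<bar>B * indicator K x\<bar>" for x using B K(2)[of x] by (cases "x \<in> K") auto
    then show "AE x in lborel. norm (?D x) \<le> norm (B * indicator K x)" by simp
  qed simp
  have der: "(\<phi> has_real_derivative ?D s) (at s)" for s
  proof -
    have lin: "frechet_derivative \<phi> (at s) h = ?D s * h" for h
      using linear_cmul[OF has_derivative_linear[OF test_function_derivative[OF \<phi>]], of s h 1]
      by (simp add: mult.commute)
    show ?thesis
      unfolding has_field_derivative_def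
      by (rule has_derivative_eq_rhs[OF test_function_derivative[OF \<phi>]]) (rule ext, rule lin)
  qed
  have cont: "isCont ?D s" for s
    using test_function_continuous(2)[OF \<phi>, of 1] by (simp add: continuous_on_eq_continuous_at)
  have FTC: "(LINT s|lborel. indicator {a<..<b} s * ?D s) = \<phi> b - \<phi> a" if "a \<le> b" for a b
  proof -
    have "(LINT s|lborel. indicator {a<..<b} s * ?D s) = (LINT s|lborel. ?D s * indicator {a..b} s)"
    proof (rule integral_cong_AE)
      show "AE s in lborel. indicator {a<..<b} s * ?D s = ?D s * indicator {a..b} s"
        using AE_lborel_singleton[of a] AE_lborel_singleton[of b]
        by eventually_elim (auto simp: indicator_def)
    qed auto
    also have "\<dots> = \<phi> b - \<phi> a" by (rule integral_FTC_Icc_real[OF that der cont])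
    finally show ?thesis .
  qed
  show "\<phi> s = \<phi> 0 + prim ?D s"
    using FTC[of 0 s] FTC[of s 0] by (cases "0 \<le> s") (simp_all add: prim_nonneg prim_nonpos)
qed

text \<open>The weak derivative of the primitive is g: in the product rule with a test function the
  boundary terms vanish. At type \<open>real\<close> the only basis vector is 1, so this one
  direction gives \<open>H1\<close>.\<close>

lemma primitive_in_H1_interval:
  fixes f g :: "real \<Rightarrow> real"
  assumes g: "integrable lborel g" and g2: "integrable lborel (\<lambda>s. (g s)\<^sup>2)"
    and fm: "f \<in> borel_measurable borel" and f2: "integrable lborel (\<lambda>s. (f s)\<^sup>2)"
    and ae: "AE s in lborel. \<alpha> < s \<and> s < \<beta> \<longrightarrow> f s = c + prim g s" and "\<alpha> < \<beta>"
  shows "f \<in> H1 {\<alpha><..<\<beta>}"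
proof -
  let ?I = "{\<alpha><..<\<beta>}"
  note [measurable] = fm
  have [measurable]: "g \<in> borel_measurable borel" using borel_measurable_integrable[OF g] by simp
  have sq: "h \<in> sq_integrable (lebesgue_on ?I)" if [measurable]: "h \<in> borel_measurable borel" and h2:
      "integrable lborel (\<lambda>s. (h s)\<^sup>2)" for h :: "real \<Rightarrow> real"
  proof -
    have "integrable (lebesgue_on ?I) (\<lambda>s. (h s)\<^sup>2) \<longleftrightarrow> integrable lborel (\<lambda>s. indicator ?I s * (h s)\<^sup>2)"
      by (rule lebesgue_on_integral_borel(1)) (auto intro: borel_measurable_lebesgue_onI)
    then show ?thesis
      using integrable_interval[OF h2, of ?I] by (simp add: sq_integrable_def borel_measurable_lebesgue_onI)
  qed
  have "has_weak_dir_deriv ?I 1 f g"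
    unfolding has_weak_dir_deriv_def
  proof
    fix \<phi> assume \<phi>: "\<phi> \<in> test_functions ?I"
    let ?D = "\<lambda>s. frechet_derivative \<phi> (at s) 1"
    note [measurable] = test_function_borel[OF \<phi>] test_function_derivative_borel[OF \<phi>]
    obtain K where K: "K \<subseteq> ?I" "\<And>x. x \<notin> K \<Longrightarrow> \<phi> x = 0"
      using test_function_support[OF \<phi>] by blast
    \<comment> \<open>The support lies in the open interval, hence misses both endpoints.\<close>
    have ends: "\<phi> \<alpha> = 0" "\<phi> \<beta> = 0" using K(1) K(2)[of \<alpha>] K(2)[of \<beta>] by fastforce+
    define F where "F s = c + prim g s" for s
    have [measurable]: "F \<in> borel_measurable borel"
      unfolding F_def[abs_def] by (intro borel_measurable_continuous_onI continuous_intros prim_continuous g)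
    note pp = prim_product[OF g test_function_prim(1)[OF \<phi>] less_imp_le[OF \<open>\<alpha> < \<beta>\<close>] F_def
        test_function_prim(2)[OF \<phi>]]
    have i2: "integrable lborel (\<lambda>s. indicator ?I s * (g s * \<phi> s))"
    proof -
      obtain B where B: "B \<ge> 0" "\<And>x. \<bar>\<phi> x\<bar> \<le> B" using test_function_bounded(1)[OF \<phi>] by blast
      show ?thesis
      proof (rule Bochner_Integration.integrable_bound)
        show "integrable lborel (\<lambda>s. B * g s)" using g by simp
        have "\<bar>g s * \<phi> s\<bar> \<le> \<bar>B * g s\<bar>" for s
          using mult_left_mono[OF B(2), of "\<bar>g s\<bar>" s] B(1) by (simp add: abs_mult mult.commute)
        then show "AE s in lborel. norm (indicator ?I s * (g s * \<phi> s)) \<le> norm (B * g s)"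
          by (auto simp: indicator_def)
      qed simp
    qed
    have i1: "integrable lborel (\<lambda>s. indicator ?I s * (F s * ?D s))"
      using Bochner_Integration.integrable_diff[OF pp(2) i2] by (simp add: algebra_simps)
    have "(LINT s|lborel. indicator ?I s * (F s * ?D s)) + (LINT s|lborel. indicator ?I s * (g s * \<phi> s)) = 0"
      using pp(1) ends i1 i2 by (simp add: algebra_simps flip: Bochner_Integration.integral_add)
    moreover have "(LINT s|lebesgue_on ?I. f s * ?D s) = (LINT s|lborel. indicator ?I s * (F s * ?D s))"
      by (rule lebesgue_on_integral_borel(2))
        (use ae[folded F_def] in \<open>auto intro!: borel_measurable_lebesgue_onI elim!: eventually_mono\<close>)
    moreover have "(LINT s|lebesgue_on ?I. g s * \<phi> s) = (LINT s|lborel. indicator ?I s * (g s * \<phi> s))"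
      by (rule lebesgue_on_integral_borel(2)) (auto intro!: borel_measurable_lebesgue_onI)
    ultimately show "(LINT s|lebesgue_on ?I. f s * ?D s) = - (LINT s|lebesgue_on ?I. g s * \<phi> s)" by simp
  qed
  then show ?thesis
    using sq[OF _ f2] sq[OF _ g2] by (auto simp: H1_def W_dir_def)
qed

section \<open>Slices of the domain, their components and boundary values\<close>

context directed_domain
begin

lemma theta_inner [simp]: "\<theta> \<bullet> \<theta> = 1"
  using norm_direction by (simp add: norm_eq_1)

lemma proj_in_hyperplane: "hyperplane_proj \<theta> x \<in> hyperplane \<theta>"
  by (simp add: hyperplane_proj_def hyperplane_def inner_diff_left)

lemma proj_add: "y \<in> hyperplane \<theta> \<Longrightarrow> hyperplane_proj \<theta> (s *\<^sub>R \<theta> + y) = y"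
  "y \<in> hyperplane \<theta> \<Longrightarrow> (s *\<^sub>R \<theta> + y) \<bullet> \<theta> = s"
  by (simp_all add: hyperplane_proj_def hyperplane_def inner_add_left)

lemma proj_line: "s *\<^sub>R \<theta> + hyperplane_proj \<theta> x = x + (s - x \<bullet> \<theta>) *\<^sub>R \<theta>"
  by (simp add: hyperplane_proj_def algebra_simps)

text \<open>In the parameter s = x \<bullet> \<theta> + r the maximal segment through x is an
  interval whose two endpoints are not in the slice. A connected set of reals containing it and
  reaching further would contain an endpoint.\<close>

lemma segment_component:
  assumes x: "x \<in> \<Omega>"
  shows "{x \<bullet> \<theta> - db x<..<x \<bullet> \<theta> + dd x} \<in> components (line_slice \<Omega> \<theta> (hyperplane_proj \<theta> x))"
    (is "?C \<in> components ?S")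
proof -
  have mem: "s \<in> ?S \<longleftrightarrow> x + (s - x \<bullet> \<theta>) *\<^sub>R \<theta> \<in> \<Omega>" for s
    by (simp add: line_slice_def proj_line)
  have pos: "0 < dd x" "0 < db x" using dd_facts(1)[OF x] db_facts(1)[OF x] .
  have sub: "?C \<subseteq> ?S" unfolding subset_iff mem using segment(1)[OF x] by auto
  have up: "x \<bullet> \<theta> + dd x \<notin> ?S" using dd_facts(4)[OF x] by (simp add: mem exit_eq)
  have lo: "x \<bullet> \<theta> - db x \<notin> ?S" using db_facts(4)[OF x] by (simp add: mem entry_eq)
  show ?thesis
    unfolding in_components_maximal
  proof (intro conjI allI impI)
    show "?C \<noteq> {}" using pos by auto
    show "connected ?C" by simp
    fix D assume D: "D \<noteq> {} \<and> ?C \<subseteq> D \<and> D \<subseteq> ?S \<and> connected D"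
    have "x \<bullet> \<theta> \<in> ?C" using pos by simp
    then have x0: "x \<bullet> \<theta> \<in> D" using D by blast
    have "d < x \<bullet> \<theta> + dd x" if "d \<in> D" for d
    proof (rule ccontr)
      assume "\<not> d < x \<bullet> \<theta> + dd x"
      then have "x \<bullet> \<theta> + dd x \<in> {x \<bullet> \<theta>..d}" using pos by simp
      moreover have "{x \<bullet> \<theta>..d} \<subseteq> D" using D x0 that by (intro connected_contains_Icc) blast+
      ultimately show False using up D by blast
    qed
    moreover have "x \<bullet> \<theta> - db x < d" if "d \<in> D" for d
    proof (rule ccontr)
      assume "\<not> x \<bullet> \<theta> - db x < d"
      then have "x \<bullet> \<theta> - db x \<in> {d..x \<bullet> \<theta>}" using pos by simp
      moreover have "{d..x \<bullet> \<theta>} \<subseteq> D" using D x0 that by (intro connected_contains_Icc) blast+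
      ultimately show False using lo D by blast
    qed
    ultimately have "D \<subseteq> ?C" by auto
    then show "D = ?C" using D by blast
  qed (rule sub)
qed

lemma component_segment:
  assumes y: "y \<in> hyperplane \<theta>" and C: "{\<alpha><..<\<beta>} \<in> components (line_slice \<Omega> \<theta> y)" and s: "\<alpha> < s" "s < \<beta>"
  defines "x \<equiv> s *\<^sub>R \<theta> + y"
  shows "x \<in> \<Omega>" "\<alpha> = s - db x" "\<beta> = s + dd x"
proof -
  have "s \<in> line_slice \<Omega> \<theta> y" using in_components_subset[OF C] s by auto
  then show x: "x \<in> \<Omega>" by (simp add: line_slice_def x_def)
  have C': "{s - db x<..<s + dd x} \<in> components (line_slice \<Omega> \<theta> y)"
    using segment_component[OF x] by (simp add: x_def proj_add[OF y])
  have pos: "0 < dd x" "0 < db x" using dd_facts(1)[OF x] db_facts(1)[OF x] .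
  have "s \<in> {\<alpha><..<\<beta>} \<inter> {s - db x<..<s + dd x}" using s pos by auto
  then have "{\<alpha><..<\<beta>} = {s - db x<..<s + dd x}"
    using components_nonoverlap[OF C C'] by blast
  \<comment> \<open>Passing to closures turns equality of nonempty open intervals into equality of
    closed ones, where the endpoints can be read off.\<close>
  then have "closure {\<alpha><..<\<beta>} = closure {s - db x<..<s + dd x}" by simp
  then have "{\<alpha>..\<beta>} = {s - db x..s + dd x}" using s pos by simp
  then show "\<alpha> = s - db x" "\<beta> = s + dd x" using s by (auto simp: Icc_eq_Icc)
qed

definition trace_fun :: "('a \<Rightarrow> real) \<Rightarrow> ('a \<Rightarrow> real) \<Rightarrow> 'a \<Rightarrow> real" where
  "trace_fun u w x = u x + prim (line w x) (dd0 x)"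

lemma borel_trace_fun [measurable]:
  "u \<in> borel_measurable borel \<Longrightarrow> w \<in> borel_measurable borel \<Longrightarrow> trace_fun u w \<in> borel_measurable borel"
  unfolding trace_fun_def[abs_def] by (intro borel_measurable_add borel_prim_line) auto

text \<open>On the component through x the continuous h of the definition, the representative v and
  the primitive based at x agree almost everywhere; h and the primitive, both continuous up to the
  right endpoint, then agree there.\<close>

lemma dir_trace_eq_trace_fun:
  assumes wd: "wd u w" and u': "AE x\<in>\<Omega> in lborel. u' x = u x" and k: "k \<in> dir_traces \<Omega> \<theta> u'"
  shows "AE x\<in>\<Omega> in lborel. k (exit x) = trace_fun u w x"
proof -
  obtain v A where v: "AE x in lebesgue_on \<Omega>. v x = u' x"
    and A: "AE y in hyperplane_lborel \<theta>. y \<in> hyperplane_proj \<theta> ` \<Omega> \<longrightarrow> y \<in> A"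
    and tr: "\<And>y \<alpha> \<beta>. y \<in> A \<Longrightarrow> {\<alpha><..<\<beta>} \<in> components (line_slice \<Omega> \<theta> y) \<Longrightarrow>
      \<exists>h. continuous_on {\<alpha>..\<beta>} h \<and> (AE s in lebesgue_on {\<alpha><..<\<beta>}. h s = v (s *\<^sub>R \<theta> + y)) \<and> k (\<beta> *\<^sub>R \<theta> + y)
          = h \<beta>"
    using k unfolding dir_traces_def by blast
  have v': "AE x\<in>\<Omega> in lborel. v x = u x"
    using v u' unfolding AE_lebesgue_on_iff[OF borel_domain] by eventually_elim auto
  show ?thesis
    using AE_hyperplane_projD[OF norm_direction A] AE_lborel_lines[OF v', of \<theta>] AE_good[OF wd]
  proof (eventually_elim, intro impI)
    fix x
    assume "hyperplane_proj \<theta> x \<in> hyperplane_proj \<theta> ` \<Omega> \<longrightarrow> hyperplane_proj \<theta> x \<in> A"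
      and vu: "AE r in lborel. x + r *\<^sub>R \<theta> \<in> \<Omega> \<longrightarrow> v (x + r *\<^sub>R \<theta>) = u (x + r *\<^sub>R \<theta>)"
      and "x \<in> \<Omega> \<longrightarrow> good u w x" and x: "x \<in> \<Omega>"
    then have y: "hyperplane_proj \<theta> x \<in> A" and good: "good u w x" by auto
    let ?y = "hyperplane_proj \<theta> x" and ?s = "x \<bullet> \<theta>"
    let ?a = "?s - db x" and ?b = "?s + dd x"
    obtain h where h: "continuous_on {?a..?b} h" "AE s in lebesgue_on {?a<..<?b}. h s = v (s *\<^sub>R \<theta> + ?y)"
        "k (?b *\<^sub>R \<theta> + ?y) = h ?b"
      using tr[OF y segment_component[OF x]] by blast
    have wi: "integrable lborel (line w x)" using good by (simp add: good_def)
    have "h ?b = u x + prim (line w x) (?b - ?s)"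
    proof (rule AE_eq_imp_endpoint_eq[OF h(1), where g = "\<lambda>s. u x + prim (line w x) (s - ?s)"])
      show "continuous_on {?a..?b} (\<lambda>s. u x + prim (line w x) (s - ?s))"
        by (intro continuous_intros continuous_on_compose2[OF prim_continuous[OF wi, of UNIV]]) auto
      show "?a < ?b" using dd_facts(1)[OF x] db_facts(1)[OF x] by simp
      have g: "AE r in lborel. - db x < r \<and> r < dd x \<longrightarrow> line u x r = u x + prim (line w x) r"
        using good by (simp add: good_def)
      have hs: "AE s in lborel. ?a < s \<and> s < ?b \<longrightarrow> h s = v (s *\<^sub>R \<theta> + ?y)"
        using h(2) by (subst (asm) AE_lebesgue_on_iff) auto
      show "AE s in lborel. ?a < s \<and> s < ?b \<longrightarrow> h s = u x + prim (line w x) (s - ?s)"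
        using hs AE_lborel_real_shift[OF g, of ?s] AE_lborel_real_shift[OF vu, of ?s]
      proof (eventually_elim, intro impI)
        fix s assume *: "?a < s \<and> s < ?b \<longrightarrow> h s = v (s *\<^sub>R \<theta> + ?y)"
          "- db x < s - ?s \<and> s - ?s < dd x \<longrightarrow> line u x (s - ?s) = u x + prim (line w x) (s - ?s)"
          "x + (s - ?s) *\<^sub>R \<theta> \<in> \<Omega> \<longrightarrow> v (x + (s - ?s) *\<^sub>R \<theta>) = u (x + (s - ?s) *\<^sub>R \<theta>)"
          and s: "?a < s \<and> s < ?b"
        have "x + (s - ?s) *\<^sub>R \<theta> \<in> \<Omega>" using segment(1)[OF x, of "s - ?s"] s by simp
        then show "h s = u x + prim (line w x) (s - ?s)" using * s by (simp add: proj_line line_def)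
      qed
    qed
    moreover have "?b *\<^sub>R \<theta> + ?y = exit x" by (simp add: proj_line exit_eq)
    ultimately show "k (exit x) = trace_fun u w x" using h(3) x by (simp add: trace_fun_def dd0_eq)
  qed
qed

text \<open>The Borel function u itself serves as representative, and A collects the lines on which
  it has the required regularity. Almost every line consists, up to null parameters, of good base
  points, and there the primitive is the continuous representative.\<close>

lemma dir_traces_nonempty:
  assumes wd: "wd u w" and u': "AE x\<in>\<Omega> in lborel. u' x = u x"
  shows "dir_traces \<Omega> \<theta> u' \<noteq> {}"
proof -
  note [measurable] = wdD(1,2)[OF wd]
  let ?rep = "\<lambda>y \<alpha> \<beta> h. continuous_on {\<alpha>..\<beta>} h \<and> (AE s in lebesgue_on {\<alpha><..<\<beta>}. h s = u (s *\<^sub>R \<theta> + y))"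
  define A where "A = {y \<in> hyperplane_proj \<theta> ` \<Omega>. \<forall>\<alpha> \<beta>. {\<alpha><..<\<beta>} \<in> components (line_slice \<Omega> \<theta> y) \<longrightarrow>
    (\<lambda>s. u (s *\<^sub>R \<theta> + y)) \<in> H1 {\<alpha><..<\<beta>} \<and> (\<exists>h. ?rep y \<alpha> \<beta> h)}"
  \<comment> \<open>A trace must depend on the boundary point alone. From z one recovers the line by
    projection and the right endpoint as \<open>z \<bullet> \<theta>\<close>; the left endpoint and
    h are chosen.\<close>
  define k where "k z = (SOME c. \<exists>\<alpha> h. {\<alpha><..<z \<bullet> \<theta>} \<in> components (line_slice \<Omega> \<theta> (hyperplane_proj \<theta> z)) \<and>
    ?rep (hyperplane_proj \<theta> z) \<alpha> (z \<bullet> \<theta>) h \<and> c = h (z \<bullet> \<theta>))" for z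
  have "k \<in> dir_traces \<Omega> \<theta> u'"
    unfolding dir_traces_def
  proof (intro CollectI exI[of _ u] exI[of _ A] conjI ballI allI impI)
    show "AE x in lebesgue_on \<Omega>. u x = u' x"
      using u' by (subst AE_lebesgue_on_iff) (auto elim!: eventually_mono)
    show "A \<subseteq> hyperplane_proj \<theta> ` \<Omega>" by (auto simp: A_def)
    show "AE y in hyperplane_lborel \<theta>. y \<in> hyperplane_proj \<theta> ` \<Omega> \<longrightarrow> y \<in> A"
      using AE_hyperplane_lines[OF norm_direction AE_good[OF wd]]
    proof (eventually_elim, intro impI)
      fix y assume ae: "AE s in lborel. s *\<^sub>R \<theta> + y \<in> \<Omega> \<longrightarrow> good u w (s *\<^sub>R \<theta> + y)" and yp: "y \<in>
          hyperplane_proj \<theta> ` \<Omega>"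
      then have y: "y \<in> hyperplane \<theta>" using proj_in_hyperplane by auto
      show "y \<in> A"
        unfolding A_def
      proof (intro CollectI conjI allI impI yp)
        fix \<alpha> \<beta> assume C: "{\<alpha><..<\<beta>} \<in> components (line_slice \<Omega> \<theta> y)"
        have "{\<alpha><..<\<beta>} \<noteq> {}" using C by (rule in_components_nonempty)
        then have "\<alpha> < \<beta>" by simp
        \<comment> \<open>One good base point per component is enough, and it exists because the
          component has positive length.\<close>
        have "AE s in lborel. \<alpha> < s \<and> s < \<beta> \<longrightarrow> good u w (s *\<^sub>R \<theta> + y)"
          using ae by eventually_elim (use component_segment(1)[OF y C] in blast)
        from AE_interval_ex[OF this \<open>\<alpha> < \<beta>\<close>]
        obtain s where s: "\<alpha> < s" "s < \<beta>" "good u w (s *\<^sub>R \<theta> + y)" by blast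
        let ?x = "s *\<^sub>R \<theta> + y"
        note cs = component_segment[OF y C s(1,2)]
        have line_eq: "line f ?x (r - s) = f (r *\<^sub>R \<theta> + y)" for f r
          by (simp add: line_def algebra_simps)
        have int: "integrable lborel (line w ?x)" "integrable lborel (\<lambda>r. (line u ?x r)\<^sup>2)" "integrable
            lborel (\<lambda>r. (line w ?x r)\<^sup>2)"
          using s(3) by (auto simp: good_def)
        let ?wy = "\<lambda>r. w (r *\<^sub>R \<theta> + y)" and ?uy = "\<lambda>r. u (r *\<^sub>R \<theta> + y)"
        have inty: "integrable lborel ?wy" "integrable lborel (\<lambda>r. (?uy r)\<^sup>2)" "integrable lborel (\<lambda>r.
            (?wy r)\<^sup>2)"
          using integrable_lborel_translate[OF int(1), of "- s"] integrable_lborel_translate[OF int(2), of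
              "- s"]
            integrable_lborel_translate[OF int(3), of "- s"] by (simp_all add: line_eq)
        define c where "c = u ?x - prim ?wy s"
        have pr: "u ?x + prim (line w ?x) (r - s) = c + prim ?wy r" for r
          using prim_shift[OF inty(1), of s "r - s"] by (simp add: c_def line_def[abs_def] algebra_simps)
        have g: "AE r in lborel. - db ?x < r \<and> r < dd ?x \<longrightarrow> line u ?x r = u ?x + prim (line w ?x) r"
          using s(3) by (simp add: good_def)
        have eq: "AE r in lborel. \<alpha> < r \<and> r < \<beta> \<longrightarrow> ?uy r = c + prim ?wy r"
          using AE_lborel_real_shift[OF g, of s]
          by eventually_elim (use cs(2,3) in \<open>auto simp: line_eq pr\<close>)
        show "?uy \<in> H1 {\<alpha><..<\<beta>}"
          by (rule primitive_in_H1_interval[OF inty(1,3) _ inty(2) eq \<open>\<alpha> < \<beta>\<close>]) measurable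
        show "\<exists>h. ?rep y \<alpha> \<beta> h"
        proof (intro exI[of _ "\<lambda>r. c + prim ?wy r"] conjI)
          show "continuous_on {\<alpha>..\<beta>} (\<lambda>r. c + prim ?wy r)"
            by (intro continuous_intros prim_continuous inty(1))
          show "AE r in lebesgue_on {\<alpha><..<\<beta>}. c + prim ?wy r = ?uy r"
            using eq by (subst AE_lebesgue_on_iff) (auto elim!: eventually_mono)
        qed
      qed
    qed
    fix y \<alpha> \<beta> assume y: "y \<in> A" and C: "{\<alpha><..<\<beta>} \<in> components (line_slice \<Omega> \<theta> y)"
    then show "(\<lambda>s. u (s *\<^sub>R \<theta> + y)) \<in> H1 {\<alpha><..<\<beta>}" by (auto simp: A_def)
    have yh: "y \<in> hyperplane \<theta>" using y proj_in_hyperplane by (auto simp: A_def)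
    obtain h where h: "?rep y \<alpha> \<beta> h" using y C by (auto simp: A_def)
    let ?P = "\<lambda>c. \<exists>\<alpha> h. {\<alpha><..<\<beta>} \<in> components (line_slice \<Omega> \<theta> y) \<and> ?rep y \<alpha> \<beta> h \<and> c = h \<beta>"
    have k_eq: "k (\<beta> *\<^sub>R \<theta> + y) = (SOME c. ?P c)"
      unfolding k_def proj_add[OF yh] ..
    have ex: "\<exists>c. ?P c" using C h by blast
    have "?P (k (\<beta> *\<^sub>R \<theta> + y))" unfolding k_eq by (rule someI_ex[OF ex])
    then obtain \<alpha>' h' where h': "{\<alpha>'<..<\<beta>} \<in> components (line_slice \<Omega> \<theta> y)" "?rep y \<alpha>' \<beta> h'" "k (\<beta> *\<^sub>R \<theta> +
        y) = h' \<beta>"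
      by blast
    have "\<alpha> < \<beta>" "\<alpha>' < \<beta>" using in_components_nonempty[OF C] in_components_nonempty[OF h'(1)] by auto
    then obtain s where s: "\<alpha> < s" "\<alpha>' < s" "s < \<beta>" using dense[of "max \<alpha> \<alpha>'" \<beta>] by auto
    \<comment> \<open>The choice inside \<open>k\<close> could name another left endpoint; a
      parameter s common to both components shows that they coincide.\<close>
    have "\<alpha>' = \<alpha>" using component_segment(2)[OF yh C s(1,3)] component_segment(2)[OF yh h'(1) s(2,3)] by simp
    then show "\<exists>h. continuous_on {\<alpha>..\<beta>} h \<and> (AE s in lebesgue_on {\<alpha><..<\<beta>}. h s = u (s *\<^sub>R \<theta> + y)) \<and> k (\<beta>
        *\<^sub>R \<theta> + y) = h \<beta>"
      using h' by blast
  qed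
  then show ?thesis by blast
qed

end

section \<open>Sobolev functions\<close>

text \<open>A fixed choice of Borel representative, so that \<open>dtr\<close> can later be written
  as a function of u alone.\<close>

definition brep :: "'a::euclidean_space set \<Rightarrow> ('a \<Rightarrow> real) \<Rightarrow> 'a \<Rightarrow> real" where
  "brep S f = (SOME g. g \<in> borel_measurable borel \<and> (AE x\<in>S in lborel. f x = g x) \<and> (\<forall>x. x \<notin> S \<longrightarrow> g x = 0))"

lemma brep:
  assumes "S \<in> sets borel" "f \<in> borel_measurable (lebesgue_on S)"
  shows "brep S f \<in> borel_measurable borel" "AE x\<in>S in lborel. f x = brep S f x"
    "\<And>x. x \<notin> S \<Longrightarrow> brep S f x = 0"
proof -
  have "\<exists>g. g \<in> borel_measurable borel \<and> (AE x\<in>S in lborel. f x = g x) \<and> (\<forall>x. x \<notin> S \<longrightarrow> g x = 0)"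
    using lebesgue_on_borel_representative[OF assms] by metis
  from someI_ex[OF this] show "brep S f \<in> borel_measurable borel" "AE x\<in>S in lborel. f x = brep S f x"
    "\<And>x. x \<notin> S \<Longrightarrow> brep S f x = 0"
    unfolding brep_def by blast+
qed

section \<open>Closure properties of square-integrable functions\<close>

lemma sq_integrableD:
  "f \<in> sq_integrable M \<Longrightarrow> f \<in> borel_measurable M" "f \<in> sq_integrable M \<Longrightarrow> integrable M (\<lambda>x. (f x)\<^sup>2)"
  by (auto simp: sq_integrable_def)

lemma sq_integrable_mult:
  assumes "f \<in> sq_integrable M" "g \<in> sq_integrable M"
  shows "integrable M (\<lambda>x. f x * g x)"
proof (rule Bochner_Integration.integrable_bound)
  note [measurable] = sq_integrableD(1)[OF assms(1)] sq_integrableD(1)[OF assms(2)]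
  show "integrable M (\<lambda>x. (f x)\<^sup>2 + (g x)\<^sup>2)"
    using sq_integrableD(2)[OF assms(1)] sq_integrableD(2)[OF assms(2)] by simp
  show "(\<lambda>x. f x * g x) \<in> borel_measurable M" by measurable
  have "\<bar>f x * g x\<bar> \<le> \<bar>(f x)\<^sup>2 + (g x)\<^sup>2\<bar>" for x
  proof -
    have "0 \<le> (\<bar>f x\<bar> - \<bar>g x\<bar>)\<^sup>2" by simp
    then have "2 * (\<bar>f x\<bar> * \<bar>g x\<bar>) \<le> (f x)\<^sup>2 + (g x)\<^sup>2" by (simp add: power2_diff)
    moreover have "0 \<le> \<bar>f x\<bar> * \<bar>g x\<bar>" by simp
    ultimately have "\<bar>f x\<bar> * \<bar>g x\<bar> \<le> (f x)\<^sup>2 + (g x)\<^sup>2" by linarith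
    then show ?thesis by (simp add: abs_mult)
  qed
  then show "AE x in M. norm (f x * g x) \<le> norm ((f x)\<^sup>2 + (g x)\<^sup>2)" by simp
qed

lemma sq_integrable_add:
  assumes "f \<in> sq_integrable M" "g \<in> sq_integrable M"
  shows "(\<lambda>x. f x + g x) \<in> sq_integrable M"
  using assms sq_integrable_mult[OF assms]
  by (auto simp: sq_integrable_def power2_sum mult.assoc)

lemma sq_integrable_cmult:
  assumes "f \<in> sq_integrable M"
  shows "(\<lambda>x. c * f x) \<in> sq_integrable M"
  using assms by (auto simp: sq_integrable_def power_mult_distrib)

lemma sq_integrable_diff:
  assumes "f \<in> sq_integrable M" "g \<in> sq_integrable M"
  shows "(\<lambda>x. f x - g x) \<in> sq_integrable M"
  using sq_integrable_add[OF assms(1) sq_integrable_cmult[OF assms(2), of "-1"]] by simp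

lemma sq_integrable_sum:
  "(\<And>i. i \<in> I \<Longrightarrow> f i \<in> sq_integrable M) \<Longrightarrow> (\<lambda>x. \<Sum>i\<in>I. f i x) \<in> sq_integrable M"
proof (induction I rule: infinite_finite_induct)
  case (insert i I)
  then show ?case using sq_integrable_add[of "f i" M "\<lambda>x. \<Sum>i\<in>I. f i x"] by simp
qed (auto simp: sq_integrable_def)

lemma weak_dir_deriv:
  assumes "u \<in> W_dir \<Omega> \<theta>"
  shows "weak_dir_deriv \<Omega> \<theta> u \<in> sq_integrable (lebesgue_on \<Omega>)"
    "has_weak_dir_deriv \<Omega> \<theta> u (weak_dir_deriv \<Omega> \<theta> u)" "u \<in> sq_integrable (lebesgue_on \<Omega>)"
proof -
  have "\<exists>w. w \<in> sq_integrable (lebesgue_on \<Omega>) \<and> has_weak_dir_deriv \<Omega> \<theta> u w"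
    using assms by (auto simp: W_dir_def)
  from someI_ex[OF this] show "weak_dir_deriv \<Omega> \<theta> u \<in> sq_integrable (lebesgue_on \<Omega>)"
    "has_weak_dir_deriv \<Omega> \<theta> u (weak_dir_deriv \<Omega> \<theta> u)"
    unfolding weak_dir_deriv_def by blast+
  show "u \<in> sq_integrable (lebesgue_on \<Omega>)" using assms by (auto simp: W_dir_def)
qed

section \<open>Weak derivatives on a bounded open set\<close>

locale bounded_open_domain =
  fixes \<Omega> :: "'a::euclidean_space set"
  assumes open_dom: "open \<Omega>" and bounded_dom: "bounded \<Omega>"
begin

lemma borel_dom: "\<Omega> \<in> sets borel"
  using open_dom by simp

lemma directed: "\<theta> \<in> sphere 0 1 \<Longrightarrow> directed_domain \<Omega> \<theta>"
  using open_dom bounded_dom by unfold_locales auto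

lemma test_function_sq_integrable:
  assumes \<phi>: "\<phi> \<in> test_functions \<Omega>"
  shows "\<phi> \<in> sq_integrable (lebesgue_on \<Omega>)" "(\<lambda>x. frechet_derivative \<phi> (at x) \<theta>) \<in> sq_integrable
      (lebesgue_on \<Omega>)"
proof -
  have fin: "finite_measure (lebesgue_on \<Omega>)"
    using open_dom bounded_dom by (intro finite_measure_lebesgue_on) (simp add: lmeasurable_open)
  have *: "f \<in> sq_integrable (lebesgue_on \<Omega>)" if ex: "\<exists>B\<ge>0. \<forall>x. \<bar>f x\<bar> \<le> B" and f: "f \<in> borel_measurable
      borel" for f
  proof -
    from ex obtain B where B: "0 \<le> B \<and> (\<forall>x. \<bar>f x\<bar> \<le> B)" ..
    have [measurable]: "f \<in> borel_measurable (lebesgue_on \<Omega>)" by (rule borel_measurable_lebesgue_onI[OF f])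
    have "(f x)\<^sup>2 \<le> B\<^sup>2" for x using power_mono[OF _ abs_ge_zero, of "f x" B 2] B by simp
    then have "integrable (lebesgue_on \<Omega>) (\<lambda>x. (f x)\<^sup>2)"
      by (intro finite_measure.integrable_const_bound[OF fin, where B = "B\<^sup>2"]) auto
    then show ?thesis by (simp add: sq_integrable_def)
  qed
  show "\<phi> \<in> sq_integrable (lebesgue_on \<Omega>)"
    by (rule *[OF test_function_bounded(1)[OF \<phi>] test_function_borel[OF \<phi>]])
  show "(\<lambda>x. frechet_derivative \<phi> (at x) \<theta>) \<in> sq_integrable (lebesgue_on \<Omega>)"
    by (rule *[OF test_function_bounded(2)[OF \<phi>] test_function_derivative_borel[OF \<phi>]])
qed

lemma brep_sq_integrable:
  assumes "f \<in> sq_integrable (lebesgue_on \<Omega>)"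
  shows "integrable lborel (\<lambda>x. (brep \<Omega> f x)\<^sup>2)"
    "(LINT x|lborel. (brep \<Omega> f x)\<^sup>2) = (LINT x|lebesgue_on \<Omega>. (f x)\<^sup>2)"
proof -
  note f = sq_integrableD[OF assms]
  note b = brep[OF borel_dom f(1)]
  note [measurable] = f(1) b(1)
  have ae: "AE x\<in>\<Omega> in lborel. (f x)\<^sup>2 = (brep \<Omega> f x)\<^sup>2" using b(2) by eventually_elim auto
  show "integrable lborel (\<lambda>x. (brep \<Omega> f x)\<^sup>2)"
    by (subst lebesgue_on_integral_borel(1)[OF borel_dom _ _ ae, symmetric]) (use b(3) f(2) in auto)
  show "(LINT x|lborel. (brep \<Omega> f x)\<^sup>2) = (LINT x|lebesgue_on \<Omega>. (f x)\<^sup>2)"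
    by (subst lebesgue_on_integral_borel(2)[OF borel_dom _ _ ae, symmetric]) (use b(3) in auto)
qed

lemma integral_brep_mult:
  assumes f: "f \<in> borel_measurable (lebesgue_on \<Omega>)" and [measurable]: "g \<in> borel_measurable borel"
  shows "(LINT x|lebesgue_on \<Omega>. f x * g x) = (LINT x|lborel. brep \<Omega> f x * g x)"
proof (rule lebesgue_on_integral_borel(2)[OF borel_dom])
  note b = brep[OF borel_dom f]
  note [measurable] = f b(1)
  show "(\<lambda>x. brep \<Omega> f x * g x) \<in> borel_measurable borel" by measurable
  have "g \<in> borel_measurable (lebesgue_on \<Omega>)" by (rule borel_measurable_lebesgue_onI) measurable
  then show "(\<lambda>x. f x * g x) \<in> borel_measurable (lebesgue_on \<Omega>)" by measurable
  show "AE x\<in>\<Omega> in lborel. f x * g x = brep \<Omega> f x * g x" using b(2) by eventually_elim auto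
  show "brep \<Omega> f x * g x = 0" if "x \<notin> \<Omega>" for x using b(3)[OF that] by simp
qed

text \<open>The difference of the two candidates is orthogonal to all test functions. Hence the
  \<open>SOME\<close> in \<open>weak_dir_deriv\<close> is determined almost everywhere, and
  identities for weak derivatives can be checked on any candidate.\<close>

lemma has_weak_dir_deriv_unique:
  assumes w: "w \<in> sq_integrable (lebesgue_on \<Omega>)" "has_weak_dir_deriv \<Omega> \<theta> u w"
    and w': "w' \<in> sq_integrable (lebesgue_on \<Omega>)" "has_weak_dir_deriv \<Omega> \<theta> u w'"
  shows "AE x\<in>\<Omega> in lborel. w x = w' x"
proof -
  let ?d = "\<lambda>x. w x - w' x"
  have d: "?d \<in> sq_integrable (lebesgue_on \<Omega>)" by (rule sq_integrable_diff[OF w(1) w'(1)])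
  note b = brep[OF borel_dom sq_integrableD(1)[OF d]]
  have bi: "integrable lborel (brep \<Omega> ?d)"
    by (rule integrable_of_square_integrable[OF b(1) brep_sq_integrable(1)[OF d] bounded_dom borel_dom b(3)])
  have "AE x\<in>\<Omega> in lborel. brep \<Omega> ?d x = 0"
  proof (rule test_functions_separate[OF open_dom b(1)])
    show "integrable lborel (\<lambda>x. indicator K x * brep \<Omega> ?d x)" if "compact K" for K
      using integrable_mult_indicator[OF _ bi, of K] that by (auto simp: compact_imp_closed)
    fix \<phi> assume \<phi>: "\<phi> \<in> test_functions \<Omega>"
    have "(LINT x|lborel. brep \<Omega> ?d x * \<phi> x) = (LINT x|lebesgue_on \<Omega>. w x * \<phi> x - w' x * \<phi> x)"
      using integral_brep_mult[OF sq_integrableD(1)[OF d] test_function_borel[OF \<phi>]] by (simp add: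
          left_diff_distrib)
    also have "\<dots> = (LINT x|lebesgue_on \<Omega>. w x * \<phi> x) - (LINT x|lebesgue_on \<Omega>. w' x * \<phi> x)"
      by (intro Bochner_Integration.integral_diff sq_integrable_mult w(1) w'(1)
          test_function_sq_integrable(1)[OF \<phi>])
    also have "\<dots> = 0" using w(2) w'(2) \<phi> by (auto simp: has_weak_dir_deriv_def)
    finally show "(LINT x|lborel. brep \<Omega> ?d x * \<phi> x) = 0" .
  qed
  with b(2) show ?thesis by eventually_elim auto
qed

lemma has_weak_dir_deriv_diff:
  assumes u: "u \<in> W_dir \<Omega> \<theta>" and v: "v \<in> W_dir \<Omega> \<theta>"
  shows "has_weak_dir_deriv \<Omega> \<theta> (\<lambda>x. v x - u x) (\<lambda>x. weak_dir_deriv \<Omega> \<theta> v x - weak_dir_deriv \<Omega> \<theta> u x)"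
  unfolding has_weak_dir_deriv_def
proof
  fix \<phi> assume \<phi>: "\<phi> \<in> test_functions \<Omega>"
  note t = test_function_sq_integrable[OF \<phi>]
  note wu = weak_dir_deriv[OF u] and wv = weak_dir_deriv[OF v]
  show "(LINT x|lebesgue_on \<Omega>. (v x - u x) * frechet_derivative \<phi> (at x) \<theta>) =
    - (LINT x|lebesgue_on \<Omega>. (weak_dir_deriv \<Omega> \<theta> v x - weak_dir_deriv \<Omega> \<theta> u x) * \<phi> x)"
    using wu(2) wv(2) \<phi> sq_integrable_mult[OF wu(3) t(2)] sq_integrable_mult[OF wv(3) t(2)]
      sq_integrable_mult[OF wu(1) t(1)] sq_integrable_mult[OF wv(1) t(1)]
    by (simp add: left_diff_distrib has_weak_dir_deriv_def)
qed

text \<open>The seminorm of a difference involves a fresh choice of weak derivative for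
  \<open>v x - u x\<close>; it has to be compared with the difference of the earlier
  choices.\<close>

lemma W_dir_diff:
  assumes u: "u \<in> W_dir \<Omega> \<theta>" and v: "v \<in> W_dir \<Omega> \<theta>"
  shows "(\<lambda>x. v x - u x) \<in> W_dir \<Omega> \<theta>"
    "AE x\<in>\<Omega> in lborel. weak_dir_deriv \<Omega> \<theta> (\<lambda>x. v x - u x) x = weak_dir_deriv \<Omega> \<theta> v x - weak_dir_deriv \<Omega> \<theta> u x"
proof -
  note wu = weak_dir_deriv[OF u] and wv = weak_dir_deriv[OF v]
  have sq: "(\<lambda>x. weak_dir_deriv \<Omega> \<theta> v x - weak_dir_deriv \<Omega> \<theta> u x) \<in> sq_integrable (lebesgue_on \<Omega>)"
    by (rule sq_integrable_diff[OF wv(1) wu(1)])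
  show W: "(\<lambda>x. v x - u x) \<in> W_dir \<Omega> \<theta>"
    using sq sq_integrable_diff[OF wv(3) wu(3)] has_weak_dir_deriv_diff[OF u v] by (auto simp: W_dir_def)
  show "AE x\<in>\<Omega> in lborel. weak_dir_deriv \<Omega> \<theta> (\<lambda>x. v x - u x) x = weak_dir_deriv \<Omega> \<theta> v x - weak_dir_deriv \<Omega>
      \<theta> u x"
    by (rule has_weak_dir_deriv_unique[OF weak_dir_deriv(1,2)[OF W] sq has_weak_dir_deriv_diff[OF u v]])
qed

lemma H1_D: "u \<in> H1 \<Omega> \<Longrightarrow> i \<in> Basis \<Longrightarrow> u \<in> W_dir \<Omega> i"
  by (auto simp: H1_def)

lemma H1_sq_integrable: "u \<in> H1 \<Omega> \<Longrightarrow> u \<in> sq_integrable (lebesgue_on \<Omega>)"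
  using weak_dir_deriv(3)[OF H1_D[OF _ SOME_Basis]] .

lemma H1_diff: "u \<in> H1 \<Omega> \<Longrightarrow> v \<in> H1 \<Omega> \<Longrightarrow> (\<lambda>x. v x - u x) \<in> H1 \<Omega>"
  by (auto simp: H1_def intro: W_dir_diff)

text \<open>Expanding the derivative of the test function in the basis shows that the combination of
  coordinate derivatives is a weak derivative along \<theta>, and uniqueness identifies it with the
  chosen one.\<close>

lemma H1_directional:
  assumes u: "u \<in> H1 \<Omega>"
  shows "u \<in> W_dir \<Omega> \<theta>"
    "AE x\<in>\<Omega> in lborel. weak_dir_deriv \<Omega> \<theta> u x = (\<Sum>i\<in>Basis. (\<theta> \<bullet> i) * weak_dir_deriv \<Omega> i u x)"
proof -
  let ?w = "\<lambda>x. \<Sum>i\<in>Basis. (\<theta> \<bullet> i) * weak_dir_deriv \<Omega> i u x"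
  note wi = weak_dir_deriv[OF H1_D[OF u]]
  have sq: "?w \<in> sq_integrable (lebesgue_on \<Omega>)"
    by (intro sq_integrable_sum sq_integrable_cmult wi(1))
  have weak: "has_weak_dir_deriv \<Omega> \<theta> u ?w"
    unfolding has_weak_dir_deriv_def
  proof
    fix \<phi> assume \<phi>: "\<phi> \<in> test_functions \<Omega>"
    note t = test_function_sq_integrable[OF \<phi>]
    have i1: "integrable (lebesgue_on \<Omega>) (\<lambda>x. u x * frechet_derivative \<phi> (at x) i)" for i
      by (rule sq_integrable_mult[OF H1_sq_integrable[OF u] t(2)])
    have i2: "integrable (lebesgue_on \<Omega>) (\<lambda>x. weak_dir_deriv \<Omega> i u x * \<phi> x)" if "i \<in> Basis" for i
      by (rule sq_integrable_mult[OF wi(1)[OF that] t(1)])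
    have "(LINT x|lebesgue_on \<Omega>. u x * frechet_derivative \<phi> (at x) \<theta>) =
      (LINT x|lebesgue_on \<Omega>. (\<Sum>i\<in>Basis. (\<theta> \<bullet> i) * (u x * frechet_derivative \<phi> (at x) i)))"
      by (subst test_function_derivative_expand[OF \<phi>]) (simp add: sum_distrib_left mult.left_commute)
    also have "\<dots> = (\<Sum>i\<in>Basis. (\<theta> \<bullet> i) * (LINT x|lebesgue_on \<Omega>. u x * frechet_derivative \<phi> (at x) i))"
      by (subst Bochner_Integration.integral_sum) (auto intro: i1)
    also have "\<dots> = (\<Sum>i\<in>Basis. - ((\<theta> \<bullet> i) * (LINT x|lebesgue_on \<Omega>. weak_dir_deriv \<Omega> i u x * \<phi> x)))"
      using wi(2) \<phi> by (intro sum.cong) (auto simp: has_weak_dir_deriv_def)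
    also have "\<dots> = - (LINT x|lebesgue_on \<Omega>. (\<Sum>i\<in>Basis. (\<theta> \<bullet> i) * (weak_dir_deriv \<Omega> i u x * \<phi> x)))"
      by (subst Bochner_Integration.integral_sum) (auto intro!: i2 simp: sum_negf)
    also have "\<dots> = - (LINT x|lebesgue_on \<Omega>. ?w x * \<phi> x)"
      by (simp add: sum_distrib_right mult.assoc)
    finally show "(LINT x|lebesgue_on \<Omega>. u x * frechet_derivative \<phi> (at x) \<theta>) = - (LINT x|lebesgue_on \<Omega>.
        ?w x * \<phi> x)" .
  qed
  show W: "u \<in> W_dir \<Omega> \<theta>"
    using sq weak H1_sq_integrable[OF u] by (auto simp: W_dir_def)
  show "AE x\<in>\<Omega> in lborel. weak_dir_deriv \<Omega> \<theta> u x = ?w x"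
    by (rule has_weak_dir_deriv_unique[OF weak_dir_deriv(1,2)[OF W] sq weak])
qed

text \<open>Cauchy-Schwarz for the coefficients of \<theta>, whose squares add up to 1. This is the
  step that makes all later constants independent of \<theta>.\<close>

lemma H1_norm_directional:
  assumes u: "u \<in> H1 \<Omega>" and \<theta>: "\<theta> \<in> sphere 0 1"
  shows "(LINT x|lebesgue_on \<Omega>. (u x)\<^sup>2) + (LINT x|lebesgue_on \<Omega>. (weak_dir_deriv \<Omega> \<theta> u x)\<^sup>2) \<le> (H1_norm \<Omega> u)\<^sup>2"
proof -
  note wi = weak_dir_deriv[OF H1_D[OF u]]
  note w = weak_dir_deriv[OF H1_directional(1)[OF u, of \<theta>]]
  have i: "integrable (lebesgue_on \<Omega>) (\<lambda>x. \<Sum>i\<in>Basis. (weak_dir_deriv \<Omega> i u x)\<^sup>2)"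
    by (intro Bochner_Integration.integrable_sum sq_integrableD(2) wi(1))
  have "(LINT x|lebesgue_on \<Omega>. (weak_dir_deriv \<Omega> \<theta> u x)\<^sup>2) \<le> (LINT x|lebesgue_on \<Omega>. (\<Sum>i\<in>Basis.
      (weak_dir_deriv \<Omega> i u x)\<^sup>2))"
  proof (rule integral_mono_AE[OF sq_integrableD(2)[OF w(1)] i])
    have "AE x in lebesgue_on \<Omega>. weak_dir_deriv \<Omega> \<theta> u x = (\<Sum>i\<in>Basis. (\<theta> \<bullet> i) * weak_dir_deriv \<Omega> i u x)"
      using H1_directional(2)[OF u, of \<theta>] by (simp add: AE_lebesgue_on_iff[OF borel_dom])
    then show "AE x in lebesgue_on \<Omega>. (weak_dir_deriv \<Omega> \<theta> u x)\<^sup>2 \<le> (\<Sum>i\<in>Basis. (weak_dir_deriv \<Omega> i u x)\<^sup>2)"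
    proof eventually_elim
      case (elim x)
      have "(\<Sum>i\<in>Basis. (\<theta> \<bullet> i) * weak_dir_deriv \<Omega> i u x)\<^sup>2 \<le> (\<Sum>i\<in>Basis. (\<theta> \<bullet> i)\<^sup>2) * (\<Sum>i\<in>Basis.
          (weak_dir_deriv \<Omega> i u x)\<^sup>2)"
        by (rule Cauchy_Schwarz_ineq_sum)
      also have "(\<Sum>i\<in>Basis. (\<theta> \<bullet> i)\<^sup>2) = 1"
        using \<theta> euclidean_inner[of \<theta> \<theta>] by (simp add: power2_eq_square norm_eq_1)
      finally show ?case unfolding elim by simp
    qed
  qed
  also have "\<dots> = (\<Sum>i\<in>Basis. LINT x|lebesgue_on \<Omega>. (weak_dir_deriv \<Omega> i u x)\<^sup>2)"
    by (intro Bochner_Integration.integral_sum sq_integrableD(2) wi(1))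
  finally show ?thesis
    by (simp add: H1_norm_def add_nonneg_nonneg sum_nonneg)
qed

end

section \<open>The pullback of the trace in one direction and its bounds\<close>

context directed_domain
begin

sublocale bounded_open_domain \<Omega>
  using open_domain bounded_domain by unfold_locales

lemma direction_sphere: "\<theta> \<in> sphere 0 1"
  using norm_direction by simp

lemma wd_brep:
  assumes u: "u \<in> sq_integrable (lebesgue_on \<Omega>)" and w: "w \<in> sq_integrable (lebesgue_on \<Omega>)"
    and weak: "has_weak_dir_deriv \<Omega> \<theta> u w"
  shows "wd (brep \<Omega> u) (brep \<Omega> w)"
proof -
  note um = sq_integrableD(1)[OF u] and wm = sq_integrableD(1)[OF w]
  have "(LINT x|lborel. brep \<Omega> u x * frechet_derivative \<phi> (at x) \<theta>) = - (LINT x|lborel. brep \<Omega> w x * \<phi> x)"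
    if \<phi>: "\<phi> \<in> test_functions \<Omega>" for \<phi>
    using weak \<phi> integral_brep_mult[OF um test_function_derivative_borel[OF \<phi>], of \<theta>]
      integral_brep_mult[OF wm test_function_borel[OF \<phi>]]
    by (simp add: has_weak_dir_deriv_def)
  then show ?thesis
    using brep[OF borel_domain um] brep[OF borel_domain wm] brep_sq_integrable(1)[OF u]
        brep_sq_integrable(1)[OF w]
    by (auto simp: wd_def)
qed

text \<open>\<open>dtr u\<close> is the pullback \<open>\<gamma>\<^sub>\<theta>u \<circ> z\<^sub>\<theta>\<close> of the directional trace to \<open>\<Omega>\<close>, up to a null set.\<close>

definition dtr :: "('a \<Rightarrow> real) \<Rightarrow> 'a \<Rightarrow> real" where
  "dtr u = trace_fun (brep \<Omega> u) (brep \<Omega> (weak_dir_deriv \<Omega> \<theta> u))"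

lemma wd_H1: "u \<in> H1 \<Omega> \<Longrightarrow> wd (brep \<Omega> u) (brep \<Omega> (weak_dir_deriv \<Omega> \<theta> u))"
  using weak_dir_deriv[OF H1_directional(1)[of u \<theta>]] by (intro wd_brep) auto

lemma borel_dtr: "u \<in> H1 \<Omega> \<Longrightarrow> dtr u \<in> borel_measurable borel"
  unfolding dtr_def using wdD[OF wd_H1] by (intro borel_trace_fun) auto

lemma line_AE_cong:
  fixes w w' :: "'a \<Rightarrow> real"
  assumes "AE x in lborel. w x = w' x" and [measurable]: "w \<in> borel_measurable borel" "w' \<in>
      borel_measurable borel"
  shows "AE x in lborel. \<forall>r. prim (line w x) r = prim (line w' x) r"
  using AE_lborel_lines[OF assms(1), of \<theta>]
proof eventually_elim
  case (elim x)
  have "(LINT \<rho>|lborel. indicator A \<rho> * line w x \<rho>) = (LINT \<rho>|lborel. indicator A \<rho> * line w' x \<rho>)" if "A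
      \<in> sets borel" for A
    by (rule integral_cong_AE) (use elim that in \<open>auto simp: line_def elim!: eventually_mono\<close>)
  then show ?case by (simp add: prim_def)
qed

lemma prim_diff:
  assumes "integrable lborel f" "integrable lborel g"
  shows "prim (\<lambda>r. f r - g r) r = prim f r - prim g r"
  using integrable_interval[OF assms(1)] integrable_interval[OF assms(2)]
  by (simp add: prim_def right_diff_distrib)

text \<open>\<open>dtr\<close> is assembled from choices, so it is additive only up to null sets:
  the chosen derivatives agree almost everywhere on almost every line, and primitives subtract where
  both lines are integrable.\<close>

lemma dtr_diff:
  assumes u: "u \<in> H1 \<Omega>" and v: "v \<in> H1 \<Omega>"
  shows "AE x\<in>\<Omega> in lborel. dtr (\<lambda>x. v x - u x) x = dtr v x - dtr u x"
proof -
  let ?d = "\<lambda>x. v x - u x"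
  let ?w = "\<lambda>u. brep \<Omega> (weak_dir_deriv \<Omega> \<theta> u)"
  note d = H1_diff[OF u v]
  note wu = wdD[OF wd_H1[OF u]] and wv = wdD[OF wd_H1[OF v]] and wd = wdD[OF wd_H1[OF d]]
  note bu = brep[OF borel_domain sq_integrableD(1)[OF H1_sq_integrable[OF u]]]
    and bv = brep[OF borel_domain sq_integrableD(1)[OF H1_sq_integrable[OF v]]]
    and bd = brep[OF borel_domain sq_integrableD(1)[OF H1_sq_integrable[OF d]]]
  note cu = brep[OF borel_domain sq_integrableD(1)[OF weak_dir_deriv(1)[OF H1_directional(1)[OF u, of \<theta>]]]]
    and cv = brep[OF borel_domain sq_integrableD(1)[OF weak_dir_deriv(1)[OF H1_directional(1)[OF v, of \<theta>]]]]
    and cd = brep[OF borel_domain sq_integrableD(1)[OF weak_dir_deriv(1)[OF H1_directional(1)[OF d, of \<theta>]]]]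
  have "AE x in lborel. ?w ?d x = ?w v x - ?w u x"
    using cu(2) cv(2) cd(2) W_dir_diff(2)[OF H1_directional(1)[OF u, of \<theta>] H1_directional(1)[OF v, of \<theta>]]
  proof eventually_elim
    case (elim x)
    then show ?case using cu(3)[of x] cv(3)[of x] cd(3)[of x] by (cases "x \<in> \<Omega>") auto
  qed
  from line_AE_cong[OF this] wu wv wd
  have l: "AE x in lborel. \<forall>r. prim (line (?w ?d) x) r = prim (line (\<lambda>x. ?w v x - ?w u x) x) r" by simp
  have lu: "AE x\<in>\<Omega> in lborel. integrable lborel (line (?w u) x)"
    by (rule line_integrable[OF wu(8)]) (rule wu(6))
  have lv: "AE x\<in>\<Omega> in lborel. integrable lborel (line (?w v) x)"
    by (rule line_integrable[OF wv(8)]) (rule wv(6))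
  show ?thesis
    using l bu(2) bv(2) bd(2) lu lv
  proof eventually_elim
    case (elim x)
    then show ?case
      using prim_diff[of "line (?w v) x" "line (?w u) x"] by (auto simp: dtr_def trace_fun_def
          line_def[abs_def])
  qed
qed

text \<open>The integral of (g - m)^2 over ]0, d[ is nonnegative, where m is the mean of g there;
  expanding it is Cauchy-Schwarz against the constant 1. The interval is then enlarged to ]0,
  R[.\<close>

lemma interval_Cauchy_Schwarz:
  fixes g :: "real \<Rightarrow> real"
  assumes g: "integrable lborel g" and g2: "integrable lborel (\<lambda>r. (g r)\<^sup>2)" and d: "0 < d" "d \<le> R"
  shows "(prim g d)\<^sup>2 \<le> R * (LINT r|lborel. indicator {0<..<R} r * (g r)\<^sup>2)"
proof -
  let ?I = "indicator {0<..<d} :: real \<Rightarrow> real"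
  define m where "m = prim g d / d"
  have m: "(LINT r|lborel. ?I r * g r) = d * m" using d by (simp add: m_def prim_nonneg)
  have Ii: "integrable lborel ?I" using emeasure_bounded_finite[of "{0<..<d}"] by (intro
      integrable_real_indicator) auto
  have "0 \<le> (LINT r|lborel. ?I r * (g r - m)\<^sup>2)" by (intro integral_nonneg_AE) auto
  also have "\<dots> = (LINT r|lborel. ?I r * (g r)\<^sup>2 - 2 * m * (?I r * g r) + m\<^sup>2 * ?I r)"
    by (intro Bochner_Integration.integral_cong) (auto simp: power2_diff algebra_simps)
  also have "\<dots> = (LINT r|lborel. ?I r * (g r)\<^sup>2) - 2 * m * (d * m) + m\<^sup>2 * d"
    using integrable_interval[OF g, of "{0<..<d}"] integrable_interval[OF g2, of "{0<..<d}"] Ii m d by simp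
  finally have "d * m\<^sup>2 \<le> (LINT r|lborel. ?I r * (g r)\<^sup>2)" by (simp add: power2_eq_square algebra_simps)
  also have le: "\<dots> \<le> (LINT r|lborel. indicator {0<..<R} r * (g r)\<^sup>2)"
    using d by (intro integral_mono integrable_interval[OF g2]) (auto simp: indicator_def)
  finally have "d * (d * m\<^sup>2) \<le> R * (LINT r|lborel. indicator {0<..<R} r * (g r)\<^sup>2)"
    using d by (intro mult_mono) auto
  moreover have "(prim g d)\<^sup>2 = d * (d * m\<^sup>2)" using d by (simp add: m_def power2_eq_square)
  ultimately show ?thesis by simp
qed

text \<open>One factor R comes from Cauchy-Schwarz on the line and one from integrating over 0 < r <
  R after the shear; the factors 2 come from (a + b)^2 <= 2 a^2 + 2 b^2.\<close>

lemma trace_bound: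
  assumes wd: "wd u w"
  defines "R \<equiv> diameter \<Omega> + 1"
  shows "integrable lborel (\<lambda>x. indicator \<Omega> x * (trace_fun u w x)\<^sup>2)"
    "(LINT x|lborel. indicator \<Omega> x * (trace_fun u w x)\<^sup>2) \<le> 2 * (LINT x|lborel. (u x)\<^sup>2) + 2 * R\<^sup>2 * (LINT
        x|lborel. (w x)\<^sup>2)"
proof -
  note W = wdD[OF wd]
  note [measurable] = W(1,2)
  have R: "0 < R" unfolding R_def using diameter_ge_0[OF bounded_domain] by simp
  \<comment> \<open>The range of r is the fixed interval ]0, R[ and not ]0, dd x[, so that the shear
    can be applied.\<close>
  define K where "K x = (LINT r|lborel. indicator {0<..<R} r * (w (x + r *\<^sub>R \<theta>))\<^sup>2)" for x
  note p = integrable_product_interval[OF W(4), of 0 R]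
  have KI: "integrable lborel K"
    unfolding K_def[abs_def] using lborel_pair.integrable_fst'[OF integrable_lborel_shear[OF p, of \<theta>]] by simp
  have KL: "(LINT x|lborel. K x) = R * (LINT x|lborel. (w x)\<^sup>2)"
    unfolding K_def using integral_lborel_shear[OF p, of \<theta>] R by simp
  have i: "integrable lborel (\<lambda>x. 2 * (u x)\<^sup>2 + 2 * (R * K x))" using W(3) KI by simp
  have le: "AE x in lborel. indicator \<Omega> x * (trace_fun u w x)\<^sup>2 \<le> 2 * (u x)\<^sup>2 + 2 * (R * K x)"
    using AE_good[OF wd]
  proof eventually_elim
    case (elim x)
    have K0: "0 \<le> K x" unfolding K_def by (intro integral_nonneg_AE) auto
    show ?case
    proof (cases "x \<in> \<Omega>")
      case True
      then have "(prim (line w x) (dd x))\<^sup>2 \<le> R * (LINT r|lborel. indicator {0<..<R} r * (line w x r)\<^sup>2)"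
        using elim dd_facts(1,2)[OF True] by (intro interval_Cauchy_Schwarz) (auto simp: good_def R_def)
      moreover have "(trace_fun u w x)\<^sup>2 \<le> 2 * (u x)\<^sup>2 + 2 * (prim (line w x) (dd x))\<^sup>2"
        using sum_squares_bound[of "u x" "prim (line w x) (dd x)"] True
        by (simp add: trace_fun_def dd0_eq power2_sum)
      ultimately show ?thesis using True by (simp add: K_def line_def)
    qed (use K0 R in simp)
  qed
  show I: "integrable lborel (\<lambda>x. indicator \<Omega> x * (trace_fun u w x)\<^sup>2)"
    by (rule Bochner_Integration.integrable_bound[OF i]) (use le in \<open>auto elim!: eventually_mono\<close>)
  have "(LINT x|lborel. indicator \<Omega> x * (trace_fun u w x)\<^sup>2) \<le> (LINT x|lborel. 2 * (u x)\<^sup>2 + 2 * (R * K x))"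
    by (rule integral_mono_AE[OF I i le])
  also have "\<dots> = 2 * (LINT x|lborel. (u x)\<^sup>2) + 2 * R\<^sup>2 * (LINT x|lborel. (w x)\<^sup>2)"
    using W(3) KI by (simp add: KL power2_eq_square)
  finally show "(LINT x|lborel. indicator \<Omega> x * (trace_fun u w x)\<^sup>2) \<le> 2 * (LINT x|lborel. (u x)\<^sup>2) + 2 *
      R\<^sup>2 * (LINT x|lborel. (w x)\<^sup>2)" .
qed

lemma dtr_bound:
  assumes u: "u \<in> H1 \<Omega>"
  shows "integrable lborel (\<lambda>x. indicator \<Omega> x * (dtr u x)\<^sup>2)"
    "(LINT x|lborel. indicator \<Omega> x * (dtr u x)\<^sup>2) \<le> 2 * (diameter \<Omega> + 1)\<^sup>2 * (H1_norm \<Omega> u)\<^sup>2"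
proof -
  show "integrable lborel (\<lambda>x. indicator \<Omega> x * (dtr u x)\<^sup>2)"
    unfolding dtr_def by (rule trace_bound(1)[OF wd_H1[OF u]])
  let ?R = "diameter \<Omega> + 1"
  let ?a = "LINT x|lebesgue_on \<Omega>. (u x)\<^sup>2" and ?b = "LINT x|lebesgue_on \<Omega>. (weak_dir_deriv \<Omega> \<theta> u x)\<^sup>2"
  \<comment> \<open>Thanks to the 1 added to the diameter, one constant covers both the term of u
    and the term of its derivative.\<close>
  have "1 \<le> ?R\<^sup>2" using diameter_ge_0[OF bounded_domain] by (simp add: one_le_power)
  from mult_right_mono[OF this, of ?a] have "2 * ?a \<le> 2 * ?R\<^sup>2 * ?a" by simp
  then have "2 * ?a + 2 * ?R\<^sup>2 * ?b \<le> 2 * ?R\<^sup>2 * (?a + ?b)" by (simp add: distrib_left)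
  also have "\<dots> \<le> 2 * ?R\<^sup>2 * (H1_norm \<Omega> u)\<^sup>2"
    by (intro mult_left_mono H1_norm_directional[OF u direction_sphere]) auto
  finally show "(LINT x|lborel. indicator \<Omega> x * (dtr u x)\<^sup>2) \<le> 2 * ?R\<^sup>2 * (H1_norm \<Omega> u)\<^sup>2"
    using trace_bound(2)[OF wd_H1[OF u]] brep_sq_integrable(2)[OF H1_sq_integrable[OF u]]
      brep_sq_integrable(2)[OF weak_dir_deriv(1)[OF H1_directional(1)[OF u, of \<theta>]]]
    by (simp add: dtr_def)
qed

lemma dir_traces_dtr:
  assumes u: "u \<in> H1 \<Omega>"
  shows "dir_traces \<Omega> \<theta> u \<noteq> {}"
    "k \<in> dir_traces \<Omega> \<theta> u \<Longrightarrow> AE x\<in>\<Omega> in lborel. k (exit x) = dtr u x"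
proof -
  have "AE x\<in>\<Omega> in lborel. u x = brep \<Omega> u x"
    by (rule brep(2)[OF borel_domain sq_integrableD(1)[OF H1_sq_integrable[OF u]]])
  then show "dir_traces \<Omega> \<theta> u \<noteq> {}"
    "k \<in> dir_traces \<Omega> \<theta> u \<Longrightarrow> AE x\<in>\<Omega> in lborel. k (exit x) = dtr u x"
    unfolding dtr_def using dir_traces_nonempty[OF wd_H1[OF u]] dir_trace_eq_trace_fun[OF wd_H1[OF u]] by auto
qed

text \<open>All directional traces of u have the same pullback, so any one of them decides the
  existential; \<open>AE_dir_measureI\<close> leads from \<Omega> back to the boundary.\<close>

lemma trace_iff_dtr:
  assumes u: "u \<in> H1 \<Omega>"
  shows "(\<exists>k\<in>dir_traces \<Omega> \<theta> u. AE z in dir_measure \<Omega> \<theta>. k z = g z) \<longleftrightarrow> (AE x\<in>\<Omega> in lborel. g (exit x) = dtr u x)"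
proof
  assume "\<exists>k\<in>dir_traces \<Omega> \<theta> u. AE z in dir_measure \<Omega> \<theta>. k z = g z"
  then obtain k where k: "k \<in> dir_traces \<Omega> \<theta> u" "AE z in dir_measure \<Omega> \<theta>. k z = g z" by blast
  show "AE x\<in>\<Omega> in lborel. g (exit x) = dtr u x"
    using dir_traces_dtr(2)[OF u k(1)] AE_dir_measureD[OF k(2)] by eventually_elim auto
next
  assume g: "AE x\<in>\<Omega> in lborel. g (exit x) = dtr u x"
  obtain k where k: "k \<in> dir_traces \<Omega> \<theta> u" using dir_traces_dtr(1)[OF u] by blast
  have "AE z in dir_measure \<Omega> \<theta>. k z = g z"
    by (rule AE_dir_measureI) (use dir_traces_dtr(2)[OF u k] g in \<open>eventually_elim, auto\<close>)
  with k show "\<exists>k\<in>dir_traces \<Omega> \<theta> u. AE z in dir_measure \<Omega> \<theta>. k z = g z" by blast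
qed

lemma dtr_sq_integrable_representative:
  assumes u: "u \<in> H1 \<Omega>" and g: "AE x\<in>\<Omega> in lborel. g (exit x) = dtr u x"
  shows "\<exists>g'\<in>sq_integrable (dir_measure \<Omega> \<theta>). (AE z in dir_measure \<Omega> \<theta>. g z = g' z) \<and>
    (LINT z|dir_measure \<Omega> \<theta>. (g' z)\<^sup>2) \<le> 2 * (diameter \<Omega> + 1)\<^sup>2 * (H1_norm \<Omega> u)\<^sup>2"
proof -
  note [measurable] = borel_dtr[OF u]
  obtain g' where g': "g' \<in> borel_measurable borel" "AE x\<in>\<Omega> in lborel. g' (exit x) = dtr u x"
    "AE z in dir_measure \<Omega> \<theta>. g z = g' z"
    using exit_function_borel_representative[OF borel_dtr[OF u] g] by blast
  note [measurable] = g'(1)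
  have sq: "AE x\<in>\<Omega> in lborel. (g' (exit x))\<^sup>2 = indicator \<Omega> x * (dtr u x)\<^sup>2"
    using g'(2) by eventually_elim auto
  note I = integral_dir_measure[of "\<lambda>z. (g' z)\<^sup>2" "\<lambda>x. indicator \<Omega> x * (dtr u x)\<^sup>2", OF _ _ sq]
  show ?thesis
  proof (intro bexI[of _ g'] conjI g'(3))
    show "g' \<in> sq_integrable (dir_measure \<Omega> \<theta>)"
      using I(1) dtr_bound(1)[OF u] borel_measurable_dir_measureI[OF g'(1)] by (simp add: sq_integrable_def)
    show "(LINT z|dir_measure \<Omega> \<theta>. (g' z)\<^sup>2) \<le> 2 * (diameter \<Omega> + 1)\<^sup>2 * (H1_norm \<Omega> u)\<^sup>2"
      using I(2) dtr_bound(2)[OF u] by simp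
  qed
qed

end

context bounded_open_domain
begin

text \<open>Membership in \<open>L2_bd\<close> comes for free: the pullback identity and
  \<open>dtr_bound\<close> provide the bound M, the same for all \<theta>. What remains is a family
  of identities almost everywhere in \<Omega>, stable under limits.\<close>

lemma is_tr_iff:
  assumes u: "u \<in> H1 \<Omega>"
  shows "is_tr \<Omega> u g \<longleftrightarrow> (\<forall>\<theta>\<in>sphere 0 1. AE x\<in>\<Omega> in lborel. g (dir_exit \<Omega> \<theta> x) = directed_domain.dtr \<Omega> \<theta> u x)"
    (is "_ \<longleftrightarrow> ?R")
proof -
  have iff: "(\<exists>k\<in>dir_traces \<Omega> \<theta> u. AE z in dir_measure \<Omega> \<theta>. k z = g z) \<longleftrightarrow>
      (AE x\<in>\<Omega> in lborel. g (dir_exit \<Omega> \<theta> x) = directed_domain.dtr \<Omega> \<theta> u x)" if "\<theta> \<in> sphere 0 1" for \<theta>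
  proof -
    interpret directed_domain \<Omega> \<theta> by (rule directed[OF that])
    show ?thesis using trace_iff_dtr[OF u] by (simp add: exit_def)
  qed
  have "g \<in> L2_bd \<Omega>" if r: ?R
    unfolding L2_bd_def
  proof (intro CollectI exI[of _ "2 * (diameter \<Omega> + 1)\<^sup>2 * (H1_norm \<Omega> u)\<^sup>2"] conjI ballI)
    fix \<theta> :: 'a assume \<theta>: "\<theta> \<in> sphere 0 1"
    interpret directed_domain \<Omega> \<theta> by (rule directed[OF \<theta>])
    have "AE x\<in>\<Omega> in lborel. g (exit x) = dtr u x" using r \<theta> by (simp add: exit_def)
    from dtr_sq_integrable_representative[OF u this]
    show "\<exists>g'\<in>sq_integrable (dir_measure \<Omega> \<theta>). (AE z in dir_measure \<Omega> \<theta>. g z = g' z) \<and>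
      (LINT z|dir_measure \<Omega> \<theta>. (g' z)\<^sup>2) \<le> 2 * (diameter \<Omega> + 1)\<^sup>2 * (H1_norm \<Omega> u)\<^sup>2" .
  qed auto
  then show ?thesis using iff by (auto simp: is_tr_def)
qed

end

section \<open>The trace operator\<close>

context directed_domain
begin

text \<open>On the closed segment from x to its exit point both h and the primitive are continuous,
  and they agree almost everywhere inside, hence at the end. The same h works for every
  direction.\<close>

lemma continuous_extension_trace:
  assumes u: "u \<in> H1 \<Omega>" and h: "continuous_on (closure \<Omega>) h" and hu: "AE x\<in>\<Omega> in lborel. h x = u x"
  shows "AE x\<in>\<Omega> in lborel. h (exit x) = dtr u x"
proof -
  let ?U = "brep \<Omega> u" and ?W = "brep \<Omega> (weak_dir_deriv \<Omega> \<theta> u)"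
  have hU: "AE x\<in>\<Omega> in lborel. h x = ?U x"
    using hu brep(2)[OF borel_domain sq_integrableD(1)[OF H1_sq_integrable[OF u]]] by eventually_elim auto
  show ?thesis
    using AE_lborel_lines[OF hU, of \<theta>] AE_good[OF wd_H1[OF u]]
  proof (eventually_elim, intro impI)
    fix x
    assume l: "AE r in lborel. x + r *\<^sub>R \<theta> \<in> \<Omega> \<longrightarrow> h (x + r *\<^sub>R \<theta>) = ?U (x + r *\<^sub>R \<theta>)"
      and "x \<in> \<Omega> \<longrightarrow> good ?U ?W x" and x: "x \<in> \<Omega>"
    then have good: "good ?U ?W x" by simp
    have wi: "integrable lborel (line ?W x)" using good by (simp add: good_def)
    note dd = dd_facts[OF x]
    have "h (x + dd x *\<^sub>R \<theta>) = ?U x + prim (line ?W x) (dd x)"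
    proof (rule AE_eq_imp_endpoint_eq[OF _ _ dd(1), where f = "\<lambda>r. h (x + r *\<^sub>R \<theta>)" and g = "\<lambda>r. ?U x +
        prim (line ?W x) r"])
      have "x + r *\<^sub>R \<theta> \<in> closure \<Omega>" if "r \<in> {0..dd x}" for r
      proof (cases "r = dd x")
        case True
        then show ?thesis using dd(5) by (auto simp: exit_eq frontier_def)
      next
        case False
        then show ?thesis using dd(3)[of r] that closure_subset[of \<Omega>] by auto
      qed
      then show "continuous_on {0..dd x} (\<lambda>r. h (x + r *\<^sub>R \<theta>))"
        by (intro continuous_on_compose2[OF h] continuous_intros) auto
      show "continuous_on {0..dd x} (\<lambda>r. ?U x + prim (line ?W x) r)"
        by (intro continuous_intros prim_continuous wi)
      have "AE r in lborel. - db x < r \<and> r < dd x \<longrightarrow> line ?U x r = ?U x + prim (line ?W x) r"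
        using good by (simp add: good_def)
      then show "AE r in lborel. 0 < r \<and> r < dd x \<longrightarrow> h (x + r *\<^sub>R \<theta>) = ?U x + prim (line ?W x) r"
        using l by eventually_elim (use dd(3) db_facts(1)[OF x] in \<open>auto simp: line_def\<close>)
    qed
    then show "h (exit x) = dtr u x"
      using x by (simp add: exit_eq dtr_def trace_fun_def dd0_eq)
  qed
qed

text \<open>Points with a common exit point lie on one maximal segment. This makes the extension of
  z_{-\<theta>} to exit points well defined, whichever x the \<open>SOME\<close> in
  \<open>dir_opposite\<close> returns.\<close>

lemma exit_eq_imp_entry_eq:
  assumes x: "x \<in> \<Omega>" and x': "x' \<in> \<Omega>" and eq: "exit x' = exit x"
  shows "entry x' = entry x"
proof -
  have x'_eq: "x' = x + (dd x - dd x') *\<^sub>R \<theta>" using eq by (simp add: exit_eq algebra_simps)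
  have "- db x < dd x - dd x'"
  proof (rule ccontr)
    \<comment> \<open>Otherwise the entry point of x would lie between x' and its exit point, hence
      in \<Omega>.\<close>
    assume "\<not> ?thesis"
    then have "x' + (dd x' - dd x - db x) *\<^sub>R \<theta> \<in> \<Omega>"
      using dd_facts(1)[OF x] db_facts(1)[OF x] by (intro dd_facts(3)[OF x']) auto
    moreover have "x' + (dd x' - dd x - db x) *\<^sub>R \<theta> = x - db x *\<^sub>R \<theta>"
      by (subst x'_eq) (simp add: algebra_simps)
    ultimately show False using db_facts(4)[OF x] by (simp add: entry_eq)
  qed
  then show ?thesis
    using segment(5)[OF x, of "dd x - dd x'"] dd_facts(1)[OF x'] x'_eq by simp
qed

lemma dir_opposite_exit:
  assumes x: "x \<in> \<Omega>"
  shows "dir_opposite \<Omega> \<theta> (exit x) = entry x"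
proof -
  let ?x' = "SOME y. y \<in> \<Omega> \<and> dir_exit \<Omega> \<theta> y = exit x"
  have "\<exists>y. y \<in> \<Omega> \<and> dir_exit \<Omega> \<theta> y = exit x" using x by (auto simp: exit_def)
  from someI_ex[OF this] have "?x' \<in> \<Omega>" "exit ?x' = exit x" by (auto simp: exit_def)
  then have "entry ?x' = entry x" by (rule exit_eq_imp_entry_eq[OF x])
  then show ?thesis by (simp add: dir_opposite_def entry_def)
qed

lemma norm_exit_entry:
  assumes x: "x \<in> \<Omega>"
  shows "norm (exit x - entry x) = dd x + db x"
proof -
  have "exit x - entry x = (dd x + db x) *\<^sub>R \<theta>" by (simp add: exit_eq entry_eq algebra_simps)
  then show ?thesis using norm_direction dd_facts(1)[OF x] db_facts(1)[OF x] by simp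
qed

text \<open>The derivatives chosen for \<theta> and - \<theta> are opposite almost everywhere, and
  reversing the parameter absorbs the sign. Both traces thus become values of one primitive, at
  \<open>dd x\<close> and at \<open>- db x\<close>.\<close>

lemma dtr_reverse:
  assumes u: "u \<in> H1 \<Omega>"
  shows "AE x\<in>\<Omega> in lborel. directed_domain.dtr \<Omega> (- \<theta>) u x =
    brep \<Omega> u x + prim (line (brep \<Omega> (weak_dir_deriv \<Omega> \<theta> u)) x) (- db x)"
proof -
  interpret rev: directed_domain \<Omega> "- \<theta>" by (rule reverse)
  let ?W = "brep \<Omega> (weak_dir_deriv \<Omega> \<theta> u)" and ?W' = "brep \<Omega> (weak_dir_deriv \<Omega> (- \<theta>) u)"
  note b = brep[OF borel_domain sq_integrableD(1)[OF weak_dir_deriv(1)[OF H1_directional(1)[OF u, of \<theta>]]]]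
    and b' = brep[OF borel_domain sq_integrableD(1)[OF weak_dir_deriv(1)[OF H1_directional(1)[OF u, of "- \<theta>"]]]]
  note [measurable] = b(1) b'(1)
  have "AE x in lborel. ?W' x = - ?W x"
    using H1_directional(2)[OF u, of \<theta>] H1_directional(2)[OF u, of "- \<theta>"] b(2) b'(2)
  proof eventually_elim
    case (elim x)
    then show ?case using b(3)[of x] b'(3)[of x] by (cases "x \<in> \<Omega>") (auto simp: sum_negf)
  qed
  then have "AE x in lborel. \<forall>r. prim (rev.line ?W' x) r = prim (rev.line (\<lambda>x. - ?W x) x) r"
    by (rule rev.line_AE_cong) measurable
  then show ?thesis
  proof (eventually_elim, intro impI)
    fix x assume x: "x \<in> \<Omega>" and e: "\<forall>r. prim (rev.line ?W' x) r = prim (rev.line (\<lambda>x. - ?W x) x) r"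
    have "prim (rev.line (\<lambda>x. - ?W x) x) r = prim (line ?W x) (- r)" for r
      using prim_reverse[of "line ?W x" r] by (simp add: line_def[abs_def] rev.line_def[abs_def])
    then show "rev.dtr u x = brep \<Omega> u x + prim (line ?W x) (- db x)"
      using x e by (simp add: rev.dtr_def rev.trace_fun_def rev.dd0_eq back_eq)
  qed
qed

text \<open>After the shear \<open>(x, r) \<mapsto> (x + r \<theta>, r)\<close> the inner integral in \<open>r\<close> runs over an interval of length
  \<open>dd x + db x\<close>.\<close>

lemma integral_segment_average:
  fixes f :: "'a \<Rightarrow> real"
  assumes f: "integrable lborel f" and f0: "\<And>x. x \<notin> \<Omega> \<Longrightarrow> f x = 0"
  defines "G \<equiv> \<lambda>x. (LINT r|lborel. (if x \<in> \<Omega> \<and> - db0 x < r \<and> r < dd0 x then f (x + r *\<^sub>R \<theta>) / (dd0 x + db0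
      x) else 0))"
  shows "integrable lborel G" "(LINT x|lborel. G x) = (LINT x|lborel. f x)"
proof -
  have [measurable]: "f \<in> borel_measurable borel" using borel_measurable_integrable[OF f] by simp
  \<comment> \<open>The integrand seen from the other end of the shear: at y = x + r \<theta> the
    condition says that the base point y - r \<theta> lies on the segment of y, whose length is the
    same as that of x.\<close>
  define m where "m x r = (if x \<in> \<Omega> \<and> - db0 x < - r \<and> - r < dd0 x then f x / (dd0 x + db0 x) else 0)" for
      x and r :: real
  have k: "m (x + r *\<^sub>R \<theta>) r = (if x \<in> \<Omega> \<and> - db0 x < r \<and> r < dd0 x then f (x + r *\<^sub>R \<theta>) / (dd0 x + db0 x)
      else 0)" for x r
  proof (cases "x \<in> \<Omega> \<and> - db0 x < r \<and> r < dd0 x")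
    case True
    then have x: "x \<in> \<Omega>" "- db x < r" "r < dd x" by (auto simp: dd0_eq db0_eq)
    note s = segment[OF x]
    show ?thesis using x s dd_facts(1)[OF x(1)] db_facts(1)[OF x(1)] by (simp add: m_def dd0_eq db0_eq)
  next
    case False
    have "\<not> (x + r *\<^sub>R \<theta> \<in> \<Omega> \<and> - db0 (x + r *\<^sub>R \<theta>) < - r \<and> - r < dd0 (x + r *\<^sub>R \<theta>))"
    proof
      assume "x + r *\<^sub>R \<theta> \<in> \<Omega> \<and> - db0 (x + r *\<^sub>R \<theta>) < - r \<and> - r < dd0 (x + r *\<^sub>R \<theta>)"
      then have y: "x + r *\<^sub>R \<theta> \<in> \<Omega>" "- db (x + r *\<^sub>R \<theta>) < - r" "- r < dd (x + r *\<^sub>R \<theta>)"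
        by (auto simp: dd0_eq db0_eq)
      from segment(1-3)[OF y] dd_facts(1)[OF y(1)] db_facts(1)[OF y(1)] have "x \<in> \<Omega>" "- db x < r" "r < dd
          x" by auto
      then show False using False by (simp add: dd0_eq db0_eq)
    qed
    then show ?thesis using False by (simp only: m_def if_False)
  qed
  have L: "0 < dd0 x + db0 x" if "x \<in> \<Omega>" for x
    using dd_facts(1)[OF that] db_facts(1)[OF that] that by (simp add: dd0_eq db0_eq)
  have m_ind: "m x r = f x / (dd0 x + db0 x) * indicator {- dd0 x<..<db0 x} r" for x r
    using f0[of x] by (auto simp: m_def indicator_def)
  have fin: "integrable lborel (indicator {- dd0 x<..<db0 x} :: real \<Rightarrow> real)" for x
    using emeasure_bounded_finite[of "{- dd0 x<..<db0 x}"] by (intro integrable_real_indicator) auto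
  have meas: "measure lborel {- dd0 x<..<db0 x} = dd0 x + db0 x" for x
  proof (cases "x \<in> \<Omega>")
    case True
    then show ?thesis using L[OF True] by simp
  qed (simp add: dd0_eq db0_eq)
  have inner: "(LINT r|lborel. m x r) = f x" "(LINT r|lborel. \<bar>m x r\<bar>) = \<bar>f x\<bar>" for x
  proof -
    \<comment> \<open>Outside \<Omega> the length is 0, but f vanishes there, so the equations
      survive the division by 0.\<close>
    have "f x / (dd0 x + db0 x) * (dd0 x + db0 x) = f x" "\<bar>f x / (dd0 x + db0 x)\<bar> * (dd0 x + db0 x) = \<bar>f x\<bar>"
      using L[of x] f0[of x] by (cases "x \<in> \<Omega>"; simp)+
    then show "(LINT r|lborel. m x r) = f x" "(LINT r|lborel. \<bar>m x r\<bar>) = \<bar>f x\<bar>"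
      unfolding m_ind by (simp_all add: abs_mult meas)
  qed
  have mI: "integrable (lborel \<Otimes>\<^sub>M lborel) (\<lambda>(x, r). m x r)"
  proof (rule lborel_pair.Fubini_integrable)
    show "(\<lambda>(x, r). m x r) \<in> borel_measurable (lborel \<Otimes>\<^sub>M lborel)"
      unfolding m_def by measurable
    show "integrable lborel (\<lambda>x. LINT y|lborel. norm (case (x, y) of (x, r) \<Rightarrow> m x r))"
      using f by (simp add: inner)
    show "AE x in lborel. integrable lborel (\<lambda>y. case (x, y) of (x, r) \<Rightarrow> m x r)"
      using fin by (auto simp: m_ind)
  qed
  show "integrable lborel G"
    using lborel_pair.integrable_fst'[OF integrable_lborel_shear[OF mI, of \<theta>]] unfolding G_def k by simp
  show "(LINT x|lborel. G x) = (LINT x|lborel. f x)"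
    using integral_lborel_shear[OF mI, of \<theta>] unfolding G_def k by (simp add: inner)
qed

text \<open>The assumptions at \<open>entry\<close> concern the direction - \<theta>;
  \<open>dtr_reverse\<close> expresses them through the primitives P and Q, which thus supply both
  ends of the segment. G is the mean of the integrand over the segment, and its integrability gives
  that of F.\<close>

lemma integration_by_parts:
  assumes u: "u \<in> H1 \<Omega>" and v: "v \<in> H1 \<Omega>"
    and gu: "AE x\<in>\<Omega> in lborel. gu (exit x) = dtr u x"
      "AE x\<in>\<Omega> in lborel. gu (entry x) = directed_domain.dtr \<Omega> (- \<theta>) u x"
    and gv: "AE x\<in>\<Omega> in lborel. gv (exit x) = dtr v x"
      "AE x\<in>\<Omega> in lborel. gv (entry x) = directed_domain.dtr \<Omega> (- \<theta>) v x"
  defines "f \<equiv> \<lambda>x. u x * weak_dir_deriv \<Omega> \<theta> v x + v x * weak_dir_deriv \<Omega> \<theta> u x"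
    and "F \<equiv> \<lambda>z. (gu z * gv z - gu (dir_opposite \<Omega> \<theta> z) * gv (dir_opposite \<Omega> \<theta> z)) / norm (z -
        dir_opposite \<Omega> \<theta> z)"
  shows "integrable (lebesgue_on \<Omega>) f" "integrable (completion (dir_measure \<Omega> \<theta>)) F"
    "(LINT x|lebesgue_on \<Omega>. f x) = (LINT z|completion (dir_measure \<Omega> \<theta>). F z)"
proof -
  note wu = weak_dir_deriv[OF H1_directional(1)[OF u, of \<theta>]] and wv = weak_dir_deriv[OF
      H1_directional(1)[OF v, of \<theta>]]
  note wdu = wd_H1[OF u] and wdv = wd_H1[OF v]
  let ?U = "brep \<Omega> u" and ?W = "brep \<Omega> (weak_dir_deriv \<Omega> \<theta> u)"
    and ?V = "brep \<Omega> v" and ?Z = "brep \<Omega> (weak_dir_deriv \<Omega> \<theta> v)"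
  note b = brep[OF borel_domain sq_integrableD(1)[OF wu(3)]] brep[OF borel_domain sq_integrableD(1)[OF wu(1)]]
    brep[OF borel_domain sq_integrableD(1)[OF wv(3)]] brep[OF borel_domain sq_integrableD(1)[OF wv(1)]]
  note [measurable] = b(1,4,7,10)
  define f0 where "f0 x = ?U x * ?Z x + ?V x * ?W x" for x
  have [measurable]: "f0 \<in> borel_measurable borel" unfolding f0_def[abs_def] by measurable
  have f0_out: "f0 x = 0" if "x \<notin> \<Omega>" for x using b(3,9)[OF that] by (simp add: f0_def)
  show fI: "integrable (lebesgue_on \<Omega>) f"
    unfolding f_def using sq_integrable_mult[OF wu(3) wv(1)] sq_integrable_mult[OF wv(3) wu(1)] by simp
  have ae: "AE x\<in>\<Omega> in lborel. f x = f0 x"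
    using b(2,5,8,11) by eventually_elim (auto simp: f_def f0_def)
  have f0I: "integrable lborel f0" and f0L: "(LINT x|lebesgue_on \<Omega>. f x) = (LINT x|lborel. f0 x)"
    using lebesgue_on_integral_borel[OF borel_domain _ borel_measurable_integrable[OF fI] ae f0_out] fI by auto
  define G where "G x = (LINT r|lborel. (if x \<in> \<Omega> \<and> - db0 x < r \<and> r < dd0 x then f0 (x + r *\<^sub>R \<theta>) / (dd0 x
      + db0 x) else 0))" for x
  note avg = integral_segment_average[OF f0I f0_out, folded G_def]
  have FG: "AE x\<in>\<Omega> in lborel. F (exit x) = G x"
    using gu gv dtr_reverse[OF u] dtr_reverse[OF v] AE_good[OF wdu] AE_good[OF wdv]
  proof (eventually_elim, intro impI)
    fix x
    assume x: "x \<in> \<Omega>"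
      and h: "x \<in> \<Omega> \<longrightarrow> gu (exit x) = dtr u x" "x \<in> \<Omega> \<longrightarrow> gu (entry x) = directed_domain.dtr \<Omega> (- \<theta>) u x"
        "x \<in> \<Omega> \<longrightarrow> gv (exit x) = dtr v x" "x \<in> \<Omega> \<longrightarrow> gv (entry x) = directed_domain.dtr \<Omega> (- \<theta>) v x"
        "x \<in> \<Omega> \<longrightarrow> directed_domain.dtr \<Omega> (- \<theta>) u x = ?U x + prim (line ?W x) (- db x)"
        "x \<in> \<Omega> \<longrightarrow> directed_domain.dtr \<Omega> (- \<theta>) v x = ?V x + prim (line ?Z x) (- db x)"
        "x \<in> \<Omega> \<longrightarrow> good ?U ?W x" "x \<in> \<Omega> \<longrightarrow> good ?V ?Z x"
    define P where "P r = ?U x + prim (line ?W x) r" for r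
    define Q where "Q r = ?V x + prim (line ?Z x) r" for r
    have vals: "gu (exit x) = P (dd x)" "gv (exit x) = Q (dd x)" "gu (entry x) = P (- db x)" "gv (entry x)
        = Q (- db x)"
      using h x by (auto simp: P_def Q_def dtr_def trace_fun_def dd0_eq)
    have gd: "integrable lborel (line ?W x)" "integrable lborel (line ?Z x)"
      "AE r in lborel. - db x < r \<and> r < dd x \<longrightarrow> line ?U x r = P r"
      "AE r in lborel. - db x < r \<and> r < dd x \<longrightarrow> line ?V x r = Q r"
      using h(7,8) x by (auto simp: good_def P_def Q_def)
    have pos: "0 < dd x" "0 < db x" using dd_facts(1)[OF x] db_facts(1)[OF x] .
    then have "- db x \<le> dd x" by simp
    note pp = prim_product[OF gd(1,2) this P_def Q_def]
    have [measurable]: "line ?W x \<in> borel_measurable borel" "line ?Z x \<in> borel_measurable borel"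
      using gd(1,2) by (auto dest: borel_measurable_integrable)
    have "G x = (LINT r|lborel. (indicator {- db x<..<dd x} r * (P r * line ?Z x r + Q r * line ?W x r)) /
        (dd x + db x))"
      unfolding G_def
    proof (rule integral_cong_AE)
      show "AE r in lborel. (if x \<in> \<Omega> \<and> - db0 x < r \<and> r < dd0 x then f0 (x + r *\<^sub>R \<theta>) / (dd0 x + db0 x)
          else 0) =
        (indicator {- db x<..<dd x} r * (P r * line ?Z x r + Q r * line ?W x r)) / (dd x + db x)"
        using gd(3,4) by eventually_elim (use x in \<open>auto simp: dd0_eq db0_eq f0_def line_def indicator_def\<close>)
      show "(\<lambda>r. (indicator {- db x<..<dd x} r * (P r * line ?Z x r + Q r * line ?W x r)) / (dd x + db x))
          \<in> borel_measurable lborel"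
        using borel_measurable_integrable[OF pp(2)] by simp
    qed measurable
    also have "\<dots> = (P (dd x) * Q (dd x) - P (- db x) * Q (- db x)) / (dd x + db x)"
      using pp(1) by simp
    finally show "F (exit x) = G x"
      unfolding F_def dir_opposite_exit[OF x] norm_exit_entry[OF x] vals by simp
  qed
  have G0: "G x = 0" if "x \<notin> \<Omega>" for x using that by (simp add: G_def)
  have Gm: "G \<in> borel_measurable borel" using borel_measurable_integrable[OF avg(1)] by simp
  note c = integral_completion_dir_measure[OF Gm FG G0]
  show "integrable (completion (dir_measure \<Omega> \<theta>)) F" using c(1) avg(1) by simp
  show "(LINT x|lebesgue_on \<Omega>. f x) = (LINT z|completion (dir_measure \<Omega> \<theta>). F z)"
    using c(2) avg(2) f0L by simp
qed

lemma trace_difference_integral: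
  assumes u: "u \<in> H1 \<Omega>" and v: "v \<in> H1 \<Omega>"
    and gu: "AE x\<in>\<Omega> in lborel. gu (exit x) = dtr u x"
    and gv: "AE x\<in>\<Omega> in lborel. gv (exit x) = dtr v x"
  shows "(LINT z|completion (dir_measure \<Omega> \<theta>). (gv z - gu z)\<^sup>2) \<le> 2 * (diameter \<Omega> + 1)\<^sup>2 * (H1_norm \<Omega> (\<lambda>x.
      v x - u x))\<^sup>2"
proof -
  note d = H1_diff[OF u v]
  let ?G = "\<lambda>x. indicator \<Omega> x * (dtr (\<lambda>x. v x - u x) x)\<^sup>2"
  note [measurable] = borel_dtr[OF d]
  have "AE x\<in>\<Omega> in lborel. (gv (exit x) - gu (exit x))\<^sup>2 = ?G x"
    using gu gv dtr_diff[OF u v] by eventually_elim auto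
  from integral_completion_dir_measure(2)[OF _ this]
  have "(LINT z|completion (dir_measure \<Omega> \<theta>). (gv z - gu z)\<^sup>2) = (LINT x|lborel. ?G x)" by simp
  then show ?thesis using dtr_bound(2)[OF d] by simp
qed

end

text \<open>The integrals are summable, so the sum of the functions has finite integral and is
  finite almost everywhere; the terms of a convergent series tend to 0.\<close>

lemma AE_tendsto_zero_geometric:
  fixes f :: "nat \<Rightarrow> 'b \<Rightarrow> real"
  assumes f: "\<And>n. integrable M (f n)" "\<And>n x. 0 \<le> f n x" and b: "\<And>n. (LINT x|M. f n x) \<le> C * (1/2) ^ n"
  shows "AE x in M. (\<lambda>n. f n x) \<longlonglongrightarrow> 0"
proof -
  have [measurable]: "f n \<in> borel_measurable M" for n using f(1) by auto
  have "0 \<le> (LINT x|M. f 0 x)" using f(2) by (intro integral_nonneg_AE) auto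
  then have C: "0 \<le> C" using b[of 0] by simp
  have "(\<integral>\<^sup>+x. (\<Sum>n. ennreal (f n x)) \<partial>M) = (\<Sum>n. \<integral>\<^sup>+x. ennreal (f n x) \<partial>M)"
    by (rule nn_integral_suminf) measurable
  also have "\<dots> \<le> (\<Sum>n. ennreal (C * (1/2) ^ n))"
    using f b by (intro suminf_le) (auto simp: nn_integral_eq_integral intro!: ennreal_leI)
  also have "\<dots> < top"
  proof -
    have "summable (\<lambda>n. C * (1/2) ^ n)" by (intro summable_mult summable_geometric) simp
    then show ?thesis using C by (subst suminf_ennreal2) auto
  qed
  finally have "AE x in M. (\<Sum>n. ennreal (f n x)) \<noteq> \<infinity>"
    by (intro nn_integral_PInf_AE) auto
  then show ?thesis
  proof eventually_elim
    case (elim x)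
    then have "summable (\<lambda>n. f n x)"
      using f(2) by (intro summable_suminf_not_top) auto
    then show ?case by (rule summable_LIMSEQ_zero)
  qed
qed

section \<open>Closedness and continuity, for all directions at once\<close>

context bounded_open_domain
begin

lemma H1_norm_nonneg: "0 \<le> H1_norm \<Omega> u"
  by (simp add: H1_norm_def sum_nonneg add_nonneg_nonneg)

lemma bd_tr:
  assumes "u \<in> H1_tr \<Omega>"
  shows "is_tr \<Omega> u (bd_tr \<Omega> u)" "u \<in> H1 \<Omega>"
proof -
  have "\<exists>g. is_tr \<Omega> u g" using assms by (auto simp: H1_tr_def)
  then show "is_tr \<Omega> u (bd_tr \<Omega> u)" unfolding bd_tr_def by (rule someI_ex)
  show "u \<in> H1 \<Omega>" using assms by (auto simp: H1_tr_def)
qed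

lemma bd_tr_dtr:
  assumes u: "u \<in> H1_tr \<Omega>" and \<theta>: "\<theta> \<in> sphere 0 1"
  shows "AE x\<in>\<Omega> in lborel. bd_tr \<Omega> u (dir_exit \<Omega> \<theta> x) = directed_domain.dtr \<Omega> \<theta> u x"
  using bd_tr[OF u] \<theta> by (auto simp: is_tr_iff)

text \<open>The contrapositive says that a point of \<open>H1\<close> outside \<open>H1_tr\<close>
  has a ball free of \<open>H1_tr\<close>, which is openness of the complement in
  \<open>seminorm_topology\<close>.\<close>

lemma H1_tr_limit:
  assumes u: "u \<in> H1 \<Omega>" and approx: "\<And>e. 0 < e \<Longrightarrow> \<exists>v\<in>H1_tr \<Omega>. H1_norm \<Omega> (\<lambda>x. v x - u x) < e"
  shows "u \<in> H1_tr \<Omega>"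
proof -
  have "\<exists>v. v \<in> H1_tr \<Omega> \<and> H1_norm \<Omega> (\<lambda>x. v x - u x) < (1/2) ^ n" for n
    using approx[of "(1/2) ^ n"] by auto
  then obtain v where v: "\<And>n. v n \<in> H1_tr \<Omega>" "\<And>n. H1_norm \<Omega> (\<lambda>x. v n x - u x) < (1/2) ^ n"
    by metis
  \<comment> \<open>Where the sequence diverges, \<open>lim\<close> is an unspecified value; for
    each \<theta> this happens only on a set with null preimage under \<open>exit\<close>.\<close>
  define g where "g z = lim (\<lambda>n. bd_tr \<Omega> (v n) z)" for z
  let ?C = "2 * (diameter \<Omega> + 1)\<^sup>2"
  have "is_tr \<Omega> u g"
    unfolding is_tr_iff[OF u]
  proof
    fix \<theta> :: 'a assume \<theta>: "\<theta> \<in> sphere 0 1"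
    interpret directed_domain \<Omega> \<theta> by (rule directed[OF \<theta>])
    let ?d = "\<lambda>n x. v n x - u x"
    note d = H1_diff[OF u bd_tr(2)[OF v(1)]]
    have tr: "AE x in lborel. \<forall>n. x \<in> \<Omega> \<longrightarrow> bd_tr \<Omega> (v n) (exit x) = dtr (v n) x"
      unfolding AE_all_countable exit_def using bd_tr_dtr[OF v(1) \<theta>] by blast
    have diff: "AE x in lborel. \<forall>n. x \<in> \<Omega> \<longrightarrow> dtr (?d n) x = dtr (v n) x - dtr u x"
      unfolding AE_all_countable using dtr_diff[OF u bd_tr(2)[OF v(1)]] by blast
    have "AE x in lborel. (\<lambda>n. indicator \<Omega> x * (dtr (?d n) x)\<^sup>2) \<longlonglongrightarrow> 0"
    proof (rule AE_tendsto_zero_geometric)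
      show "integrable lborel (\<lambda>x. indicator \<Omega> x * (dtr (?d n) x)\<^sup>2)" for n by (rule dtr_bound(1)[OF d])
      fix n
      \<comment> \<open>The bound on traces is quadratic in the norm, so the squared rate is
        available; it is weakened to \<open>(1/2) ^ n\<close>.\<close>
      have "(H1_norm \<Omega> (?d n))\<^sup>2 \<le> ((1/2) ^ n)\<^sup>2"
        using v(2)[of n] H1_norm_nonneg by (intro power_mono) auto
      also have "\<dots> \<le> (1/2) ^ n" by (simp add: power2_eq_square mult_left_le_one_le power_le_one)
      finally have "?C * (H1_norm \<Omega> (?d n))\<^sup>2 \<le> ?C * (1/2) ^ n" by (intro mult_left_mono) auto
      then show "(LINT x|lborel. indicator \<Omega> x * (dtr (?d n) x)\<^sup>2) \<le> ?C * (1/2) ^ n"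
        using dtr_bound(2)[OF d, of n] by simp
    qed simp
    then show "AE x\<in>\<Omega> in lborel. g (dir_exit \<Omega> \<theta> x) = dtr u x"
      using tr diff
    proof (eventually_elim, intro impI)
      fix x
      assume x: "x \<in> \<Omega>" and l: "(\<lambda>n. indicator \<Omega> x * (dtr (?d n) x)\<^sup>2) \<longlonglongrightarrow> 0"
        and t: "\<forall>n. x \<in> \<Omega> \<longrightarrow> bd_tr \<Omega> (v n) (exit x) = dtr (v n) x"
        and e: "\<forall>n. x \<in> \<Omega> \<longrightarrow> dtr (?d n) x = dtr (v n) x - dtr u x"
      have "(\<lambda>n. sqrt ((dtr (v n) x - dtr u x)\<^sup>2)) \<longlonglongrightarrow> sqrt 0"
        using l x e by (intro tendsto_real_sqrt) simp
      then have "(\<lambda>n. dtr (v n) x) \<longlonglongrightarrow> dtr u x"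
        by (simp add: tendsto_rabs_zero_iff LIM_zero_iff)
      then have "(\<lambda>n. bd_tr \<Omega> (v n) (exit x)) \<longlonglongrightarrow> dtr u x" using t x by simp
      then show "g (dir_exit \<Omega> \<theta> x) = dtr u x"
        unfolding g_def exit_def by (rule limI)
    qed
  qed
  then show ?thesis using u by (auto simp: H1_tr_def)
qed

lemma closedin_H1_tr: "closedin (H1_topology \<Omega>) (H1_tr \<Omega>)"
proof -
  have sub: "H1_tr \<Omega> \<subseteq> H1 \<Omega>" by (auto simp: H1_tr_def)
  have "openin (H1_topology \<Omega>) (H1 \<Omega> - H1_tr \<Omega>)"
    unfolding H1_topology_def openin_seminorm_topology
  proof (intro conjI ballI)
    fix u assume "u \<in> H1 \<Omega> - H1_tr \<Omega>"
    then obtain e where "0 < e" "\<forall>v\<in>H1_tr \<Omega>. \<not> H1_norm \<Omega> (\<lambda>x. v x - u x) < e"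
      using H1_tr_limit[of u] by blast
    then show "\<exists>e>0. \<forall>v\<in>H1 \<Omega>. H1_norm \<Omega> (\<lambda>x. v x - u x) < e \<longrightarrow> v \<in> H1 \<Omega> - H1_tr \<Omega>" by blast
  qed auto
  then show ?thesis
    using sub by (simp add: closedin_def H1_topology_def topspace_seminorm_topology)
qed

lemma H1_C0_subset_H1_tr: "H1_C0 \<Omega> \<subseteq> H1_tr \<Omega>"
proof
  fix u assume "u \<in> H1_C0 \<Omega>"
  then obtain h where u: "u \<in> H1 \<Omega>" and h: "continuous_on (closure \<Omega>) h" "AE x\<in>\<Omega> in lborel. h x = u x"
    by (auto simp: H1_C0_def AE_lebesgue_on_iff[OF borel_dom])
  have "is_tr \<Omega> u h"
    unfolding is_tr_iff[OF u]
  proof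
    fix \<theta> :: 'a assume \<theta>: "\<theta> \<in> sphere 0 1"
    interpret directed_domain \<Omega> \<theta> by (rule directed[OF \<theta>])
    show "AE x\<in>\<Omega> in lborel. h (dir_exit \<Omega> \<theta> x) = dtr u x"
      using continuous_extension_trace[OF u h] by (simp add: exit_def)
  qed
  then show "u \<in> H1_tr \<Omega>" using u by (auto simp: H1_tr_def)
qed

lemma bd_tr_Lipschitz:
  assumes u: "u \<in> H1_tr \<Omega>" and v: "v \<in> H1_tr \<Omega>"
  shows "L2_bd_norm \<Omega> (\<lambda>z. bd_tr \<Omega> v z - bd_tr \<Omega> u z) \<le> sqrt 2 * (diameter \<Omega> + 1) * H1_norm \<Omega> (\<lambda>x. v x - u x)"
proof -
  let ?N = "H1_norm \<Omega> (\<lambda>x. v x - u x)"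
  \<comment> \<open>\<open>cSUP_least\<close> asks for a nonempty index set; a basis vector lies on
    the sphere.\<close>
  have "norm (SOME i. i \<in> (Basis :: 'a set)) = 1" by (rule norm_Basis) (rule SOME_Basis)
  then have ne: "sphere (0::'a) 1 \<noteq> {}" by (metis empty_iff mem_sphere_0)
  have "(SUP \<theta>\<in>sphere 0 1. LINT z|completion (dir_measure \<Omega> \<theta>). (bd_tr \<Omega> v z - bd_tr \<Omega> u z)\<^sup>2) \<le> 2 *
      (diameter \<Omega> + 1)\<^sup>2 * ?N\<^sup>2"
  proof (rule cSUP_least[OF ne])
    fix \<theta> :: 'a assume \<theta>: "\<theta> \<in> sphere 0 1"
    interpret directed_domain \<Omega> \<theta> by (rule directed[OF \<theta>])
    show "(LINT z|completion (dir_measure \<Omega> \<theta>). (bd_tr \<Omega> v z - bd_tr \<Omega> u z)\<^sup>2) \<le> 2 * (diameter \<Omega> + 1)\<^sup>2 * ?N\<^sup>2"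
      using trace_difference_integral[OF bd_tr(2)[OF u] bd_tr(2)[OF v]] bd_tr_dtr[OF u \<theta>] bd_tr_dtr[OF v \<theta>]
      by (simp add: exit_def)
  qed
  then have "L2_bd_norm \<Omega> (\<lambda>z. bd_tr \<Omega> v z - bd_tr \<Omega> u z) \<le> sqrt (2 * (diameter \<Omega> + 1)\<^sup>2 * ?N\<^sup>2)"
    unfolding L2_bd_norm_def by (rule real_sqrt_le_mono)
  also have "\<dots> = sqrt 2 * (diameter \<Omega> + 1) * ?N"
    using diameter_ge_0[OF bounded_dom] H1_norm_nonneg by (simp add: real_sqrt_mult)
  finally show ?thesis .
qed

lemma continuous_map_bd_tr:
  "continuous_map (subtopology (H1_topology \<Omega>) (H1_tr \<Omega>)) (L2_bd_topology \<Omega>) (bd_tr \<Omega>)"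
proof -
  let ?C = "sqrt 2 * (diameter \<Omega> + 1)"
  have C: "0 < ?C" using diameter_ge_0[OF bounded_dom] by simp
  have sub: "H1_tr \<Omega> \<subseteq> H1 \<Omega>" by (auto simp: H1_tr_def)
  have top: "topspace (subtopology (H1_topology \<Omega>) (H1_tr \<Omega>)) = H1_tr \<Omega>"
    using sub by (auto simp: H1_topology_def topspace_seminorm_topology)
  have "openin (subtopology (H1_topology \<Omega>) (H1_tr \<Omega>)) {u \<in> H1_tr \<Omega>. bd_tr \<Omega> u \<in> U}"
    if U: "openin (L2_bd_topology \<Omega>) U" for U
  proof -
    \<comment> \<open>The preimage must be cut out by a set open in \<open>H1\<close>. All points
      outside \<open>H1_tr\<close> are added to it: they are interior points because
      \<open>H1_tr\<close> is closed.\<close>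
    let ?V = "{v \<in> H1 \<Omega>. v \<in> H1_tr \<Omega> \<longrightarrow> bd_tr \<Omega> v \<in> U}"
    have "openin (H1_topology \<Omega>) ?V"
      unfolding H1_topology_def openin_seminorm_topology
    proof (intro conjI ballI)
      fix u assume u: "u \<in> ?V"
      show "\<exists>e>0. \<forall>v\<in>H1 \<Omega>. H1_norm \<Omega> (\<lambda>x. v x - u x) < e \<longrightarrow> v \<in> ?V"
      proof (cases "u \<in> H1_tr \<Omega>")
        case True
        then have "bd_tr \<Omega> u \<in> U" using u by simp
        then obtain e where e: "0 < e" "\<forall>g\<in>L2_bd \<Omega>. L2_bd_norm \<Omega> (\<lambda>z. g z - bd_tr \<Omega> u z) < e \<longrightarrow> g \<in> U"
          using U unfolding L2_bd_topology_def openin_seminorm_topology by blast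
        have "v \<in> ?V" if v: "v \<in> H1 \<Omega>" "H1_norm \<Omega> (\<lambda>x. v x - u x) < e / ?C" for v
        proof -
          have "bd_tr \<Omega> v \<in> U" if vt: "v \<in> H1_tr \<Omega>"
          proof -
            have "?C * H1_norm \<Omega> (\<lambda>x. v x - u x) < e"
              using v(2) C by (simp add: pos_less_divide_eq mult.commute)
            then have "L2_bd_norm \<Omega> (\<lambda>z. bd_tr \<Omega> v z - bd_tr \<Omega> u z) < e"
              using bd_tr_Lipschitz[OF True vt] by linarith
            moreover have "bd_tr \<Omega> v \<in> L2_bd \<Omega>" using bd_tr(1)[OF vt] by (simp add: is_tr_def)
            ultimately show ?thesis using e(2) by blast
          qed
          then show ?thesis using v(1) by simp
        qed
        moreover have "0 < e / ?C" using e(1) C by simp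
        ultimately show ?thesis by blast
      next
        case False
        then have "u \<in> H1 \<Omega> - H1_tr \<Omega>" using u by simp
        moreover have "openin (H1_topology \<Omega>) (H1 \<Omega> - H1_tr \<Omega>)"
          using closedin_H1_tr by (simp add: closedin_def H1_topology_def topspace_seminorm_topology)
        ultimately show ?thesis
          unfolding H1_topology_def openin_seminorm_topology by blast
      qed
    qed auto
    moreover have "{u \<in> H1_tr \<Omega>. bd_tr \<Omega> u \<in> U} = ?V \<inter> H1_tr \<Omega>" using sub by auto
    ultimately show ?thesis unfolding openin_subtopology by blast
  qed
  moreover have "bd_tr \<Omega> u \<in> L2_bd \<Omega>" if "u \<in> H1_tr \<Omega>" for u
    using bd_tr(1)[OF that] by (simp add: is_tr_def)
  ultimately show ?thesis
    unfolding continuous_map_def top by (auto simp: L2_bd_topology_def topspace_seminorm_topology)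
qed

end

theorem theorem4p6:
  fixes \<Omega> :: "'a::euclidean_space set"
  assumes "open \<Omega>" and "bounded \<Omega>" and "\<Omega> \<noteq> {}"
  shows "closedin (H1_topology \<Omega>) (H1_tr \<Omega>) \<and>
    (H1_topology \<Omega> closure_of H1_C0 \<Omega>) \<subseteq> H1_tr \<Omega> \<and>
    continuous_map (subtopology (H1_topology \<Omega>) (H1_tr \<Omega>)) (L2_bd_topology \<Omega>) (bd_tr \<Omega>) \<and>
    (\<forall>u\<in>H1_tr \<Omega>. \<forall>v\<in>H1_tr \<Omega>. \<forall>\<theta>\<in>sphere 0 1.
       let f = (\<lambda>x. u x * weak_dir_deriv \<Omega> \<theta> v x + v x * weak_dir_deriv \<Omega> \<theta> u x);
           F = (\<lambda>z. (bd_tr \<Omega> u z * bd_tr \<Omega> v z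
                     - bd_tr \<Omega> u (dir_opposite \<Omega> \<theta> z) * bd_tr \<Omega> v (dir_opposite \<Omega> \<theta> z))
                    / norm (z - dir_opposite \<Omega> \<theta> z))
       in integrable (lebesgue_on \<Omega>) f \<and>
          integrable (completion (dir_measure \<Omega> \<theta>)) F \<and>
          (LINT x|lebesgue_on \<Omega>. f x) = (LINT z|completion (dir_measure \<Omega> \<theta>). F z))"
proof -
  interpret bounded_open_domain \<Omega> using assms by unfold_locales
  have "(H1_topology \<Omega> closure_of H1_C0 \<Omega>) \<subseteq> H1_tr \<Omega>"
    by (rule closure_of_minimal[OF H1_C0_subset_H1_tr closedin_H1_tr])
  moreover have "integrable (lebesgue_on \<Omega>) f \<and> integrable (completion (dir_measure \<Omega> \<theta>)) F \<and>
      (LINT x|lebesgue_on \<Omega>. f x) = (LINT z|completion (dir_measure \<Omega> \<theta>). F z)"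
    if u: "u \<in> H1_tr \<Omega>" and v: "v \<in> H1_tr \<Omega>" and \<theta>: "\<theta> \<in> sphere 0 1"
      and f: "f = (\<lambda>x. u x * weak_dir_deriv \<Omega> \<theta> v x + v x * weak_dir_deriv \<Omega> \<theta> u x)"
      and F: "F = (\<lambda>z. (bd_tr \<Omega> u z * bd_tr \<Omega> v z
                     - bd_tr \<Omega> u (dir_opposite \<Omega> \<theta> z) * bd_tr \<Omega> v (dir_opposite \<Omega> \<theta> z))
                    / norm (z - dir_opposite \<Omega> \<theta> z))"
    for u v \<theta> f F
  proof -
    interpret directed_domain \<Omega> \<theta> by (rule directed[OF \<theta>])
    \<comment> \<open>The entry point is the exit point for - \<theta>, so the value of the one
      function \<open>bd_tr\<close> there is governed by the trace condition in the opposite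
      direction.\<close>
    have \<theta>': "- \<theta> \<in> sphere 0 1" using \<theta> by simp
    show ?thesis
      unfolding f F
      using integration_by_parts[OF bd_tr(2)[OF u] bd_tr(2)[OF v]
          bd_tr_dtr[OF u \<theta>, folded exit_def] bd_tr_dtr[OF u \<theta>', folded entry_def]
          bd_tr_dtr[OF v \<theta>, folded exit_def] bd_tr_dtr[OF v \<theta>', folded entry_def]]
      by blast
  qed
  ultimately show ?thesis
    using closedin_H1_tr continuous_map_bd_tr unfolding Let_def by blast
qed

end
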